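(* Let $\mathbb{F}$ be a field of characteristic zero, let $\mathfrak{g}$ be a Lie algebra over $\mathbb{F}$ with a vector space decomposition $\mathfrak{g}=\mathfrak{g}^-\oplus\mathfrak{g}^+$, let $s,t$ be commuting formal variables commuting with $\mathfrak{g}$, and let $\pi^\pm:\mathfrak{g}[[s,t]]\to\mathfrak{g}^\pm[[s,t]]$ be the corresponding projections. Let $h^\pm\in\mathfrak{g}^\pm[[s,t]]$, and let $g^\pm\in\mathfrak{g}^\pm[[s,t]]$ be the unique elements such that $e^{sg^-}e^{tg^+}=e^{sh^-+th^+}$ in $U(\mathfrak{g})[[s,t]]$. Then $$sg^-,\ tg^+\in\mathbb{F}\langle\langle sh^-,th^+;\pi^\pm\rangle\rangle,$$ and $sg^-$ and $tg^+$ are given by the canonical factorization series $F^\pm$: $$sg^-=F^-(sh^-,th^+;\pi^\pm),\qquad tg^+=F^+(sh^-,th^+;\pi^\pm).$$ Moreover, the lowest-order terms in $sg^-$ and $tg^+$ are given by $$sg^-=sh^-+\tfrac12\pi^-([th^+,sh^-])+u^-(s,t),$$ $$tg^+=th^++\tfrac12\pi^+([th^+,sh^-])+u^+(s,t),$$ where $u^\pm(s,t)\in\mathbb{F}\langle\langle sh^-,th^+;\pi^\pm\rangle\rangle^\pm$ are formal (possibly infinite) linear combinations of words involving at least three occurrences of $sh^-$ and $th^+$ (including at least one of each).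
   Context: $\mathfrak{g}[[s,t]]$ is the Lie algebra of formal power series with coefficients in $\mathfrak{g}$, and $U(\mathfrak{g})$ is the universal enveloping algebra. Existence and uniqueness of $g^\pm$ (given $h^\pm$) is a known fact (the factorization theorem). Words. A formal word of bidegree $(m,n)$ in symbols $a,b$ is a formal expression built from $a$ and $b$ by repeatedly applying a bracket $[\cdot,\cdot]$ and the unary operations $\pi^-,\pi^+$, involving exactly $m$ occurrences of $a$ and exactly $n$ occurrences of $b$. It is evaluated at $a=sh^-$, $b=th^+$ using the bracket of $\mathfrak{g}[[s,t]]$ and the projections $\pi^\pm$; a word of bidegree $(m,n)$ then evaluates to an element of $s^mt^n\mathfrak{g}[[s,t]]$. The space $\mathbb{F}\langle\langle sh^-,th^+;\pi^\pm\rangle\rangle\subset\mathfrak{g}[[s,t]]$ is the set of all formal (possibly infinite) linear combinations of such words in $sh^-,th^+$ and $\pi^\pm$, i.e. all sums $\sum_{m,n\ge 0}w_{m,n}$ with $w_{m,n}$ in the $\mathbb{F}$-span of the evaluated words of bidegree $(m,n)$. It is a Lie subalgebra of $\mathfrak{g}[[s,t]]$ stable under $\pi^\pm$, and $\mathbb{F}\langle\langle sh^-,th^+;\pi^\pm\rangle\rangle^\pm$ denotes its intersection with $\mathfrak{g}^\pm[[s,t]]$. Canonical factorization series. Let $C(a,b)=\sum_{j,k\ge 0}H_{j,k}(a,b)\in\mathbb{Q}\langle\langle a,b\rangle\rangle$ be the Campbell-Baker-Hausdorff series (the unique Lie series with $e^ae^b=e^{C(a,b)}$), with $H_{j,k}$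 the Lie polynomial homogeneous of degree $j$ in $a$ and $k$ in $b$, each written as a fixed rational linear combination of iterated brackets. The canonical factorization series $F^\pm(a,b;\pi^\pm)=\sum_{m,n\ge0}F^\pm_{m,n}$ are the universal formal series of words, with $F^\pm_{m,n}$ a rational linear combination of words of bidegree $(m,n)$, independent of $\mathfrak{g}$, $\pi^\pm$ and $h^\pm$, determined recursively by: $F^-_{1,0}=a$, $F^+_{0,1}=b$, all other $F^\pm_{m,n}$ with $m=0$ or $n=0$ are zero, and for $m,n\ge 1$, $$F^-_{m,n}=-\pi^-(l_{m,n}),\qquad F^+_{m,n}=-\pi^+(l_{m,n}),$$ where $l_{m,n}$ is the bidegree $(m,n)$ component of $\sum_{j,k\ge1}H_{j,k}(F^-,F^+)$ (which involves only $F^\pm_{p,q}$ with $p+q<m+n$). $F^\pm(sh^-,th^+;\pi^\pm)$ denotes the evaluation at $a=sh^-$, $b=th^+$; it does not depend on the choice of expressions for the $H_{j,k}$. *)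

theory Defs
  imports
    Complex_Main
    "HOL-Library.Poly_Mapping"
    "HOL-Library.Function_Algebras"
    "HOL-Algebra.QuotRing"
begin

section \<open>Noncommutative formal power series\<close>

text \<open>
  A series in noncommuting variables \<open>'x\<close> is the function sending a monomial (a list of variables)
  to its coefficient. The series of finite support form the free associative algebra on \<open>'x\<close>.
\<close>

typedef ('x, 'k) ncps = "UNIV :: ('x list \<Rightarrow> 'k) set"
  morphisms nc_coeff Abs_ncps ..

setup_lifting type_definition_ncps

lemma ncps_eqI: "(\<And>w. nc_coeff p w = nc_coeff q w) \<Longrightarrow> p = q"
  by (metis ext nc_coeff_inject)

instantiation ncps :: (type, ring_1) ring_1
begin

lift_definition zero_ncps :: "('a, 'b) ncps" is "\<lambda>w. 0" .
lift_definition one_ncps :: "('a, 'b) ncps" is "\<lambda>w. if w = [] then 1 else 0" .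
lift_definition plus_ncps :: "('a, 'b) ncps \<Rightarrow> ('a, 'b) ncps \<Rightarrow> ('a, 'b) ncps"
  is "\<lambda>p q w. p w + q w" .
lift_definition minus_ncps :: "('a, 'b) ncps \<Rightarrow> ('a, 'b) ncps \<Rightarrow> ('a, 'b) ncps"
  is "\<lambda>p q w. p w - q w" .
lift_definition uminus_ncps :: "('a, 'b) ncps \<Rightarrow> ('a, 'b) ncps"
  is "\<lambda>p w. - p w" .
lift_definition times_ncps :: "('a, 'b) ncps \<Rightarrow> ('a, 'b) ncps \<Rightarrow> ('a, 'b) ncps"
  is "\<lambda>p q w. \<Sum>i\<le>length w. p (take i w) * q (drop i w)" .

instance
proof
  fix a b c :: "('a, 'b) ncps"
  show "a * b * c = a * (b * c)"
  proof transfer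
    fix a b c :: "'a list \<Rightarrow> 'b"
    show "(\<lambda>w. \<Sum>i\<le>length w. (\<Sum>k\<le>length (take i w). a (take k (take i w)) * b (drop k (take i w))) * c (drop i w))
        = (\<lambda>w. \<Sum>i\<le>length w. a (take i w) * (\<Sum>k\<le>length (drop i w). b (take k (drop i w)) * c (drop k (drop i w))))"
    proof
      fix w :: "'a list"
      let ?n = "length w"
      have "(\<Sum>i\<le>?n. (\<Sum>k\<le>length (take i w). a (take k (take i w)) * b (drop k (take i w))) * c (drop i w))
          = (\<Sum>i\<le>?n. \<Sum>k\<le>i. a (take k w) * b (drop k (take i w)) * c (drop i w))"
        by (intro sum.cong refl) (auto simp: sum_distrib_right min_def intro!: sum.cong)
      also have "\<dots> = (\<Sum>(i,k)\<in>(SIGMA i:{..?n}. {..i}). a (take k w) * b (drop k (take i w)) * c (drop i w))"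
        by (subst sum.Sigma) auto
      also have "\<dots> = (\<Sum>(k,j)\<in>(SIGMA k:{..?n}. {..?n - k}). a (take k w) * b (take j (drop k w)) * c (drop (k + j) w))"
        by (rule sum.reindex_bij_witness[where j = "\<lambda>(i,k). (k, i - k)" and i = "\<lambda>(k,j). (k + j, k)"])
           (auto simp: drop_take)
      also have "\<dots> = (\<Sum>i\<le>?n. a (take i w) * (\<Sum>k\<le>length (drop i w). b (take k (drop i w)) * c (drop k (drop i w))))"
        by (subst sum.Sigma[symmetric]) (auto simp: sum_distrib_left mult.assoc add.commute)
      finally show "(\<Sum>i\<le>?n. (\<Sum>k\<le>length (take i w). a (take k (take i w)) * b (drop k (take i w))) * c (drop i w))
          = (\<Sum>i\<le>?n. a (take i w) * (\<Sum>k\<le>length (drop i w). b (take k (drop i w)) * c (drop k (drop i w))))" .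
    qed
  qed
  show "1 * a = a"
  proof transfer
    fix a :: "'a list \<Rightarrow> 'b"
    have "(\<Sum>i\<le>length w. (if take i w = [] then 1 else 0) * a (drop i w)) = a w" for w
    proof -
      have "(\<Sum>i\<le>length w. (if take i w = [] then 1 else 0) * a (drop i w))
          = (\<Sum>i\<in>{0}. a (drop i w))"
        by (rule sum.mono_neutral_cong_right) auto
      thus ?thesis by simp
    qed
    thus "(\<lambda>w. \<Sum>i\<le>length w. (if take i w = [] then 1 else 0) * a (drop i w)) = a" by auto
  qed
  show "a * 1 = a"
  proof transfer
    fix a :: "'a list \<Rightarrow> 'b"
    have "(\<Sum>i\<le>length w. a (take i w) * (if drop i w = [] then 1 else 0)) = a w" for w
    proof -
      have "(\<Sum>i\<le>length w. a (take i w) * (if drop i w = [] then 1 else 0))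
          = (\<Sum>i\<in>{length w}. a (take i w))"
        by (rule sum.mono_neutral_cong_right) auto
      thus ?thesis by simp
    qed
    thus "(\<lambda>w. \<Sum>i\<le>length w. a (take i w) * (if drop i w = [] then 1 else 0)) = a" by auto
  qed
  show "(a + b) * c = a * c + b * c" "a * (b + c) = a * b + a * c"
    by (transfer, simp add: algebra_simps sum.distrib)+
  show "(0 :: ('a, 'b) ncps) \<noteq> 1"
    by transfer (metis zero_neq_one)
  show "a + b + c = a + (b + c)" "a + b = b + a" "0 + a = a" "- a + a = 0" "a - b = a + - b"
    by (transfer, simp add: algebra_simps)+
qed

end

lift_definition nc_const :: "'k \<Rightarrow> ('x, 'k::ring_1) ncps" is "\<lambda>c w. if w = [] then c else 0" .
lift_definition nc_var :: "'x \<Rightarrow> ('x, 'k::ring_1) ncps" is "\<lambda>x w. if w = [x] then 1 else 0" .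

text \<open>The exponential of a series without constant term: \<open>X ^ k\<close> only has monomials of length \<open>\<ge> k\<close>.\<close>

definition nc_exp :: "('x, 'k::field_char_0) ncps \<Rightarrow> ('x, 'k) ncps" where
  "nc_exp X = Abs_ncps (\<lambda>w. \<Sum>k\<le>length w. nc_coeff (X ^ k) w / fact k)"


section \<open>Power series in two commuting variables\<close>

text \<open>
  \<open>X i j\<close> is the coefficient of \<open>s\<^sup>i t\<^sup>j\<close>. The library type of formal power series multiplies
  coefficients in a type-class ring, which fits neither a Lie algebra nor the quotient ring
  \<open>U(\<gg>)\<close>. Sums of series below are the pointwise ones of \<^theory>\<open>HOL-Library.Function_Algebras\<close>.
\<close>

type_synonym 'a series = "nat \<Rightarrow> nat \<Rightarrow> 'a"

definition series_in :: "'a set \<Rightarrow> 'a series set" where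
  "series_in A = {X. \<forall>i j. X i j \<in> A}"

definition series_map :: "('a \<Rightarrow> 'b) \<Rightarrow> 'a series \<Rightarrow> 'b series" where
  "series_map f X = (\<lambda>i j. f (X i j))"

definition s_times :: "'a::zero series \<Rightarrow> 'a series" where
  "s_times X = (\<lambda>i j. if i = 0 then 0 else X (i - 1) j)"

definition t_times :: "'a::zero series \<Rightarrow> 'a series" where
  "t_times X = (\<lambda>i j. if j = 0 then 0 else X i (j - 1))"

text \<open>The extension of a biadditive operation to series.\<close>

definition series_bilin :: "('a \<Rightarrow> 'a \<Rightarrow> 'a::comm_monoid_add) \<Rightarrow> 'a series \<Rightarrow> 'a series \<Rightarrow> 'a series" where
  "series_bilin f X Y = (\<lambda>i j. \<Sum>p\<le>i. \<Sum>q\<le>j. f (X p q) (Y (i - p) (j - q)))"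

text \<open>
  \<open>\<Sum>m n. w m n\<close> for \<open>w m n\<close> divisible by \<open>s\<^sup>m t\<^sup>n\<close>: such a term contributes to the coefficient of
  \<open>s\<^sup>i t\<^sup>j\<close> only if \<open>m \<le> i\<close> and \<open>n \<le> j\<close>.
\<close>

definition graded_sum :: "(nat \<Rightarrow> nat \<Rightarrow> 'a::comm_monoid_add series) \<Rightarrow> 'a series" where
  "graded_sum w = (\<lambda>i j. \<Sum>m\<le>i. \<Sum>n\<le>j. w m n i j)"

definition series_ring :: "'r ring \<Rightarrow> 'r series ring" where
  "series_ring R =
    \<lparr>carrier = series_in (carrier R),
     mult = (\<lambda>X Y i j. finsum R (\<lambda>p. finsum R (\<lambda>q. X p q \<otimes>\<^bsub>R\<^esub> Y (i - p) (j - q)) {..j}) {..i}),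
     one = (\<lambda>i j. if i = 0 \<and> j = 0 then \<one>\<^bsub>R\<^esub> else \<zero>\<^bsub>R\<^esub>),
     zero = (\<lambda>i j. \<zero>\<^bsub>R\<^esub>),
     add = (\<lambda>X Y i j. X i j \<oplus>\<^bsub>R\<^esub> Y i j)\<rparr>"


section \<open>Lie algebras and their enveloping algebras\<close>

locale lie_algebra = vector_space scale
  for scale :: "'k::field \<Rightarrow> 'g::ab_group_add \<Rightarrow> 'g" +
  fixes br :: "'g \<Rightarrow> 'g \<Rightarrow> 'g"
  assumes br_add_left: "br (x + y) z = br x z + br y z"
    and br_add_right: "br x (y + z) = br x y + br x z"
    and br_scale_left: "br (scale c x) y = scale c (br x y)"
    and br_scale_right: "br x (scale c y) = scale c (br x y)"
    and br_self: "br x x = 0"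
    and jacobi: "br x (br y z) + br y (br z x) + br z (br x y) = 0"

locale split_lie_algebra = lie_algebra scale br
  for scale :: "'k::field \<Rightarrow> 'g::ab_group_add \<Rightarrow> 'g" and br :: "'g \<Rightarrow> 'g \<Rightarrow> 'g" +
  fixes g_minus g_plus :: "'g set"
  assumes subspace_g_minus: "subspace g_minus"
    and subspace_g_plus: "subspace g_plus"
    and g_minus_Int_g_plus: "g_minus \<inter> g_plus = {0}"
    and g_minus_plus_g_plus: "\<exists>y\<in>g_minus. \<exists>z\<in>g_plus. x = y + z"

text \<open>The projection onto \<open>A\<close> along the complement \<open>B\<close>.\<close>

definition proj_along :: "'g::ab_group_add set \<Rightarrow> 'g set \<Rightarrow> 'g \<Rightarrow> 'g" where
  "proj_along A B x = (THE y. y \<in> A \<and> x - y \<in> B)"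

definition free_algebra :: "('x, 'k::field) ncps ring" where
  "free_algebra = \<lparr>carrier = {p. finite {w. nc_coeff p w \<noteq> 0}}, mult = (*), one = 1, zero = 0, add = (+)\<rparr>"

text \<open>
  The enveloping algebra is the free associative algebra on the set \<open>\<gg>\<close> modulo the two-sided ideal
  generated by the relations below. The first two sets of relations turn the free algebra into the
  tensor algebra of the vector space \<open>\<gg>\<close>.
\<close>

definition uea_relations ::
  "('k::field \<Rightarrow> 'g::ab_group_add \<Rightarrow> 'g) \<Rightarrow> ('g \<Rightarrow> 'g \<Rightarrow> 'g) \<Rightarrow> ('g, 'k) ncps set" where
  "uea_relations scale br =
     {nc_var (x + y) - nc_var x - nc_var y | x y. True} \<union>
     {nc_var (scale c x) - nc_const c * nc_var x | c x. True} \<union>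
     {nc_var x * nc_var y - nc_var y * nc_var x - nc_var (br x y) | x y. True}"

definition uea_ideal ::
  "('k::field \<Rightarrow> 'g::ab_group_add \<Rightarrow> 'g) \<Rightarrow> ('g \<Rightarrow> 'g \<Rightarrow> 'g) \<Rightarrow> ('g, 'k) ncps set" where
  "uea_ideal scale br = Idl\<^bsub>free_algebra\<^esub> (uea_relations scale br)"

definition uea ::
  "('k::field \<Rightarrow> 'g::ab_group_add \<Rightarrow> 'g) \<Rightarrow> ('g \<Rightarrow> 'g \<Rightarrow> 'g) \<Rightarrow> ('g, 'k) ncps set ring" where
  "uea scale br = free_algebra Quot (uea_ideal scale br)"

definition uea_scale ::
  "('k::field \<Rightarrow> 'g::ab_group_add \<Rightarrow> 'g) \<Rightarrow> ('g \<Rightarrow> 'g \<Rightarrow> 'g) \<Rightarrow>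
   'k \<Rightarrow> ('g, 'k) ncps set \<Rightarrow> ('g, 'k) ncps set" where
  "uea_scale scale br c u = (uea_ideal scale br +>\<^bsub>free_algebra\<^esub> nc_const c) \<otimes>\<^bsub>uea scale br\<^esub> u"

definition uea_incl ::
  "('k::field \<Rightarrow> 'g::ab_group_add \<Rightarrow> 'g) \<Rightarrow> ('g \<Rightarrow> 'g \<Rightarrow> 'g) \<Rightarrow> 'g \<Rightarrow> ('g, 'k) ncps set" where
  "uea_incl scale br x = uea_ideal scale br +>\<^bsub>free_algebra\<^esub> nc_var x"

text \<open>
  The exponential in \<open>U(\<gg>)[[s,t]]\<close> of \<open>X \<in> \<gg>[[s,t]]\<close> without constant term; then \<open>X\<^sup>k\<close> only has
  terms of total degree \<open>\<ge> k\<close>.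
\<close>

definition uea_exp ::
  "('k::field_char_0 \<Rightarrow> 'g::ab_group_add \<Rightarrow> 'g) \<Rightarrow> ('g \<Rightarrow> 'g \<Rightarrow> 'g) \<Rightarrow>
   'g series \<Rightarrow> ('g, 'k) ncps set series" where
  "uea_exp scale br X = (\<lambda>i j.
     finsum (uea scale br)
       (\<lambda>k. uea_scale scale br (1 / fact k)
          ((series_map (uea_incl scale br) X [^]\<^bsub>series_ring (uea scale br)\<^esub> k) i j))
       {..i + j})"

lemma nc_coeff_simps [simp]:
  "nc_coeff 0 w = 0"
  "nc_coeff (p + q) w = nc_coeff p w + nc_coeff q w"
  "nc_coeff (p - q) w = nc_coeff p w - nc_coeff q w"
  "nc_coeff (- p) w = - nc_coeff p w"
  by (transfer; simp)+

lemma finite_support_times: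
  fixes p q :: "('x, 'k::ring_1) ncps"
  assumes "finite {w. nc_coeff p w \<noteq> 0}" "finite {w. nc_coeff q w \<noteq> 0}"
  shows "finite {w. nc_coeff (p * q) w \<noteq> 0}"
proof (rule finite_subset)
  show "{w. nc_coeff (p * q) w \<noteq> 0} \<subseteq>
      (\<lambda>(u, v). u @ v) ` ({w. nc_coeff p w \<noteq> 0} \<times> {w. nc_coeff q w \<noteq> 0})"
  proof
    fix w assume "w \<in> {w. nc_coeff (p * q) w \<noteq> 0}"
    then have "(\<Sum>i\<le>length w. nc_coeff p (take i w) * nc_coeff q (drop i w)) \<noteq> 0"
      by (simp add: times_ncps.rep_eq)
    then obtain i where "nc_coeff p (take i w) * nc_coeff q (drop i w) \<noteq> 0"
      by (metis (no_types, lifting) sum.neutral)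
    then have "nc_coeff p (take i w) \<noteq> 0" "nc_coeff q (drop i w) \<noteq> 0"
      by auto
    then show "w \<in> (\<lambda>(u, v). u @ v) ` ({w. nc_coeff p w \<noteq> 0} \<times> {w. nc_coeff q w \<noteq> 0})"
      by (intro image_eqI[where x = "(take i w, drop i w)"]) auto
  qed
qed (use assms in auto)

lemma finite_support_add:
  fixes p q :: "('x, 'k::ring_1) ncps"
  assumes "finite {w. nc_coeff p w \<noteq> 0}" "finite {w. nc_coeff q w \<noteq> 0}"
  shows "finite {w. nc_coeff (p + q) w \<noteq> 0}" "finite {w. nc_coeff (p - q) w \<noteq> 0}"
  by (rule finite_subset[OF _ finite_UnI[OF assms]]; auto)+

lemma finite_support_const: "finite {w. nc_coeff (nc_const c) w \<noteq> 0}"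
  by (rule finite_subset[of _ "{[]}"]) (auto simp: nc_const.rep_eq)

lemma finite_support_one: "finite {w. nc_coeff (1 :: ('x, 'k::ring_1) ncps) w \<noteq> 0}"
  by (rule finite_subset[of _ "{[]}"]) (auto simp: one_ncps.rep_eq)

lemma finite_support_var: "finite {w. nc_coeff (nc_var x) w \<noteq> 0}"
  by (rule finite_subset[of _ "{[x]}"]) (auto simp: nc_var.rep_eq)

lemma ring_free_algebra: "ring (free_algebra :: ('x, 'k::field) ncps ring)"
proof (rule ringI)
  show "abelian_group (free_algebra :: ('x, 'k) ncps ring)"
  proof (rule abelian_groupI)
    fix x assume "x \<in> carrier (free_algebra :: ('x, 'k) ncps ring)"
    then show "\<exists>y\<in>carrier free_algebra. y \<oplus>\<^bsub>free_algebra\<^esub> x = \<zero>\<^bsub>free_algebra\<^esub>"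
      by (intro bexI[of _ "- x"]) (auto simp: free_algebra_def)
  qed (auto simp: free_algebra_def finite_support_add add_ac simp del: nc_coeff_simps(2))
  show "monoid (free_algebra :: ('x, 'k) ncps ring)"
    by (rule monoidI)
       (auto simp: free_algebra_def finite_support_times finite_support_one mult.assoc)
qed (auto simp: free_algebra_def algebra_simps)

lemma uea_relations_closed: "uea_relations scale br \<subseteq> carrier free_algebra"
  by (auto simp: uea_relations_def free_algebra_def finite_support_add finite_support_times
      finite_support_const finite_support_var simp del: nc_coeff_simps)

lemma ideal_uea_ideal: "ideal (uea_ideal scale br) free_algebra"
  unfolding uea_ideal_def by (rule ring.genideal_ideal[OF ring_free_algebra uea_relations_closed])

lemma ring_uea: "ring (uea scale br)"
  unfolding uea_def by (rule ideal.quotient_is_ring[OF ideal_uea_ideal])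


section \<open>The Campbell-Baker-Hausdorff series\<close>

datatype lie_word = LieA | LieB | LieBr lie_word lie_word

primrec lie_count_a :: "lie_word \<Rightarrow> nat" where
  "lie_count_a LieA = 1"
| "lie_count_a LieB = 0"
| "lie_count_a (LieBr u v) = lie_count_a u + lie_count_a v"

primrec lie_count_b :: "lie_word \<Rightarrow> nat" where
  "lie_count_b LieA = 0"
| "lie_count_b LieB = 1"
| "lie_count_b (LieBr u v) = lie_count_b u + lie_count_b v"

primrec lie_eval :: "('l \<Rightarrow> 'l \<Rightarrow> 'l) \<Rightarrow> 'l \<Rightarrow> 'l \<Rightarrow> lie_word \<Rightarrow> 'l" where
  "lie_eval f x y LieA = x"
| "lie_eval f x y LieB = y"
| "lie_eval f x y (LieBr u v) = f (lie_eval f x y u) (lie_eval f x y v)"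

text \<open>The value of a rational linear combination of words, given the values \<open>f\<close> of the words and
  the scalar multiplication \<open>sc\<close> of the target.\<close>

definition lincomb :: "(rat \<Rightarrow> 'm \<Rightarrow> 'm::comm_monoid_add) \<Rightarrow> ('w \<Rightarrow> 'm) \<Rightarrow> ('w \<Rightarrow>\<^sub>0 rat) \<Rightarrow> 'm" where
  "lincomb sc f p = (\<Sum>w\<in>Poly_Mapping.keys p. sc (Poly_Mapping.lookup p w) (f w))"

datatype letter = Letter_a | Letter_b

definition nc_lie_poly :: "(lie_word \<Rightarrow>\<^sub>0 rat) \<Rightarrow> (letter, rat) ncps" where
  "nc_lie_poly = lincomb (\<lambda>r p. nc_const r * p)
     (lie_eval (\<lambda>p q. p * q - q * p) (nc_var Letter_a) (nc_var Letter_b))"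

text \<open>
  \<open>H j k\<close> is an expression, as a rational linear combination of iterated brackets, for the component
  of bidegree \<open>(j, k)\<close> of the Campbell-Baker-Hausdorff series \<open>C = (\<Sum>j k. H j k)\<close>. In the
  coefficient of the monomial \<open>w\<close> in \<open>C\<close>, only \<open>j, k\<close> with \<open>j + k = length w\<close> contribute.
\<close>

definition cbh_expression :: "(nat \<Rightarrow> nat \<Rightarrow> lie_word \<Rightarrow>\<^sub>0 rat) \<Rightarrow> bool" where
  "cbh_expression H \<longleftrightarrow>
     (\<forall>j k. \<forall>w\<in>Poly_Mapping.keys (H j k). lie_count_a w = j \<and> lie_count_b w = k) \<and>
     nc_exp (nc_var Letter_a) * nc_exp (nc_var Letter_b) =
     nc_exp (Abs_ncps (\<lambda>w. \<Sum>j\<le>length w. \<Sum>k\<le>length w. nc_coeff (nc_lie_poly (H j k)) w))"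


section \<open>Words and the canonical factorization series\<close>

datatype word = WordA | WordB | WordBr word word | WordPm word | WordPp word

primrec count_a :: "word \<Rightarrow> nat" where
  "count_a WordA = 1"
| "count_a WordB = 0"
| "count_a (WordBr u v) = count_a u + count_a v"
| "count_a (WordPm u) = count_a u"
| "count_a (WordPp u) = count_a u"

primrec count_b :: "word \<Rightarrow> nat" where
  "count_b WordA = 0"
| "count_b WordB = 1"
| "count_b (WordBr u v) = count_b u + count_b v"
| "count_b (WordPm u) = count_b u"
| "count_b (WordPp u) = count_b u"

text \<open>The linear extensions of \<open>\<pi>\<^sup>\<plusminus>\<close> and the bilinear extension of the bracket to formal linear
  combinations of words.\<close>

definition word_map :: "(word \<Rightarrow> word) \<Rightarrow> (word \<Rightarrow>\<^sub>0 rat) \<Rightarrow> (word \<Rightarrow>\<^sub>0 rat)" where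
  "word_map f p = (\<Sum>w\<in>Poly_Mapping.keys p. Poly_Mapping.single (f w) (Poly_Mapping.lookup p w))"

definition word_br :: "(word \<Rightarrow>\<^sub>0 rat) \<Rightarrow> (word \<Rightarrow>\<^sub>0 rat) \<Rightarrow> (word \<Rightarrow>\<^sub>0 rat)" where
  "word_br p q = (\<Sum>u\<in>Poly_Mapping.keys p. \<Sum>v\<in>Poly_Mapping.keys q.
     Poly_Mapping.single (WordBr u v) (Poly_Mapping.lookup p u * Poly_Mapping.lookup q v))"

text \<open>
  A formal series of words is given by its components of bidegree \<open>(m, n)\<close>, so it has type
  \<^typ>\<open>(word \<Rightarrow>\<^sub>0 rat) series\<close>, with the bracket of two series being given by
  \<^term>\<open>series_bilin word_br\<close>.
\<close>

definition word_lie_poly ::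
  "(word \<Rightarrow>\<^sub>0 rat) series \<Rightarrow> (word \<Rightarrow>\<^sub>0 rat) series \<Rightarrow> (lie_word \<Rightarrow>\<^sub>0 rat) \<Rightarrow> (word \<Rightarrow>\<^sub>0 rat) series" where
  "word_lie_poly X Y =
     lincomb (\<lambda>r. series_map (Poly_Mapping.map ((*) r))) (lie_eval (series_bilin word_br) X Y)"

text \<open>
  The component of bidegree \<open>(m, n)\<close> of \<open>\<Sum>j k. H j k (X, Y)\<close> over \<open>j, k \<ge> 1\<close>. When all components
  of \<open>X\<close> have \<open>m \<ge> 1\<close> and all components of \<open>Y\<close> have \<open>n \<ge> 1\<close>, the omitted terms with \<open>j > m\<close> or
  \<open>k > n\<close> vanish.
\<close>

definition bracket_part ::
  "(nat \<Rightarrow> nat \<Rightarrow> lie_word \<Rightarrow>\<^sub>0 rat) \<Rightarrow> (word \<Rightarrow>\<^sub>0 rat) series \<Rightarrow> (word \<Rightarrow>\<^sub>0 rat) series \<Rightarrow>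
   nat \<Rightarrow> nat \<Rightarrow> (word \<Rightarrow>\<^sub>0 rat)" where
  "bracket_part H X Y m n = (\<Sum>j = 1..m. \<Sum>k = 1..n. word_lie_poly X Y (H j k) m n)"

text \<open>
  The canonical factorization series. The restriction to \<open>p + q < m + n\<close> makes the recursion
  well-founded. It does not change the values, by \<open>F_recursion\<close> below.
\<close>

function (sequential)
  F_minus F_plus :: "(nat \<Rightarrow> nat \<Rightarrow> lie_word \<Rightarrow>\<^sub>0 rat) \<Rightarrow> nat \<Rightarrow> nat \<Rightarrow> (word \<Rightarrow>\<^sub>0 rat)" where
  "F_minus H m n =
     (if m = 0 \<or> n = 0 then if m = 1 \<and> n = 0 then Poly_Mapping.single WordA 1 else 0
      else - word_map WordPm (bracket_part H
              (\<lambda>p q. if p + q < m + n then F_minus H p q else 0)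
              (\<lambda>p q. if p + q < m + n then F_plus H p q else 0) m n))"
| "F_plus H m n =
     (if m = 0 \<or> n = 0 then if m = 0 \<and> n = 1 then Poly_Mapping.single WordB 1 else 0
      else - word_map WordPp (bracket_part H
              (\<lambda>p q. if p + q < m + n then F_minus H p q else 0)
              (\<lambda>p q. if p + q < m + n then F_plus H p q else 0) m n))"
  by pat_completeness auto
termination
  by (relation "measure (\<lambda>x. case x of Inl (H, m, n) \<Rightarrow> m + n | Inr (H, m, n) \<Rightarrow> m + n)") auto

declare F_minus.simps [simp del] F_plus.simps [simp del]

lemma word_br_zero [simp]: "word_br 0 q = 0" "word_br p 0 = 0"
  by (auto simp: word_br_def)

lemma series_bilin_apply:
  "series_bilin f X Y i j = (\<Sum>p\<le>i. \<Sum>q\<le>j. f (X p q) (Y (i - p) (j - q)))"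
  by (simp add: series_bilin_def)

lemma lincomb_series_apply:
  fixes f :: "'w \<Rightarrow> 'b::comm_monoid_add series"
  shows "lincomb (\<lambda>r. series_map (g r)) f p m n =
     (\<Sum>w\<in>Poly_Mapping.keys p. g (Poly_Mapping.lookup p w) (f w m n))"
proof -
  have "(\<Sum>w\<in>A. h w) m n = (\<Sum>w\<in>A. h w m n)" for A :: "'w set" and h :: "'w \<Rightarrow> 'b::comm_monoid_add series"
    by (induction A rule: infinite_finite_induct) auto
  then show ?thesis
    by (simp add: lincomb_def series_map_def)
qed

lemma lie_eval_below:
  assumes "\<And>m n. m = 0 \<Longrightarrow> X m n = 0" "\<And>m n. n = 0 \<Longrightarrow> Y m n = 0"
    and "m < lie_count_a w \<or> n < lie_count_b w"
  shows "lie_eval (series_bilin word_br) X Y w m n = 0"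
  using assms(3)
proof (induction w arbitrary: m n)
  case (LieBr u v)
  have "word_br (lie_eval (series_bilin word_br) X Y u p q)
          (lie_eval (series_bilin word_br) X Y v (m - p) (n - q)) = 0" if "p \<le> m" "q \<le> n" for p q
  proof (cases "p < lie_count_a u \<or> q < lie_count_b u")
    case True
    then show ?thesis using LieBr.IH(1) by simp
  next
    case False
    then have "m - p < lie_count_a v \<or> n - q < lie_count_b v"
      using LieBr.prems that by auto
    then show ?thesis using LieBr.IH(2) by simp
  qed
  then show ?case by (simp add: series_bilin_apply[of _ "lie_eval _ _ _ _"])
qed (use assms(1,2) in auto)

lemma lie_eval_00:
  assumes "X 0 0 = 0" "Y 0 0 = 0"
  shows "lie_eval (series_bilin word_br) X Y w 0 0 = 0"
  by (induction w) (auto simp: assms series_bilin_apply)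

lemma lie_eval_agree:
  assumes "X 0 0 = 0" "Y 0 0 = 0" "X' 0 0 = 0" "Y' 0 0 = 0"
    and "\<And>p q. p + q < d \<Longrightarrow> X p q = X' p q" "\<And>p q. p + q < d \<Longrightarrow> Y p q = Y' p q"
    and "m + n < d \<or> m + n \<le> d \<and> (\<exists>u v. w = LieBr u v)"
  shows "lie_eval (series_bilin word_br) X Y w m n = lie_eval (series_bilin word_br) X' Y' w m n"
  using assms(7)
proof (induction w arbitrary: m n)
  case (LieBr u v)
  let ?e = "lie_eval (series_bilin word_br) X Y" and ?e' = "lie_eval (series_bilin word_br) X' Y'"
  have le: "m + n \<le> d"
    using LieBr.prems by auto
  have "word_br (?e u p q) (?e v (m - p) (n - q)) = word_br (?e' u p q) (?e' v (m - p) (n - q))"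
    if pq: "p \<le> m" "q \<le> n" for p q
  proof -
    consider "p = 0" "q = 0" | "m - p = 0" "n - q = 0" | "p + q < d" "(m - p) + (n - q) < d"
      using le pq by atomize_elim presburger
    then show ?thesis
      by cases (use LieBr.IH lie_eval_00 assms(1-4) in auto)
  qed
  then show ?case by (simp add: series_bilin_apply[of _ "lie_eval _ _ _ _"])
qed (use assms in auto)

lemma F_minus_boundary: "m = 0 \<or> n = 0 \<Longrightarrow>
    F_minus H m n = (if m = 1 \<and> n = 0 then Poly_Mapping.single WordA 1 else 0)"
  and F_plus_boundary: "m = 0 \<or> n = 0 \<Longrightarrow>
    F_plus H m n = (if m = 0 \<and> n = 1 then Poly_Mapping.single WordB 1 else 0)"
  by (subst F_minus.simps F_plus.simps, auto)+

lemma bracket_part_truncate: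
  assumes H: "\<forall>j k. \<forall>w\<in>Poly_Mapping.keys (H j k). lie_count_a w = j \<and> lie_count_b w = k"
  shows "bracket_part H (\<lambda>p q. if p + q < m + n then F_minus H p q else 0)
            (\<lambda>p q. if p + q < m + n then F_plus H p q else 0) m n =
         bracket_part H (F_minus H) (F_plus H) m n"
  unfolding bracket_part_def word_lie_poly_def lincomb_series_apply
proof (intro sum.cong refl, rule arg_cong[where f = "Poly_Mapping.map _"])
  fix j k w assume jk: "j \<in> {1..m}" "k \<in> {1..n}" and w: "w \<in> Poly_Mapping.keys (H j k)"
  have "\<exists>u v. w = LieBr u v"
    using H w jk by (cases w) fastforce+
  then show "lie_eval (series_bilin word_br) (\<lambda>p q. if p + q < m + n then F_minus H p q else 0)
            (\<lambda>p q. if p + q < m + n then F_plus H p q else 0) w m n =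
      lie_eval (series_bilin word_br) (F_minus H) (F_plus H) w m n"
    by (intro lie_eval_agree[where d = "m + n"]) (auto simp: F_minus_boundary F_plus_boundary)
qed

lemma F_recursion:
  assumes "\<forall>j k. \<forall>w\<in>Poly_Mapping.keys (H j k). lie_count_a w = j \<and> lie_count_b w = k"
    and "m \<ge> 1" "n \<ge> 1"
  shows "F_minus H m n = - word_map WordPm (bracket_part H (F_minus H) (F_plus H) m n)"
    and "F_plus H m n = - word_map WordPp (bracket_part H (F_minus H) (F_plus H) m n)"
  using assms(2,3) by (subst F_minus.simps F_plus.simps, simp add: bracket_part_truncate[OF assms(1)])+

lemma bracket_part_omitted_terms:
  assumes "\<forall>j k. \<forall>w\<in>Poly_Mapping.keys (H j k). lie_count_a w = j \<and> lie_count_b w = k"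
    and "j > m \<or> k > n"
  shows "word_lie_poly (F_minus H) (F_plus H) (H j k) m n = 0"
  unfolding word_lie_poly_def lincomb_series_apply
proof (intro sum.neutral ballI)
  fix w assume "w \<in> Poly_Mapping.keys (H j k)"
  then have "lie_eval (series_bilin word_br) (F_minus H) (F_plus H) w m n = 0"
    using assms by (intro lie_eval_below) (auto simp: F_minus_boundary F_plus_boundary)
  then show "Poly_Mapping.map ((*) (Poly_Mapping.lookup (H j k) w))
      (lie_eval (series_bilin word_br) (F_minus H) (F_plus H) w m n) = 0"
    by (metis Poly_Mapping.map_eq_zero_iff Poly_Mapping.keys_zero empty_iff)
qed


section \<open>Evaluation of words\<close>

definition series_scale :: "('k \<Rightarrow> 'g \<Rightarrow> 'g) \<Rightarrow> 'k \<Rightarrow> 'g series \<Rightarrow> 'g series" where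
  "series_scale scale c = series_map (scale c)"

primrec word_eval ::
  "('g::ab_group_add \<Rightarrow> 'g \<Rightarrow> 'g) \<Rightarrow> 'g set \<Rightarrow> 'g set \<Rightarrow> 'g series \<Rightarrow> 'g series \<Rightarrow> word \<Rightarrow> 'g series" where
  "word_eval br g_minus g_plus x y WordA = x"
| "word_eval br g_minus g_plus x y WordB = y"
| "word_eval br g_minus g_plus x y (WordBr u v) =
     series_bilin br (word_eval br g_minus g_plus x y u) (word_eval br g_minus g_plus x y v)"
| "word_eval br g_minus g_plus x y (WordPm u) = series_map (proj_along g_minus g_plus) (word_eval br g_minus g_plus x y u)"
| "word_eval br g_minus g_plus x y (WordPp u) = series_map (proj_along g_plus g_minus) (word_eval br g_minus g_plus x y u)"

text \<open>The value of a formal series \<open>F\<close> of words at \<open>x \<in> s \<gg>[[s,t]]\<close> and \<open>y \<in> t \<gg>[[s,t]]\<close>.\<close>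

definition word_series_eval ::
  "('k::field_char_0 \<Rightarrow> 'g::ab_group_add \<Rightarrow> 'g) \<Rightarrow> ('g \<Rightarrow> 'g \<Rightarrow> 'g) \<Rightarrow> 'g set \<Rightarrow> 'g set \<Rightarrow>
   'g series \<Rightarrow> 'g series \<Rightarrow> (word \<Rightarrow>\<^sub>0 rat) series \<Rightarrow> 'g series" where
  "word_series_eval scale br g_minus g_plus x y F =
     graded_sum (\<lambda>m n. lincomb (\<lambda>r. series_scale scale (of_rat r)) (word_eval br g_minus g_plus x y) (F m n))"

text \<open>
  The (possibly infinite) linear combinations, with coefficients in the ground field, of words in
  \<open>x \<in> s \<gg>[[s,t]]\<close> and \<open>y \<in> t \<gg>[[s,t]]\<close> whose bidegrees belong to \<open>D\<close>.
\<close>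

definition word_space_on ::
  "(nat \<times> nat) set \<Rightarrow> ('k::field_char_0 \<Rightarrow> 'g::ab_group_add \<Rightarrow> 'g) \<Rightarrow> ('g \<Rightarrow> 'g \<Rightarrow> 'g) \<Rightarrow> 'g set \<Rightarrow> 'g set \<Rightarrow>
   'g series \<Rightarrow> 'g series \<Rightarrow> 'g series set" where
  "word_space_on D scale br g_minus g_plus x y =
     {graded_sum w | w. \<forall>m n. w m n \<in> module.span (series_scale scale)
        {word_eval br g_minus g_plus x y u | u. count_a u = m \<and> count_b u = n \<and> (m, n) \<in> D}}"

abbreviation word_space ::
  "('k::field_char_0 \<Rightarrow> 'g::ab_group_add \<Rightarrow> 'g) \<Rightarrow> ('g \<Rightarrow> 'g \<Rightarrow> 'g) \<Rightarrow> 'g set \<Rightarrow> 'g set \<Rightarrow>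
   'g series \<Rightarrow> 'g series \<Rightarrow> 'g series set" where
  "word_space \<equiv> word_space_on UNIV"

end

theory Submission
  imports Defs "HOL-Computational_Algebra.Formal_Power_Series"
begin

text \<open>
  The embedding \<open>\<gg> \<rightarrow> U(\<gg>)\<close> is injective (the part of the Poincare-Birkhoff-Witt theorem that is needed),
  and the exponential is injective on series without constant term. Mapping the free identity
  \<open>e\<^sup>a e\<^sup>b = e\<^sup>C\<close> to \<open>U(\<gg>)[[s,t]]\<close>, one sees that \<open>e\<^sup>X e\<^sup>Y = e\<^sup>Z\<close> implies
  \<open>C(X, Y) = Z\<close> in \<open>\<gg>[[s,t]]\<close>. So \<open>X = s g\<^sup>-\<close> and \<open>Y = t g\<^sup>+\<close> satisfy
  \<open>X + Y = s h\<^sup>- + t h\<^sup>+ - (\<Sum>j, k \<ge> 1. H j k (X, Y))\<close>. By its recursion, the evaluated canonical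
  factorization series solves the same equation. The solution is unique: the brackets on the right only
  involve lower degrees, and the decomposition \<open>\<gg> = \<gg>\<^sup>- \<oplus> \<gg>\<^sup>+\<close> separates \<open>X\<close> from \<open>Y\<close>. The terms
  of lowest order come from \<open>H 1 1 (a, b) = [a, b] / 2\<close>.
\<close>

section \<open>Injectivity of the embedding into the enveloping algebra\<close>

text \<open>Two obstacles shape the proof. The hypothesis is an equation in \<open>uea\<close>, a
  quotient by generators and relations, and it says nothing about \<gg> as long as this quotient
  might identify elements of \<gg>. As \<gg> is arbitrary, possibly of infinite dimension, a map
  back from U(\<gg>) to \<gg> is built by hand: words in a linearly ordered basis are sorted by the
  rule x y = y x + [x, y]. The result must not depend on the order of the exchanges, and the only
  nontrivial case of this is the Jacobi identity. The second obstacle is that exponentials and C are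
  infinite sums, while sums in a ring are finite. Everything is therefore computed modulo an ideal
  that contains both the relations of U(\<gg>) and all terms of total degree above a bound N. There
  the monomials of length above N vanish, the exponential is a polynomial, and equality of two
  exponentials can be traced back to the exponents degree by degree. Since each coefficient of a
  series is reached by some N, nothing is lost.\<close>

fun inversions :: "('a \<Rightarrow> 'a \<Rightarrow> bool) \<Rightarrow> 'a list \<Rightarrow> nat" where
  "inversions lt [] = 0"
| "inversions lt (x # xs) = length (filter (\<lambda>y. lt y x) xs) + inversions lt xs"

text \<open>Only the exchanged pair changes its relative order. The count both bounds the recursion
  of \<open>straighten\<close> and orders the induction behind its confluence.\<close>

lemma inversions_swap:
  assumes "lt y x" "\<not> lt x y"
  shows "inversions lt (u @ x # y # v) = Suc (inversions lt (u @ y # x # v))"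
  using assms by (induction u) auto

context lie_algebra
begin

lemma br_antisym: "br x y = - br y x"
proof -
  have "br (x + y) (x + y) = (br x x + br y x) + (br x y + br y y)"
    by (simp only: br_add_left br_add_right)
  then show ?thesis
    by (simp add: br_self eq_neg_iff_add_eq_0 add.commute)
qed

lemma br_uminus_right: "br x (- y) = - br x y"
  using br_scale_right[of x "-1" y] by simp

end

locale lie_algebra_basis = lie_algebra scale br
  for scale :: "'k::field \<Rightarrow> 'g::ab_group_add \<Rightarrow> 'g" and br :: "'g \<Rightarrow> 'g \<Rightarrow> 'g" +
  fixes B :: "'g set" and lt :: "'g \<Rightarrow> 'g \<Rightarrow> bool"
  assumes independent_B: "independent B" and span_B: "span B = UNIV"
    and lt_asym: "lt x y \<Longrightarrow> \<not> lt y x" and lt_total: "x \<noteq> y \<Longrightarrow> lt x y \<or> lt y x"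
    and lt_trans: "lt x y \<Longrightarrow> lt y z \<Longrightarrow> lt x z"
begin

lemma B_induct [case_names basis add scale zero]:
  assumes "\<And>b. b \<in> B \<Longrightarrow> P b" "\<And>x y. P x \<Longrightarrow> P y \<Longrightarrow> P (x + y)" "\<And>c x. P x \<Longrightarrow> P (scale c x)" "P 0"
  shows "P x"
proof -
  have "x \<in> span B" using span_B by simp
  then show ?thesis
    by (induction rule: span_induct_alt) (use assms in auto)
qed

section \<open>Multilinear extension from basis words\<close>

definition lin_ext :: "('g \<Rightarrow> 'g) \<Rightarrow> 'g \<Rightarrow> 'g" where
  "lin_ext f x = (\<Sum>z | representation B x z \<noteq> 0. scale (representation B x z) (f z))"

lemma lin_ext_superset:
  assumes "finite S" "{z. representation B x z \<noteq> 0} \<subseteq> S"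
  shows "lin_ext f x = (\<Sum>z\<in>S. scale (representation B x z) (f z))"
  unfolding lin_ext_def using assms by (intro sum.mono_neutral_left) auto

lemma lin_ext_add: "lin_ext f (x + y) = lin_ext f x + lin_ext f y"
proof -
  let ?S = "{z. representation B x z \<noteq> 0} \<union> {z. representation B y z \<noteq> 0}"
  have r: "representation B (x + y) = (\<lambda>z. representation B x z + representation B y z)"
    using independent_B span_B by (intro representation_add) auto
  have "finite ?S" using finite_representation by blast
  moreover have "{z. representation B (x + y) z \<noteq> 0} \<subseteq> ?S" unfolding r by auto
  ultimately show ?thesis
    by (simp add: lin_ext_superset[of ?S] r scale_left_distrib sum.distrib)
qed

lemma lin_ext_scale: "lin_ext f (scale c x) = scale c (lin_ext f x)"
proof -
  let ?S = "{z. representation B x z \<noteq> 0}"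
  have r: "representation B (scale c x) = (\<lambda>z. c * representation B x z)"
    using independent_B span_B by (intro representation_scale) auto
  have "finite ?S" using finite_representation by blast
  moreover have "{z. representation B (scale c x) z \<noteq> 0} \<subseteq> ?S" unfolding r by auto
  ultimately show ?thesis
    by (simp add: lin_ext_superset[of ?S] r scale_sum_right)
qed

lemma lin_ext_basis: "b \<in> B \<Longrightarrow> lin_ext f b = f b"
  using independent_B
  by (subst lin_ext_superset[of "{b}"]) (auto simp: representation_basis)

lemma lin_ext_fun_add: "lin_ext (\<lambda>z. f z + g z) x = lin_ext f x + lin_ext g x"
  by (simp add: lin_ext_def scale_right_distrib sum.distrib)

lemma lin_ext_fun_scale: "lin_ext (\<lambda>z. scale c (f z)) x = scale c (lin_ext f x)"
  by (simp add: lin_ext_def scale_sum_right mult.commute)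

text \<open>The generators of \<open>free_algebra\<close> are all elements of \<gg>, not only those
  of \<open>B\<close>. Expanding each letter in the basis carries a function on basis words over to
  all words.\<close>

primrec multilin_ext :: "('g list \<Rightarrow> 'g) \<Rightarrow> 'g list \<Rightarrow> 'g" where
  "multilin_ext f [] = f []"
| "multilin_ext f (x # xs) = lin_ext (\<lambda>z. multilin_ext (\<lambda>zs. f (z # zs)) xs) x"

lemma multilin_ext_add:
  "multilin_ext f (u @ (x + y) # v) = multilin_ext f (u @ x # v) + multilin_ext f (u @ y # v)"
  by (induction u arbitrary: f) (auto simp: lin_ext_add lin_ext_fun_add)

lemma multilin_ext_scale:
  "multilin_ext f (u @ scale c x # v) = scale c (multilin_ext f (u @ x # v))"
  by (induction u arbitrary: f) (auto simp: lin_ext_scale lin_ext_fun_scale)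

lemma multilin_ext_zero: "multilin_ext f (u @ 0 # v) = 0"
  using multilin_ext_scale[of f u 0 0 v] by simp

lemma multilin_ext_uminus: "multilin_ext f (u @ (- x) # v) = - multilin_ext f (u @ x # v)"
  using multilin_ext_scale[of f u "-1" x v] by simp

lemma multilin_ext_basis: "set xs \<subseteq> B \<Longrightarrow> multilin_ext f xs = f xs"
  by (induction xs arbitrary: f) (auto simp: lin_ext_basis)

lemma multilin_ext_basis_append:
  "set u \<subseteq> B \<Longrightarrow> multilin_ext f (u @ xs) = multilin_ext (\<lambda>zs. f (u @ zs)) xs"
  by (induction u arbitrary: f) (auto simp: lin_ext_basis)

text \<open>Used to read the \<open>lin_ext\<close> term in the recursion of
  \<open>straighten\<close> as the value of \<open>strn\<close> at a word that has the bracket as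
  one of its letters.\<close>

lemma multilin_ext_slot:
  assumes "set u \<subseteq> B" "set v \<subseteq> B"
  shows "multilin_ext f (u @ x # v) = lin_ext (\<lambda>z. f (u @ z # v)) x"
  using assms by (simp add: multilin_ext_basis_append multilin_ext_basis)

text \<open>Reduces a multilinear identity to basis words: the rules \<open>add\<close>,
  \<open>scale\<close> and \<open>zero\<close> express its linearity in one slot of a word of fixed
  length.\<close>

lemma basis_lists_induct [case_names basis add scale zero]:
  assumes "\<And>u. length u = n \<Longrightarrow> set u \<subseteq> B \<Longrightarrow> P u"
    and "\<And>u x y v. length (u @ x # v) = n \<Longrightarrow> P (u @ x # v) \<Longrightarrow> P (u @ y # v) \<Longrightarrow> P (u @ (x + y) # v)"
    and "\<And>u c x v. length (u @ x # v) = n \<Longrightarrow> P (u @ x # v) \<Longrightarrow> P (u @ scale c x # v)"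
    and "\<And>u v. length (u @ 0 # v) = n \<Longrightarrow> P (u @ 0 # v)"
    and "length u = n"
  shows "P u"
proof -
  \<comment> \<open>Letters are treated from left to right. One that has been reduced to a basis
    vector moves into the prefix \<open>p\<close>, which is therefore kept arbitrary.\<close>
  have "P (p @ u)" if "\<And>v. length v = length u \<Longrightarrow> set v \<subseteq> B \<Longrightarrow> P (p @ v)" "length (p @ u) = n" for p u
    using that
  proof (induction u arbitrary: p)
    case (Cons x u)
    show ?case
    proof (induction x rule: B_induct)
      case (basis b)
      have "P ((p @ [b]) @ u)"
      proof (rule Cons.IH)
        fix v assume "length v = length u" "set v \<subseteq> B"
        then show "P ((p @ [b]) @ v)" using Cons.prems(1)[of "b # v"] basis by simp
      qed (use Cons.prems in auto)
      then show ?case by simp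
    qed (use assms(2-4) Cons.prems in auto)
  qed auto
  from this[of u "[]"] show ?thesis using assms(1,5) by simp
qed

section \<open>Straightening of words and its confluence\<close>

definition descent :: "'g list \<Rightarrow> 'g list \<times> 'g \<times> 'g \<times> 'g list \<Rightarrow> bool" where
  "descent w d = (case d of (u, x, y, v) \<Rightarrow> w = u @ x # y # v \<and> lt y x)"

lemma descent_measures:
  assumes "descent w (u, x, y, v)"
  shows "(u @ y # x # v, w) \<in> measures [length, inversions lt]"
    and "(u @ z # v, w) \<in> measures [length, inversions lt]"
  using assms by (auto simp: descent_def inversions_swap lt_asym)

text \<open>
  The reduction happens at an arbitrary descent (by \<open>SOME\<close>); independence of the choice is confluence,
  proved below. Of the words without descents only the single letters are kept, which turns the normal form
  map of the Poincare-Birkhoff-Witt theorem into a linear retraction onto \<open>\<gg>\<close>. The tests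
  \<open>descent w (u, x, y, v)\<close> on the right are redundant and only serve termination.
\<close>

function straighten :: "'g list \<Rightarrow> 'g" where
  "straighten w = (if \<exists>d. descent w d then
      (case (SOME d. descent w d) of (u, x, y, v) \<Rightarrow>
         (if descent w (u, x, y, v) then straighten (u @ y # x # v) else 0) +
         lin_ext (\<lambda>z. if descent w (u, x, y, v) then straighten (u @ z # v) else 0) (br x y))
    else (case w of [x] \<Rightarrow> x | _ \<Rightarrow> 0))"
  by auto
termination
  by (relation "measures [length, inversions lt]") (simp, (metis descent_measures)+)

declare straighten.simps [simp del]

abbreviation strn :: "'g list \<Rightarrow> 'g" where
  "strn \<equiv> multilin_ext straighten"

lemma strn_single: "strn [x] = x"
proof (induction x rule: B_induct)
  case (basis b)
  have "\<not> descent [b] d" for d by (auto simp: descent_def)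
  then show ?case using basis by (simp add: lin_ext_basis straighten.simps[of "[b]"])
next
  case (add x y)
  then show ?case using multilin_ext_add[of straighten "[]" x y "[]"] by simp
next
  case (scale c x)
  then show ?case using multilin_ext_scale[of straighten "[]" c x "[]"] by simp
next
  case zero
  then show ?case using multilin_ext_zero[of straighten "[]" "[]"] by simp
qed

text \<open>Hides the choice operator: from here on it is known only that some descent was reduced,
  not which one.\<close>

lemma strn_some_descent:
  assumes "lt y x" "set (u @ x # y # v) \<subseteq> B"
  obtains u' x' y' v' where "u @ x # y # v = u' @ x' # y' # v'" "lt y' x'"
    "strn (u @ x # y # v) = strn (u' @ y' # x' # v') + strn (u' @ br x' y' # v')"
proof -
  let ?w = "u @ x # y # v"
  have ex: "\<exists>d. descent ?w d"
    using assms by (intro exI[of _ "(u, x, y, v)"]) (auto simp: descent_def)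
  obtain u' x' y' v' where d: "(SOME d. descent ?w d) = (u', x', y', v')"
    by (metis surj_pair)
  have d': "descent ?w (u', x', y', v')"
    using someI_ex[OF ex] d by simp
  then have w: "?w = u' @ x' # y' # v'" "lt y' x'" by (auto simp: descent_def)
  then have sub: "set u' \<subseteq> B" "set v' \<subseteq> B" "x' \<in> B" "y' \<in> B"
    using assms(2) by (auto simp: w(1))
  have "strn ?w = straighten ?w" using assms(2) by (intro multilin_ext_basis) auto
  also have "\<dots> = straighten (u' @ y' # x' # v') + lin_ext (\<lambda>z. straighten (u' @ z # v')) (br x' y')"
    using ex d' by (subst straighten.simps) (simp add: d)
  also have "\<dots> = strn (u' @ y' # x' # v') + strn (u' @ br x' y' # v')"
    using sub by (simp add: multilin_ext_slot multilin_ext_basis)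
  finally show ?thesis using that w by blast
qed

text \<open>Disjoint exchanges do not interfere: each can be followed by the other, and both orders
  end in the same four words. The second exchange happens in a word that is shorter or has fewer
  inversions, so one of the two induction hypotheses applies to it.\<close>

lemma strn_confluent_disjoint:
  assumes "\<And>u x y v. \<lbrakk>length (u @ x # y # v) < n\<rbrakk> \<Longrightarrow>
      strn (u @ x # y # v) = strn (u @ y # x # v) + strn (u @ br x y # v)"
    and "\<And>u x y v. \<lbrakk>lt y x; set (u @ x # y # v) \<subseteq> B; length (u @ x # y # v) = n; inversions lt (u @ x # y # v) < m\<rbrakk> \<Longrightarrow>
      strn (u @ x # y # v) = strn (u @ y # x # v) + strn (u @ br x y # v)"
    and "length (p @ x # y # q @ x' # y' # r) = n" "inversions lt (p @ x # y # q @ x' # y' # r) = m"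
    and "set (p @ x # y # q @ x' # y' # r) \<subseteq> B" "lt y x" "lt y' x'"
  shows "strn (p @ y # x # q @ x' # y' # r) + strn (p @ br x y # q @ x' # y' # r) =
    strn (p @ x # y # q @ y' # x' # r) + strn (p @ x # y # q @ br x' y' # r)"
proof -
  have i: "inversions lt (p @ y # x # q @ x' # y' # r) < m" "inversions lt (p @ x # y # q @ y' # x' # r) < m"
    using assms(4,6,7) inversions_swap[of lt y x p "q @ x' # y' # r"]
      inversions_swap[of lt y' x' "p @ x # y # q" "r"] lt_asym by auto
  have "strn (p @ y # x # q @ x' # y' # r) = strn (p @ y # x # q @ y' # x' # r) + strn (p @ y # x # q @ br x' y' # r)"
    using assms(2)[of y' x' "p @ y # x # q" r] i assms(3,5,7) by simp
  moreover have "strn (p @ x # y # q @ y' # x' # r) = strn (p @ y # x # q @ y' # x' # r) + strn (p @ br x y # q @ y' # x' # r)"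
    using assms(2)[of y x "p" "q @ y' # x' # r"] i assms(3,5,6) by simp
  moreover have "strn (p @ br x y # q @ x' # y' # r) = strn (p @ br x y # q @ y' # x' # r) + strn (p @ br x y # q @ br x' y' # r)"
    using assms(1)[of "p @ br x y # q" x' y' r] assms(3) by simp
  moreover have "strn (p @ x # y # q @ br x' y' # r) = strn (p @ y # x # q @ br x' y' # r) + strn (p @ br x y # q @ br x' y' # r)"
    using assms(1)[of "p" x y "q @ br x' y' # r"] assms(3) by simp
  ultimately show ?thesis by simp
qed

text \<open>The critical case: a decreasing triple x, y, z can be sorted beginning with either pair.
  Both ways reach z, y, x, and the shorter words left over match by the Jacobi identity.\<close>

lemma strn_confluent_overlap:
  assumes "\<And>u x y v. \<lbrakk>length (u @ x # y # v) < n\<rbrakk> \<Longrightarrow>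
      strn (u @ x # y # v) = strn (u @ y # x # v) + strn (u @ br x y # v)"
    and "\<And>u x y v. \<lbrakk>lt y x; set (u @ x # y # v) \<subseteq> B; length (u @ x # y # v) = n; inversions lt (u @ x # y # v) < m\<rbrakk> \<Longrightarrow>
      strn (u @ x # y # v) = strn (u @ y # x # v) + strn (u @ br x y # v)"
    and "length (p @ x # y # z # r) = n" "inversions lt (p @ x # y # z # r) = m"
    and "set (p @ x # y # z # r) \<subseteq> B" "lt y x" "lt z y"
  shows "strn (p @ y # x # z # r) + strn (p @ br x y # z # r) =
    strn (p @ x # z # y # r) + strn (p @ x # br y z # r)"
proof -
  have zx: "lt z x" using assms(6,7) lt_trans by blast
  have i: "inversions lt (p @ y # x # z # r) < m" "inversions lt (p @ x # z # y # r) < m"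
    using assms(4,6,7) inversions_swap[of lt y x p "z # r"]
      inversions_swap[of lt z y "p @ [x]" "r"] lt_asym by auto
  moreover have "inversions lt (p @ y # z # x # r) < m" "inversions lt (p @ z # x # y # r) < m"
    using i zx inversions_swap[of lt z x "p @ [y]" "r"]
      inversions_swap[of lt z x "p" "y # r"] lt_asym by auto
  ultimately have i: "inversions lt (p @ y # x # z # r) < m" "inversions lt (p @ x # z # y # r) < m"
     "inversions lt (p @ y # z # x # r) < m" "inversions lt (p @ z # x # y # r) < m" by auto
  have 1: "strn (p @ y # x # z # r) = strn (p @ y # z # x # r) + strn (p @ y # br x z # r)"
    using assms(2)[of z x "p @ [y]" r] i assms(3,5) zx by simp
  have 2: "strn (p @ y # z # x # r) = strn (p @ z # y # x # r) + strn (p @ br y z # x # r)"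
    using assms(2)[of z y "p" "x # r"] i assms(3,5,7) by simp
  have 3: "strn (p @ x # z # y # r) = strn (p @ z # x # y # r) + strn (p @ br x z # y # r)"
    using assms(2)[of z x "p" "y # r"] i assms(3,5) zx by simp
  have 4: "strn (p @ z # x # y # r) = strn (p @ z # y # x # r) + strn (p @ z # br x y # r)"
    using assms(2)[of y x "p @ [z]" "r"] i assms(3,5,6) by simp
  \<comment> \<open>These words are shorter, so arbitrary letters may be exchanged, in particular
    letters that are brackets.\<close>
  have 5: "strn (p @ a # b # r) = strn (p @ b # a # r) + strn (p @ br a b # r)" for a b
    using assms(1)[of p a b r] assms(3) by simp
  \<comment> \<open>The Jacobi identity in the form that bracketing with \<open>x\<close> is a
    derivation; this is how the three leftover words combine.\<close>
  have "br (br x y) z + br y (br x z) = - (br y (br z x) + br z (br x y))"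
    using br_antisym[of "br x y" z] br_antisym[of x z] br_uminus_right[of y "br z x"]
    by simp
  also have "\<dots> = br x (br y z)"
    using jacobi[of x y z] by (metis add.assoc eq_neg_iff_add_eq_0)
  finally have "br (br x y) z + br y (br x z) = br x (br y z)" .
  then have "strn (p @ br (br x y) z # r) + strn (p @ br y (br x z) # r) = strn (p @ br x (br y z) # r)"
    by (metis multilin_ext_add)
  then show ?thesis
    unfolding 1 2 3 4 using 5[of x "br y z"] 5[of y "br x z"] 5[of "br x y" z]
    by (simp add: algebra_simps)
qed

text \<open>The recursion reduces one chosen descent, the claim concerns a given one. The two are
  the same pair, overlap in one letter, or are disjoint; the last two cases are the confluence
  lemmas.\<close>

lemma strn_swap_descent:
  assumes IH: "\<And>u x y v. length (u @ x # y # v) < n \<Longrightarrow>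
      strn (u @ x # y # v) = strn (u @ y # x # v) + strn (u @ br x y # v)"
    and "lt y x" "set (u @ x # y # v) \<subseteq> B" "length (u @ x # y # v) = n"
  shows "strn (u @ x # y # v) = strn (u @ y # x # v) + strn (u @ br x y # v)"
  using assms(2-4)
proof (induction "inversions lt (u @ x # y # v)" arbitrary: u x y v rule: less_induct)
  case less
  let ?w = "u @ x # y # v"
  obtain u' x' y' v' where w: "?w = u' @ x' # y' # v'" and lt': "lt y' x'" and
    eq: "strn ?w = strn (u' @ y' # x' # v') + strn (u' @ br x' y' # v')"
    by (rule strn_some_descent[OF less.prems(1,2)])
  let ?m = "inversions lt ?w"
  have IH': "strn (u @ x # y # v) = strn (u @ y # x # v) + strn (u @ br x y # v)"
    if "lt y x" "set (u @ x # y # v) \<subseteq> B" "length (u @ x # y # v) = n" "inversions lt (u @ x # y # v) < ?m" for u x y v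
    using that less.hyps by blast
  have over: "strn (p @ y # x # z # r) + strn (p @ br x y # z # r) =
      strn (p @ x # z # y # r) + strn (p @ x # br y z # r)"
    if "p @ x # y # z # r = ?w" "lt y x" "lt z y" for p x y z r
  proof (rule strn_confluent_overlap[where n = n and m = ?m], goal_cases)
    case 1
    then show ?case by (rule IH)
  next
    case 2
    then show ?case by (rule IH')
  next
    case 3
    show ?case unfolding that(1) by (rule less.prems(3))
  next
    case 4
    show ?case unfolding that(1) by (rule refl)
  next
    case 5
    show ?case unfolding that(1) by (rule less.prems(2))
  qed (rule that)+
  have disj: "strn (p @ y # x # q @ x' # y' # r) + strn (p @ br x y # q @ x' # y' # r) =
      strn (p @ x # y # q @ y' # x' # r) + strn (p @ x # y # q @ br x' y' # r)"
    if "p @ x # y # q @ x' # y' # r = ?w" "lt y x" "lt y' x'" for p x y q x' y' r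
  proof (rule strn_confluent_disjoint[where n = n and m = ?m], goal_cases)
    case 1
    then show ?case by (rule IH)
  next
    case 2
    then show ?case by (rule IH')
  next
    case 3
    show ?case unfolding that(1) by (rule less.prems(3))
  next
    case 4
    show ?case unfolding that(1) by (rule refl)
  next
    case 5
    show ?case unfolding that(1) by (rule less.prems(2))
  qed (rule that)+
  have "strn (u' @ y' # x' # v') + strn (u' @ br x' y' # v') = strn (u @ y # x # v) + strn (u @ br x y # v)"
  proof -
    consider p where "u' = u @ p" "x # y # v = p @ x' # y' # v'" | p where "u = u' @ p" "p @ x # y # v = x' # y' # v'"
      using iffD1[OF append_eq_append_conv2 w] by blast
    then show ?thesis
    proof cases
      case 1
      consider "p = []" | "p = [x]" | q where "p = x # y # q"
        using 1(2) by (auto simp: Cons_eq_append_conv)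
      then show ?thesis
      proof cases
        case 1
        then show ?thesis using \<open>u' = u @ p\<close> \<open>x # y # v = p @ x' # y' # v'\<close> by simp
      next
        case p: 2
        then show ?thesis
          using 1 less.prems lt' over[of u x y y' v'] by simp
      next
        case p: 3
        then show ?thesis
          using 1 less.prems lt' disj[of u x y q x' y' v'] by simp
      qed
    next
      case 2
      consider "p = []" | "p = [x']" | q where "p = x' # y' # q"
        using 2(2) by (auto simp: append_eq_Cons_conv)
      then show ?thesis
      proof cases
        case 1
        then show ?thesis using \<open>u = u' @ p\<close> \<open>p @ x # y # v = x' # y' # v'\<close> by simp
      next
        case p: 2
        then show ?thesis
          using 2 less.prems lt' over[of u' x' y' y v] by simp
      next
        case p: 3
        then show ?thesis
          using 2 less.prems lt' disj[of u' x' y' q x y v] by simp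
      qed
    qed
  qed
  then show ?case using eq by simp
qed

text \<open>For basis letters, an ascent is a descent of the exchanged word up to antisymmetry, and
  equal letters are covered by [x, x] = 0. Multilinearity of both sides gives the rest, and
  induction on the length supplies the exchange rule for shorter words.\<close>

lemma strn_swap:
  "strn (u @ x # y # v) = strn (u @ y # x # v) + strn (u @ br x y # v)"
proof (induction "length (u @ x # y # v)" arbitrary: u x y v rule: less_induct)
  case less
  let ?n = "length (u @ x # y # v)"
  let ?P = "\<lambda>u x y v. strn (u @ x # y # v) = strn (u @ y # x # v) + strn (u @ br x y # v)"
  have IH: "?P u' x' y' v'" if "length (u' @ x' # y' # v') < ?n" for u' x' y' v'
    using less.hyps that by blast
  have desc: "?P u' x' y' v'" if "lt y' x'" "set (u' @ x' # y' # v') \<subseteq> B" "length (u' @ x' # y' # v') = ?n" for u' x' y' v'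
    using IH that by (rule strn_swap_descent)
  have on_basis: "?P u' x' y' v'" if "set (u' @ x' # y' # v') \<subseteq> B" "length (u' @ x' # y' # v') = ?n" for u' x' y' v'
  proof -
    consider "x' = y'" | "lt y' x'" | "lt x' y'" using lt_total by blast
    then show ?thesis
    proof cases
      case 1
      then show ?thesis by (simp add: br_self multilin_ext_zero)
    next
      case 2
      then show ?thesis using desc that by blast
    next
      case 3
      then have "?P u' y' x' v'" using desc that by simp
      then show ?thesis by (simp add: br_antisym[of x' y'] multilin_ext_uminus)
    qed
  qed
  note simps = multilin_ext_add multilin_ext_scale multilin_ext_zero br_add_left br_add_right br_scale_left br_scale_right
  \<comment> \<open>The restriction to \<open>B\<close> is lifted one slot at a time: first
    \<open>x'\<close>, then \<open>y'\<close>, then the letters of \<open>v'\<close>, finally those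
    of \<open>u'\<close>.\<close>
  have 1: "?P u' x' y' v'" if "y' \<in> B" "set u' \<subseteq> B" "set v' \<subseteq> B" "length (u' @ x' # y' # v') = ?n" for u' x' y' v'
  proof (induction x' rule: B_induct)
    case (add a b)
    then show ?case using multilin_ext_add[of _ "u' @ [y']"] by (simp add: simps)
  next
    case (scale c a)
    then show ?case using multilin_ext_scale[of _ "u' @ [y']"] by (simp add: simps scale_right_distrib)
  next
    case zero
    then show ?case using multilin_ext_zero[of _ "u' @ [y']"] br_scale_left[of 0 0] by (simp add: simps)
  next
    case (basis b)
    then show ?case using that by (intro on_basis) auto
  qed
  have 2: "?P u' x' y' v'" if "set u' \<subseteq> B" "set v' \<subseteq> B" "length (u' @ x' # y' # v') = ?n" for u' x' y' v'
  proof (induction y' rule: B_induct)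
    case (add a b)
    then show ?case using multilin_ext_add[of _ "u' @ [x']"] by (simp add: simps)
  next
    case (scale c a)
    then show ?case using multilin_ext_scale[of _ "u' @ [x']"] by (simp add: simps scale_right_distrib)
  next
    case zero
    then show ?case using multilin_ext_zero[of _ "u' @ [x']"] br_scale_right[of _ 0 0] by (simp add: simps)
  next
    case (basis b)
    then show ?case using that by (intro 1) auto
  qed
  have 3: "?P u' x y v'" if "set u' \<subseteq> B" "length u' = length u" "length v' = length v" for u' v'
    using that(3)
  proof (induction v' rule: basis_lists_induct[where n = "length v"])
    case (add p a b q)
    then show ?case
      using multilin_ext_add[of _ "u' @ x # y # p"] multilin_ext_add[of _ "u' @ y # x # p"] multilin_ext_add[of _ "u' @ br x y # p"]
      by simp
  next
    case (scale p c a q)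
    then show ?case
      using multilin_ext_scale[of _ "u' @ x # y # p"] multilin_ext_scale[of _ "u' @ y # x # p"] multilin_ext_scale[of _ "u' @ br x y # p"]
      by (simp add: scale_right_distrib)
  next
    case (zero p q)
    then show ?case
      using multilin_ext_zero[of _ "u' @ x # y # p"] multilin_ext_zero[of _ "u' @ y # x # p"] multilin_ext_zero[of _ "u' @ br x y # p"]
      by simp
  next
    case (basis q)
    then show ?case using that(1,2) by (intro 2) auto
  qed (use that in simp)
  have "?P u' x y v" if "length u' = length u" for u'
    using that
  proof (induction u' rule: basis_lists_induct[where n = "length u"])
    case (add p a b q)
    then show ?case by (simp add: simps)
  next
    case (scale p c a q)
    then show ?case by (simp add: simps scale_right_distrib)
  next
    case (zero p q)
    then show ?case by (simp add: simps)
  next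
    case (basis p)
    then show ?case by (intro 3) auto
  qed (use that in simp)
  then show ?case by simp
qed

section \<open>Passage of the straightening map to the enveloping algebra\<close>

definition word_functional :: "('g list \<Rightarrow> 'g) \<Rightarrow> ('g, 'k) ncps \<Rightarrow> 'g" where
  "word_functional f p = (\<Sum>w | nc_coeff p w \<noteq> 0. scale (nc_coeff p w) (f w))"

lemma word_functional_superset:
  assumes "finite S" "{w. nc_coeff p w \<noteq> 0} \<subseteq> S"
  shows "word_functional f p = (\<Sum>w\<in>S. scale (nc_coeff p w) (f w))"
  unfolding word_functional_def using assms by (intro sum.mono_neutral_left) auto

lemma word_functional_add:
  assumes "finite {w. nc_coeff p w \<noteq> 0}" "finite {w. nc_coeff q w \<noteq> 0}"
  shows "word_functional f (p + q) = word_functional f p + word_functional f q"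
    and "word_functional f (p - q) = word_functional f p - word_functional f q"
proof -
  let ?S = "{w. nc_coeff p w \<noteq> 0} \<union> {w. nc_coeff q w \<noteq> 0}"
  have "finite ?S" using assms by blast
  moreover have "{w. nc_coeff (p + q) w \<noteq> 0} \<subseteq> ?S" "{w. nc_coeff (p - q) w \<noteq> 0} \<subseteq> ?S" by auto
  ultimately show "word_functional f (p + q) = word_functional f p + word_functional f q"
    "word_functional f (p - q) = word_functional f p - word_functional f q"
    by (simp_all add: word_functional_superset[of ?S] scale_left_distrib scale_left_diff_distrib sum.distrib sum_subtractf)
qed

lemma word_functional_times:
  assumes "finite {w. nc_coeff p w \<noteq> 0}" "finite {w. nc_coeff q w \<noteq> 0}"
  shows "word_functional f (p * q) =
    (\<Sum>u | nc_coeff p u \<noteq> 0. \<Sum>v | nc_coeff q v \<noteq> 0. scale (nc_coeff p u * nc_coeff q v) (f (u @ v)))"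
proof -
  let ?S = "{w. nc_coeff p w \<noteq> 0}" and ?T = "{w. nc_coeff q w \<noteq> 0}"
  let ?W = "(\<lambda>(u, v). u @ v) ` (?S \<times> ?T)"
  have fin: "finite ?W" using assms by blast
  have sub: "{w. nc_coeff (p * q) w \<noteq> 0} \<subseteq> ?W"
  proof
    fix w assume "w \<in> {w. nc_coeff (p * q) w \<noteq> 0}"
    then have "(\<Sum>i\<le>length w. nc_coeff p (take i w) * nc_coeff q (drop i w)) \<noteq> 0"
      by (simp add: times_ncps.rep_eq)
    then obtain i where "nc_coeff p (take i w) * nc_coeff q (drop i w) \<noteq> 0"
      by (metis (no_types, lifting) sum.neutral)
    then show "w \<in> ?W" by (intro image_eqI[where x = "(take i w, drop i w)"]) auto
  qed
  have coeff: "nc_coeff (p * q) w = (\<Sum>(u, v) | (u, v) \<in> ?S \<times> ?T \<and> u @ v = w. nc_coeff p u * nc_coeff q v)" for w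
  proof -
    have "nc_coeff (p * q) w = (\<Sum>i | i \<le> length w \<and> nc_coeff p (take i w) \<noteq> 0 \<and> nc_coeff q (drop i w) \<noteq> 0.
        nc_coeff p (take i w) * nc_coeff q (drop i w))"
      unfolding times_ncps.rep_eq by (intro sum.mono_neutral_right) auto
    also have "\<dots> = (\<Sum>(u, v) | (u, v) \<in> ?S \<times> ?T \<and> u @ v = w. nc_coeff p u * nc_coeff q v)"
      by (rule sum.reindex_bij_witness[where j = "\<lambda>i. (take i w, drop i w)" and i = "\<lambda>(u, v). length u"]) auto
    finally show ?thesis .
  qed
  have "word_functional f (p * q) = (\<Sum>w\<in>?W. \<Sum>(u, v) | (u, v) \<in> ?S \<times> ?T \<and> u @ v = w.
      scale (nc_coeff p u * nc_coeff q v) (f (u @ v)))"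
    unfolding word_functional_superset[OF fin sub]
    by (intro sum.cong refl) (auto simp: coeff scale_sum_left case_prod_unfold intro!: sum.cong)
  also have "\<dots> = (\<Sum>(u, v)\<in>?S \<times> ?T. scale (nc_coeff p u * nc_coeff q v) (f (u @ v)))"
    using sum.group[of "?S \<times> ?T" ?W "\<lambda>(u, v). u @ v" "\<lambda>(u, v). scale (nc_coeff p u * nc_coeff q v) (f (u @ v))"] assms fin
    by (simp add: case_prod_unfold conj_commute mem_Times_iff)
  also have "\<dots> = (\<Sum>u\<in>?S. \<Sum>v\<in>?T. scale (nc_coeff p u * nc_coeff q v) (f (u @ v)))"
    using assms by (simp add: sum.cartesian_product)
  finally show ?thesis .
qed

lemma word_functional_var: "word_functional f (nc_var x) = f [x]"
  by (subst word_functional_superset[of "{[x]}"]) (auto simp: nc_var.rep_eq)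

text \<open>Quantifying over the contexts \<open>u\<close>, \<open>v\<close> is what makes this a
  two-sided ideal: each monomial of a factor on either side is absorbed into the context.\<close>

definition strn_kernel :: "('g, 'k) ncps set" where
  "strn_kernel = {p \<in> carrier free_algebra. \<forall>u v. word_functional (\<lambda>w. strn (u @ w @ v)) p = 0}"

lemma word_functional_zero: "word_functional f 0 = 0"
  by (simp add: word_functional_def)

lemma ideal_strn_kernel: "ideal strn_kernel (free_algebra :: ('g, 'k) ncps ring)"
proof (rule idealI)
  show "ring (free_algebra :: ('g, 'k) ncps ring)" by (rule ring_free_algebra)
  interpret ring "free_algebra :: ('g, 'k) ncps ring" by (rule ring_free_algebra)
  show "subgroup strn_kernel (add_monoid (free_algebra :: ('g, 'k) ncps ring))"
  proof (rule add.subgroupI)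
    fix a assume a: "a \<in> strn_kernel"
    then have "- a \<in> carrier free_algebra" "- a \<oplus>\<^bsub>free_algebra\<^esub> a = \<zero>\<^bsub>free_algebra\<^esub>"
      by (auto simp: strn_kernel_def free_algebra_def)
    then have "\<ominus>\<^bsub>free_algebra\<^esub> a = - a"
      using a minus_equality strn_kernel_def by auto
    moreover have "- a \<in> strn_kernel"
      using a by (auto simp: strn_kernel_def free_algebra_def word_functional_def sum_negf)
    ultimately show "\<ominus>\<^bsub>free_algebra\<^esub> a \<in> strn_kernel" by simp
  qed (auto simp: strn_kernel_def free_algebra_def word_functional_add word_functional_zero finite_support_add
      simp del: nc_coeff_simps(2) intro!: exI[of _ "0 :: ('g, 'k) ncps"])
next
  fix a x :: "('g, 'k) ncps"
  assume a: "a \<in> strn_kernel" and x: "x \<in> carrier free_algebra"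
  have fin: "finite {w. nc_coeff a w \<noteq> 0}" "finite {w. nc_coeff x w \<noteq> 0}"
    using a x by (auto simp: strn_kernel_def free_algebra_def)
  have 0: "(\<Sum>w | nc_coeff a w \<noteq> 0. scale (nc_coeff a w) (strn (u @ w @ v))) = 0" for u v
    using a by (auto simp: strn_kernel_def word_functional_def)
  have "word_functional (\<lambda>w. strn (u @ w @ v)) (x * a) = 0" for u v
  proof -
    have "word_functional (\<lambda>w. strn (u @ w @ v)) (x * a) =
      (\<Sum>p | nc_coeff x p \<noteq> 0. scale (nc_coeff x p)
        (\<Sum>w | nc_coeff a w \<noteq> 0. scale (nc_coeff a w) (strn ((u @ p) @ w @ v))))"
      using fin by (simp add: word_functional_times scale_sum_right)
    then show ?thesis unfolding 0 by simp
  qed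
  then show "x \<otimes>\<^bsub>free_algebra\<^esub> a \<in> strn_kernel"
    using fin by (auto simp: strn_kernel_def free_algebra_def finite_support_times)
  have "word_functional (\<lambda>w. strn (u @ w @ v)) (a * x) = 0" for u v
  proof -
    have "word_functional (\<lambda>w. strn (u @ w @ v)) (a * x) =
      (\<Sum>p | nc_coeff x p \<noteq> 0. scale (nc_coeff x p)
        (\<Sum>w | nc_coeff a w \<noteq> 0. scale (nc_coeff a w) (strn (u @ w @ (p @ v)))))"
      using fin by (subst word_functional_times, simp, simp, subst sum.swap) (simp add: scale_sum_right mult.commute)
    then show ?thesis unfolding 0 by simp
  qed
  then show "a \<otimes>\<^bsub>free_algebra\<^esub> x \<in> strn_kernel"
    using fin by (auto simp: strn_kernel_def free_algebra_def finite_support_times)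
qed

lemma word_functional_var_times_var:
  "word_functional f (nc_var x * nc_var y) = f [x, y]"
proof -
  have "{w. nc_coeff (nc_var x :: ('g, 'k) ncps) w \<noteq> 0} = {[x]}" for x
    by (auto simp: nc_var.rep_eq)
  then show ?thesis by (simp add: word_functional_times nc_var.rep_eq)
qed

lemma word_functional_const_times_var:
  "word_functional f (nc_const c * nc_var x) = scale c (f [x])"
proof -
  have "{w. nc_coeff (nc_var x :: ('g, 'k) ncps) w \<noteq> 0} = {[x]}" for x
    by (auto simp: nc_var.rep_eq)
  moreover have "{w. nc_coeff (nc_const c :: ('g, 'k) ncps) w \<noteq> 0} = (if c = 0 then {} else {[]})"
    by (auto simp: nc_const.rep_eq)
  ultimately show ?thesis by (simp add: word_functional_times nc_var.rep_eq nc_const.rep_eq)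
qed

text \<open>The first two families of relations hold by multilinearity, the third is
  \<open>strn_swap\<close>, all of them inside an arbitrary context.\<close>

lemma uea_relations_strn_kernel: "uea_relations scale br \<subseteq> strn_kernel"
proof -
  have fin: "finite {w. nc_coeff (nc_var x :: ('g, 'k) ncps) w \<noteq> 0}"
    "finite {w. nc_coeff (nc_const c * nc_var x :: ('g, 'k) ncps) w \<noteq> 0}"
    "finite {w. nc_coeff (nc_var x * nc_var y :: ('g, 'k) ncps) w \<noteq> 0}"
    "finite {w. nc_coeff (nc_var x - nc_var y :: ('g, 'k) ncps) w \<noteq> 0}"
    "finite {w. nc_coeff (nc_var x * nc_var y - nc_var y * nc_var x :: ('g, 'k) ncps) w \<noteq> 0}" for c x y
    by (intro finite_support_var finite_support_times finite_support_const finite_support_add(2))+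
  have swap: "strn (u @ x # y # v) - strn (u @ y # x # v) - strn (u @ br x y # v) = 0" for u x y v
    unfolding strn_swap[of u x y v] by simp
  note simps = word_functional_add fin word_functional_var word_functional_var_times_var
    word_functional_const_times_var multilin_ext_add multilin_ext_scale
  have "word_functional (\<lambda>w. strn (u @ w @ v)) p = 0" if "p \<in> uea_relations scale br" for p u v
    using that unfolding uea_relations_def
    by (elim UnE CollectE exE conjE) (simp_all add: simps swap del: nc_coeff_simps)
  then show ?thesis
    using uea_relations_closed[of scale br] by (auto simp: strn_kernel_def)
qed

text \<open>In the empty context \<open>strn\<close> annihilates the ideal but fixes every single
  letter, so it tells the generators apart.\<close>

lemma uea_ideal_var:
  assumes "nc_var x - nc_var y \<in> uea_ideal scale br"
  shows "x = y"
proof -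
  have "uea_ideal scale br \<subseteq> strn_kernel"
    unfolding uea_ideal_def
    by (rule ring.genideal_minimal[OF ring_free_algebra ideal_strn_kernel uea_relations_strn_kernel])
  then have "word_functional (\<lambda>w. strn ([] @ w @ [])) (nc_var x - nc_var y) = 0"
    using assms unfolding strn_kernel_def by blast
  then show ?thesis
    using strn_single by (simp only: append_Nil append_Nil2 word_functional_add(2)[OF finite_support_var finite_support_var] word_functional_var right_minus_eq)
qed

end

context lie_algebra
begin

lemma uea_incl_inject:
  fixes x y :: 'g
  assumes "nc_var x - nc_var y \<in> uea_ideal scale br"
  shows "x = y"
proof -
  define B where "B = extend_basis {}"
  have B: "independent B" "span B = UNIV"
    unfolding B_def using independent_empty by (rule independent_extend_basis, rule span_extend_basis)
  \<comment> \<open>Any linear order on \<gg> can serve to sort basis letters; the well-ordering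
    theorem provides one.\<close>
  obtain r :: "'g rel" where "well_order_on UNIV r" using well_order_on by blast
  then have r: "linear_order r" "refl r" "trans r" "antisym r" "total r"
    by (auto simp: well_order_on_def linear_order_on_def partial_order_on_def preorder_on_def)
  interpret lie_algebra_basis scale br B "\<lambda>x y. (x, y) \<in> r \<and> x \<noteq> y"
  proof
    show "independent B" "span B = UNIV" by (fact B)+
  qed (use r in \<open>auto dest: antisymD transD simp: total_on_def\<close>)
  show ?thesis using assms by (rule uea_ideal_var)
qed

end

section \<open>The Campbell-Baker-Hausdorff identity in a ring modulo an ideal\<close>

text \<open>Congruences modulo \<open>K\<close> replace computations in a quotient, so that the
  arithmetic of the type class \<open>ring_1\<close> remains available to the simplifier.\<close>

locale two_sided_ideal =
  fixes K :: "'r::ring_1 set"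
  assumes zero_mem: "0 \<in> K" and add_mem: "a \<in> K \<Longrightarrow> b \<in> K \<Longrightarrow> a + b \<in> K"
    and mult_left_mem: "a \<in> K \<Longrightarrow> r * a \<in> K" and mult_right_mem: "a \<in> K \<Longrightarrow> a * r \<in> K"
begin

definition cong :: "'r \<Rightarrow> 'r \<Rightarrow> bool" (infix "\<approx>" 50) where
  "a \<approx> b \<longleftrightarrow> a - b \<in> K"

lemma uminus_mem: "a \<in> K \<Longrightarrow> - a \<in> K"
  using mult_left_mem[of a "-1"] by simp

lemma minus_mem: "a \<in> K \<Longrightarrow> b \<in> K \<Longrightarrow> a - b \<in> K"
  using add_mem[of a "- b"] uminus_mem by simp

lemma sum_mem: "(\<And>i. i \<in> A \<Longrightarrow> f i \<in> K) \<Longrightarrow> sum f A \<in> K"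
  by (induction A rule: infinite_finite_induct) (auto simp: zero_mem add_mem)

lemma cong_refl [simp]: "a \<approx> a"
  by (simp add: cong_def zero_mem)

lemma cong_sym: "a \<approx> b \<Longrightarrow> b \<approx> a"
  unfolding cong_def using uminus_mem[of "a - b"] by simp

lemma cong_trans [trans]: "a \<approx> b \<Longrightarrow> b \<approx> c \<Longrightarrow> a \<approx> c"
  unfolding cong_def using add_mem[of "a - b" "b - c"] by simp

lemma cong_add: "a \<approx> b \<Longrightarrow> c \<approx> d \<Longrightarrow> a + c \<approx> b + d"
  unfolding cong_def using add_mem[of "a - b" "c - d"] by (simp add: algebra_simps)

lemma cong_diff: "a \<approx> b \<Longrightarrow> c \<approx> d \<Longrightarrow> a - c \<approx> b - d"
  unfolding cong_def using minus_mem[of "a - b" "c - d"] by (simp add: algebra_simps)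

lemma cong_mult: "a \<approx> b \<Longrightarrow> c \<approx> d \<Longrightarrow> a * c \<approx> b * d"
  unfolding cong_def using add_mem[OF mult_right_mem[of "a - b" c] mult_left_mem[of "c - d" b]]
  by (simp add: algebra_simps)

lemma cong_sum: "(\<And>i. i \<in> A \<Longrightarrow> f i \<approx> g i) \<Longrightarrow> sum f A \<approx> sum g A"
  unfolding cong_def using sum_mem[of A "\<lambda>i. f i - g i"] by (simp add: sum_subtractf)

lemma cong_power: "a \<approx> b \<Longrightarrow> a ^ k \<approx> b ^ k"
  by (induction k) (auto intro: cong_mult)

end

lemma nc_coeff_power_eq_0:
  assumes "nc_coeff P [] = 0" "length w < k"
  shows "nc_coeff (P ^ k) w = 0"
  using assms(2)
proof (induction k arbitrary: w)
  case (Suc k)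
  have "nc_coeff P (take i w) * nc_coeff (P ^ k) (drop i w) = 0" if "i \<le> length w" for i
    using Suc assms(1) that by (cases "i = 0") auto
  then show ?case by (simp add: times_ncps.rep_eq)
qed auto

lemma nc_coeff_const_times: "nc_coeff (nc_const c * P) w = c * nc_coeff P w"
proof -
  have "nc_coeff (nc_const c * P) w = (\<Sum>i\<in>{0}. c * nc_coeff P (drop i w))"
    unfolding times_ncps.rep_eq nc_const.rep_eq by (intro sum.mono_neutral_cong_right) auto
  then show ?thesis by simp
qed

lemma nc_coeff_sum: "nc_coeff (sum f A) w = (\<Sum>i\<in>A. nc_coeff (f i) w)"
  by (induction A rule: infinite_finite_induct) auto

lemma nc_coeff_lie_eval_eq_0:
  assumes "length w \<noteq> lie_count_a u + lie_count_b u"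
  shows "nc_coeff (lie_eval (\<lambda>p q. p * q - q * p) (nc_var Letter_a) (nc_var Letter_b) u :: (letter, 'k::ring_1) ncps) w = 0"
  using assms
proof (induction u arbitrary: w)
  case (LieBr u v)
  let ?e = "lie_eval (\<lambda>p q. p * q - q * p) (nc_var Letter_a) (nc_var Letter_b) :: _ \<Rightarrow> (letter, 'k) ncps"
  have 1: "nc_coeff (?e u) (take i w) * nc_coeff (?e v) (drop i w) = 0" if "i \<le> length w" for i
    using LieBr that by (cases "i = lie_count_a u + lie_count_b u") auto
  have 2: "nc_coeff (?e v) (take i w) * nc_coeff (?e u) (drop i w) = 0" if "i \<le> length w" for i
    using LieBr that by (cases "i = lie_count_a v + lie_count_b v") auto
  show ?case by (simp add: times_ncps.rep_eq 1 2)
qed (auto simp: nc_var.rep_eq)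

definition exp_trunc :: "(rat \<Rightarrow> 'r::ring_1) \<Rightarrow> nat \<Rightarrow> 'r \<Rightarrow> 'r" where
  "exp_trunc \<kappa> N z = (\<Sum>k\<le>N. \<kappa> (1 / fact k) * z ^ k)"

text \<open>The square of indices also contains bidegrees of total degree above \<open>N\<close>.
  For the \<open>H\<close> and the ideals considered below, their contribution is congruent to
  zero.\<close>

definition cbh_trunc :: "(nat \<Rightarrow> nat \<Rightarrow> lie_word \<Rightarrow>\<^sub>0 rat) \<Rightarrow> (rat \<Rightarrow> 'r::ring_1) \<Rightarrow> nat \<Rightarrow> 'r \<Rightarrow> 'r \<Rightarrow> 'r" where
  "cbh_trunc H \<kappa> N x y = (\<Sum>j\<le>N. \<Sum>k\<le>N. lincomb (\<lambda>r p. \<kappa> r * p) (lie_eval (\<lambda>p q. p * q - q * p) x y) (H j k))"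

text \<open>
  Modulo \<open>K\<close>, a series in \<open>a, b\<close> has a value at \<open>x, y\<close> given by a finite sum, since the monomials of length
  \<open>> N\<close> vanish. The ring is not an algebra over the rationals by a type class; \<open>\<kappa>\<close> provides the scalars.
\<close>

locale nilpotent_evaluation = two_sided_ideal K
  for K :: "'r::ring_1 set" +
  fixes \<kappa> :: "rat \<Rightarrow> 'r" and x y :: 'r and N :: nat
  assumes \<kappa>_add: "\<kappa> (r + s) = \<kappa> r + \<kappa> s" and \<kappa>_mult: "\<kappa> (r * s) = \<kappa> r * \<kappa> s" and \<kappa>_1: "\<kappa> 1 = 1"
    and \<kappa>_commute: "\<kappa> r * z = z * \<kappa> r"
    and long_words: "length w > N \<Longrightarrow> prod_list (map (case_letter x y) w) \<in> K"
begin

lemma \<kappa>_0: "\<kappa> 0 = 0"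
  using \<kappa>_add[of 0 0] by simp

lemma \<kappa>_diff: "\<kappa> (r - s) = \<kappa> r - \<kappa> s"
  using \<kappa>_add[of "r - s" s] by (simp add: algebra_simps)

lemma \<kappa>_sum: "\<kappa> (sum f A) = (\<Sum>i\<in>A. \<kappa> (f i))"
  by (induction A rule: infinite_finite_induct) (auto simp: \<kappa>_0 \<kappa>_add)

definition mon :: "letter list \<Rightarrow> 'r" where
  "mon w = prod_list (map (case_letter x y) w)"

definition short :: "letter list set" where
  "short = {w. length w \<le> N}"

definition ev :: "(letter, rat) ncps \<Rightarrow> 'r" where
  "ev P = (\<Sum>w\<in>short. \<kappa> (nc_coeff P w) * mon w)"

lemma finite_short: "finite short"
proof -
  have "(UNIV :: letter set) = {Letter_a, Letter_b}" using letter.exhaust by blast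
  then have "finite (UNIV :: letter set)" by (metis finite.emptyI finite.insertI)
  then show ?thesis using finite_lists_length_le[of UNIV N] by (simp add: short_def)
qed

lemma ev_add: "ev (P + Q) = ev P + ev Q"
  by (simp add: ev_def \<kappa>_add distrib_right sum.distrib)

lemma ev_diff: "ev (P - Q) = ev P - ev Q"
  by (simp add: ev_def \<kappa>_diff left_diff_distrib sum_subtractf)

lemma ev_0: "ev 0 = 0"
  by (simp add: ev_def \<kappa>_0)

lemma ev_sum: "ev (sum f A) = (\<Sum>i\<in>A. ev (f i))"
  by (induction A rule: infinite_finite_induct) (auto simp: ev_0 ev_add)

lemma ev_const_times: "ev (nc_const c * P) = \<kappa> c * ev P"
  by (simp add: ev_def nc_coeff_const_times \<kappa>_mult sum_distrib_left mult.assoc)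

lemma ev_1: "ev 1 = 1"
proof -
  have "ev 1 = (\<Sum>w\<in>{[]}. \<kappa> 1 * mon w)"
    unfolding ev_def by (intro sum.mono_neutral_cong_right finite_short) (auto simp: one_ncps.rep_eq \<kappa>_0 short_def)
  then show ?thesis by (simp add: \<kappa>_1 mon_def)
qed

lemma mon_append: "mon (u @ v) = mon u * mon v"
  by (simp add: mon_def)

text \<open>Two short words may have a long concatenation. Such pairs occur on the right but are cut
  off on the left, and \<open>long_words\<close> puts them into \<open>K\<close>; this is why
  evaluation is multiplicative only up to congruence.\<close>

lemma ev_mult: "ev (P * Q) \<approx> ev P * ev Q"
proof -
  let ?f = "\<lambda>(u, v). \<kappa> (nc_coeff P u * nc_coeff Q v) * mon (u @ v)"
  let ?L = "{(u, v). u \<in> short \<and> v \<in> short \<and> length u + length v \<le> N}"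
  have "ev P * ev Q = (\<Sum>u\<in>short. \<Sum>v\<in>short. (\<kappa> (nc_coeff P u) * mon u) * (\<kappa> (nc_coeff Q v) * mon v))"
    by (simp add: ev_def sum_product)
  also have "\<dots> = (\<Sum>(u, v)\<in>short \<times> short. ?f (u, v))"
    unfolding sum.cartesian_product
    by (intro sum.cong refl) (auto simp: \<kappa>_mult mon_append mult.assoc, metis \<kappa>_commute mult.assoc)
  also have "\<dots> = sum ?f (short \<times> short - ?L) + sum ?f ?L"
    using finite_short by (subst sum.subset_diff[of ?L]) auto
  finally have 1: "ev P * ev Q = sum ?f (short \<times> short - ?L) + sum ?f ?L" .
  have "ev (P * Q) = (\<Sum>w\<in>short. \<Sum>i\<le>length w. ?f (take i w, drop i w))"
    by (simp add: ev_def times_ncps.rep_eq \<kappa>_sum sum_distrib_right)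
  also have "\<dots> = (\<Sum>(w, i)\<in>(SIGMA w:short. {..length w}). ?f (take i w, drop i w))"
    using finite_short by (subst sum.Sigma) auto
  also have "\<dots> = sum ?f ?L"
    by (rule sum.reindex_bij_witness[where i = "\<lambda>(u, v). (u @ v, length u)" and j = "\<lambda>(w, i). (take i w, drop i w)"])
      (auto simp: short_def)
  finally have 2: "ev (P * Q) = sum ?f ?L" .
  have "sum ?f (short \<times> short - ?L) \<in> K"
  proof (rule sum_mem)
    fix z assume z: "z \<in> short \<times> short - ?L"
    obtain u v where uv: "z = (u, v)" by fastforce
    then have "mon (u @ v) \<in> K" unfolding mon_def using z by (intro long_words) auto
    then show "?f z \<in> K" by (simp add: uv mult_left_mem)
  qed
  then show ?thesis
    unfolding cong_def 1 2 using uminus_mem by fastforce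
qed

lemma ev_power: "ev (P ^ k) \<approx> ev P ^ k"
proof (induction k)
  case (Suc k)
  have "ev (P ^ Suc k) \<approx> ev P * ev (P ^ k)" by (simp add: ev_mult)
  also have "\<dots> \<approx> ev P ^ Suc k" by (simp add: cong_mult Suc)
  finally show ?case .
qed (simp add: ev_1)

text \<open>Without a constant term, \<open>P ^ k\<close> has no monomial shorter than
  \<open>k\<close>. On short words the cutoff of \<open>nc_exp\<close>, which depends on the word,
  can thus be replaced by the uniform \<open>N\<close>.\<close>

lemma ev_exp:
  assumes "nc_coeff P [] = 0"
  shows "ev (nc_exp P) \<approx> exp_trunc \<kappa> N (ev P)"
proof -
  have c: "nc_coeff (nc_exp P) w = (\<Sum>k\<le>N. nc_coeff (P ^ k) w / fact k)" if "w \<in> short" for w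
    unfolding nc_exp_def Abs_ncps_inverse[OF UNIV_I] using that assms nc_coeff_power_eq_0[OF assms]
    by (intro sum.mono_neutral_left) (auto simp: short_def not_le)
  have "ev (nc_exp P) = (\<Sum>w\<in>short. \<Sum>k\<le>N. \<kappa> (1 / fact k) * (\<kappa> (nc_coeff (P ^ k) w) * mon w))"
    unfolding ev_def
    by (intro sum.cong refl) (auto simp: c \<kappa>_sum sum_distrib_right mult.assoc[symmetric] \<kappa>_mult[symmetric])
  also have "\<dots> = (\<Sum>k\<le>N. \<kappa> (1 / fact k) * ev (P ^ k))"
    by (subst sum.swap) (simp add: ev_def sum_distrib_left)
  also have "\<dots> \<approx> exp_trunc \<kappa> N (ev P)"
    unfolding exp_trunc_def by (intro cong_sum cong_mult ev_power cong_refl)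
  finally show ?thesis .
qed

lemma ev_var: "ev (nc_var l) \<approx> case_letter x y l"
\<comment> \<open>For \<open>N = 0\<close> a single letter is already too long: it evaluates to 0,
  and its value lies in \<open>K\<close>.\<close>
proof (cases "N = 0")
  case True
  have "case_letter x y l \<in> K" using long_words[of "[l]"] True by simp
  moreover have "short = {[]}" unfolding short_def using True by auto
  then have "ev (nc_var l) = 0" by (simp add: ev_def nc_var.rep_eq \<kappa>_0)
  ultimately show ?thesis unfolding cong_def by (simp add: uminus_mem)
next
  case False
  have "ev (nc_var l) = (\<Sum>w\<in>{[l]}. \<kappa> 1 * mon w)"
    unfolding ev_def using False
    by (intro sum.mono_neutral_cong_right finite_short) (auto simp: nc_var.rep_eq \<kappa>_0 short_def)
  then show ?thesis by (simp add: \<kappa>_1 mon_def)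
qed

lemma ev_lie_eval:
  "ev (lie_eval (\<lambda>p q. p * q - q * p) (nc_var Letter_a) (nc_var Letter_b) u) \<approx> lie_eval (\<lambda>p q. p * q - q * p) x y u"
proof (induction u)
  case (LieBr u v)
  show ?case unfolding lie_eval.simps ev_diff
    by (intro cong_diff cong_trans[OF ev_mult] cong_mult LieBr)
qed (use ev_var[of Letter_a] ev_var[of Letter_b] in auto)

lemma exp_trunc_cong: "a \<approx> b \<Longrightarrow> exp_trunc \<kappa> N a \<approx> exp_trunc \<kappa> N b"
  unfolding exp_trunc_def by (intro cong_sum cong_mult cong_power cong_refl)

theorem exp_trunc_mult:
  assumes "cbh_expression H"
  shows "exp_trunc \<kappa> N x * exp_trunc \<kappa> N y \<approx> exp_trunc \<kappa> N (cbh_trunc H \<kappa> N x y)"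
proof -
  define C :: "(letter, rat) ncps" where
    "C = Abs_ncps (\<lambda>w. \<Sum>j\<le>length w. \<Sum>k\<le>length w. nc_coeff (nc_lie_poly (H j k)) w)"
  have cnt: "\<forall>j k. \<forall>w\<in>Poly_Mapping.keys (H j k). lie_count_a w = j \<and> lie_count_b w = k"
    and eq: "nc_exp (nc_var Letter_a) * nc_exp (nc_var Letter_b) = nc_exp C"
    using assms unfolding cbh_expression_def C_def by blast+
  have C: "nc_coeff C w = (\<Sum>j\<le>length w. \<Sum>k\<le>length w. nc_coeff (nc_lie_poly (H j k)) w)" for w
    by (simp add: C_def Abs_ncps_inverse)
  have hom: "nc_coeff (nc_lie_poly (H j k)) w = 0" if "length w \<noteq> j + k" for j k w
    unfolding nc_lie_poly_def lincomb_def nc_coeff_sum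
    using that cnt by (intro sum.neutral) (auto simp: nc_coeff_const_times nc_coeff_lie_eval_eq_0)
  \<comment> \<open>By homogeneity the indices with \<open>j + k \<noteq> length w\<close>
    contribute nothing, so the range can be made independent of \<open>w\<close>.\<close>
  have C': "nc_coeff C w = (\<Sum>j\<le>N. \<Sum>k\<le>N. nc_coeff (nc_lie_poly (H j k)) w)" if "w \<in> short" for w
  proof -
    have "nc_coeff C w = (\<Sum>j\<le>length w. \<Sum>k\<le>N. nc_coeff (nc_lie_poly (H j k)) w)"
      unfolding C using that by (intro sum.cong refl sum.mono_neutral_left) (auto simp: short_def hom)
    also have "\<dots> = (\<Sum>j\<le>N. \<Sum>k\<le>N. nc_coeff (nc_lie_poly (H j k)) w)"
      using that by (intro sum.mono_neutral_left) (auto simp: short_def hom intro!: sum.neutral)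
    finally show ?thesis .
  qed
  \<comment> \<open>Every Lie word contains a letter. Hence \<open>C\<close> has no constant term,
    as \<open>ev_exp\<close> requires.\<close>
  have "\<forall>w\<in>Poly_Mapping.keys (H 0 0). False"
  proof
    fix w assume "w \<in> Poly_Mapping.keys (H 0 0)"
    then have "lie_count_a w + lie_count_b w = 0" using cnt by auto
    moreover have "lie_count_a w + lie_count_b w > 0" by (induction w) auto
    ultimately show False by simp
  qed
  then have "nc_coeff C [] = 0" by (simp add: C nc_lie_poly_def lincomb_def)
  have "ev C = (\<Sum>j\<le>N. \<Sum>k\<le>N. ev (nc_lie_poly (H j k)))"
    by (simp add: ev_def C' \<kappa>_sum sum_distrib_right sum.swap[of _ _ short])
  also have "\<dots> \<approx> cbh_trunc H \<kappa> N x y"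
    unfolding cbh_trunc_def nc_lie_poly_def lincomb_def ev_sum ev_const_times
    by (intro cong_sum cong_mult cong_refl ev_lie_eval)
  finally have evC: "ev C \<approx> cbh_trunc H \<kappa> N x y" .
  have "exp_trunc \<kappa> N x * exp_trunc \<kappa> N y \<approx> exp_trunc \<kappa> N (ev (nc_var Letter_a)) * exp_trunc \<kappa> N (ev (nc_var Letter_b))"
    using ev_var[of Letter_a] ev_var[of Letter_b] by (intro cong_mult exp_trunc_cong) (auto intro: cong_sym)
  also have "\<dots> \<approx> ev (nc_exp (nc_var Letter_a)) * ev (nc_exp (nc_var Letter_b))"
    by (intro cong_mult cong_sym[OF ev_exp]) (auto simp: nc_var.rep_eq)
  also have "\<dots> \<approx> ev (nc_exp C)"
    unfolding eq[symmetric] by (rule cong_sym[OF ev_mult])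
  also have "\<dots> \<approx> exp_trunc \<kappa> N (ev C)" by (rule ev_exp) fact
  also have "\<dots> \<approx> exp_trunc \<kappa> N (cbh_trunc H \<kappa> N x y)" by (rule exp_trunc_cong[OF evC])
  finally show ?thesis .
qed

end

section \<open>From the enveloping algebra to the Lie algebra\<close>

text \<open>
  The carrier of the ring \<open>free_algebra\<close> as a type. Power series over \<open>U(\<gg>)\<close> are then cosets of elements of
  the type-class ring \<open>('g, 'k) free_alg fps fps\<close>.
\<close>

typedef (overloaded) ('x, 'k::ring_1) free_alg = "{p :: ('x, 'k) ncps. finite {w. nc_coeff p w \<noteq> 0}}"
  morphisms to_ncps Abs_free_alg
  by (rule exI[of _ 0]) simp

setup_lifting type_definition_free_alg

instantiation free_alg :: (type, ring_1) ring_1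
begin

lift_definition zero_free_alg :: "('a, 'b) free_alg" is 0 by simp
lift_definition one_free_alg :: "('a, 'b) free_alg" is 1 by (rule finite_support_one)
lift_definition plus_free_alg :: "('a, 'b) free_alg \<Rightarrow> ('a, 'b) free_alg \<Rightarrow> ('a, 'b) free_alg"
  is "(+)" by (rule finite_support_add)
lift_definition minus_free_alg :: "('a, 'b) free_alg \<Rightarrow> ('a, 'b) free_alg \<Rightarrow> ('a, 'b) free_alg"
  is "(-)" by (rule finite_support_add)
lift_definition uminus_free_alg :: "('a, 'b) free_alg \<Rightarrow> ('a, 'b) free_alg"
  is uminus by simp
lift_definition times_free_alg :: "('a, 'b) free_alg \<Rightarrow> ('a, 'b) free_alg \<Rightarrow> ('a, 'b) free_alg"
  is "(*)" by (rule finite_support_times)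

instance
  by standard (transfer, simp add: mult.assoc distrib_left distrib_right add_ac)+

end

lift_definition fa_const :: "'k \<Rightarrow> ('x, 'k::ring_1) free_alg" is nc_const by (rule finite_support_const)
lift_definition fa_var :: "'x \<Rightarrow> ('x, 'k::ring_1) free_alg" is nc_var by (rule finite_support_var)

lemma nc_coeff_times_const: "nc_coeff (P * nc_const c) w = nc_coeff P w * c"
proof -
  have "nc_coeff (P * nc_const c) w = (\<Sum>i\<in>{length w}. nc_coeff P (take i w) * c)"
    unfolding times_ncps.rep_eq nc_const.rep_eq by (intro sum.mono_neutral_cong_right) auto
  then show ?thesis by simp
qed

lemma fa_const_simps:
  "fa_const (c + d) = fa_const c + fa_const d" "fa_const (c * d) = fa_const c * fa_const d"
  "fa_const 1 = 1"
  by (transfer; auto intro!: ncps_eqI simp: nc_const.rep_eq nc_coeff_const_times one_ncps.rep_eq)+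

lemma fa_const_commute: "fa_const c * p = p * fa_const (c :: 'k :: comm_ring_1)"
  by transfer (auto intro!: ncps_eqI simp: nc_coeff_const_times nc_coeff_times_const mult.commute)

section \<open>Series in two variables, modulo an ideal and up to a given degree\<close>

definition coef :: "'a fps fps \<Rightarrow> nat \<Rightarrow> nat \<Rightarrow> 'a" where
  "coef P i j = fps_nth (fps_nth P i) j"

definition to_fps :: "(nat \<Rightarrow> nat \<Rightarrow> 'a) \<Rightarrow> 'a fps fps" where
  "to_fps X = Abs_fps (\<lambda>i. Abs_fps (X i))"

lemma coef_to_fps [simp]: "coef (to_fps X) i j = X i j"
  by (simp add: coef_def to_fps_def)

lemma coef_simps [simp]:
  "coef 0 i j = 0" "coef (P + Q) i j = coef P i j + coef Q i j" "coef (P - Q) i j = coef P i j - coef Q i j"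
  by (simp_all add: coef_def)

lemma coef_1: "coef 1 i j = (if i = 0 \<and> j = 0 then 1 else 0)"
  by (simp add: coef_def)

lemma coef_sum: "coef (sum f A) i j = (\<Sum>k\<in>A. coef (f k :: 'a::ring_1 fps fps) i j)"
  by (induction A rule: infinite_finite_induct) auto

lemma coef_mult:
  fixes P Q :: "'a::ring_1 fps fps"
  shows "coef (P * Q) i j = (\<Sum>p\<le>i. \<Sum>q\<le>j. coef P p q * coef Q (i - p) (j - q))"
  by (simp add: coef_def fps_mult_nth fps_sum_nth atLeast0AtMost)

lemma coef_mult_const:
  fixes c :: "'a::ring_1"
  shows "coef (fps_const (fps_const c) * P) i j = c * coef P i j"
  by (simp add: coef_def)

lemma coef_mult_00: "coef (P * Q) 0 0 = coef P 0 0 * coef Q 0 (0::nat)" for P Q :: "'a::ring_1 fps fps"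
  by (simp add: coef_mult)

lemma coef_power_eq_0:
  fixes P :: "'a::ring_1 fps fps"
  assumes "coef P 0 0 = 0" "i + j < k"
  shows "coef (P ^ k) i j = 0"
  using assms(2)
proof (induction k arbitrary: i j)
  case (Suc k)
  have "coef P p q * coef (P ^ k) (i - p) (j - q) = 0" if "p \<le> i" "q \<le> j" for p q
    using assms(1) Suc that by (cases "p = 0 \<and> q = 0") auto
  then show ?case by (simp add: coef_mult)
qed auto

locale series_ideal = two_sided_ideal I for I :: "'a::ring_1 set"
begin

text \<open>This is I[[s,t]] + (s,t)^(n+1). Working modulo it imposes the relations in
  \<open>I\<close> on the coefficients and discards total degrees above \<open>n\<close> at the same
  time.\<close>

definition ser :: "nat \<Rightarrow> 'a fps fps set" where
  "ser n = {P. \<forall>i j. i + j \<le> n \<longrightarrow> coef P i j \<in> I}"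

lemma two_sided_ideal_ser: "two_sided_ideal (ser n)"
  by standard (auto simp: ser_def coef_mult zero_mem intro!: add_mem sum_mem intro: mult_left_mem mult_right_mem)

text \<open>A factor without constant term uses up at least one degree, so a product in total degree
  \<open>n + 1\<close> sees the other factor only up to degree \<open>n\<close>.\<close>

lemma ser_mult_Suc:
  assumes "P \<in> ser n" "coef Q 0 0 = 0"
  shows "Q * P \<in> ser (Suc n)" "P * Q \<in> ser (Suc n)"
proof -
  have "coef Q p q * coef P (i - p) (j - q) \<in> I" if "p \<le> i" "q \<le> j" "i + j \<le> Suc n" for p q i j
    using that assms by (cases "p = 0 \<and> q = 0") (auto simp: ser_def zero_mem intro!: mult_left_mem)
  then show "Q * P \<in> ser (Suc n)" by (auto simp: ser_def coef_mult intro!: sum_mem)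
  have "coef P p q * coef Q (i - p) (j - q) \<in> I" if "p \<le> i" "q \<le> j" "i + j \<le> Suc n" for p q i j
    using that assms by (cases "p = i \<and> q = j") (auto simp: ser_def zero_mem intro!: mult_right_mem)
  then show "P * Q \<in> ser (Suc n)" by (auto simp: ser_def coef_mult intro!: sum_mem)
qed

lemma ser_antimono: "m \<le> n \<Longrightarrow> ser n \<subseteq> ser m"
  by (auto simp: ser_def)

text \<open>Induction on the degree up to which \<open>W\<close> and \<open>Z\<close> agree. If they
  agree up to degree \<open>n\<close>, their powers of exponent at least 2 agree up to degree
  \<open>n + 1\<close>, so in that degree the difference of the exponentials is already the
  difference of the linear terms.\<close>

lemma exp_trunc_inject:
  assumes eq: "exp_trunc \<kappa> N W - exp_trunc \<kappa> N Z \<in> ser N"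
    and \<kappa>: "\<kappa> 1 = 1" and W: "coef W 0 0 = 0" and Z: "coef Z 0 0 = 0"
  shows "W - Z \<in> ser N"
proof -
  have "W - Z \<in> ser n" if "n \<le> N" for n
    using that
  proof (induction n)
    case 0
    then show ?case using W Z by (simp add: ser_def zero_mem)
  next
    case (Suc n)
    interpret Kn: two_sided_ideal "ser n" by (rule two_sided_ideal_ser)
    interpret KS: two_sided_ideal "ser (Suc n)" by (rule two_sided_ideal_ser)
    have D: "W - Z \<in> ser n" using Suc by simp
    have pow: "W ^ k - Z ^ k \<in> ser (Suc n)" if "k \<ge> 2" for k
    proof -
      define m where "m = k - 2"
      have k: "k = Suc (Suc m)" using that by (simp add: m_def)
      \<comment> \<open>In each summand one factor is a difference lying in \<open>ser n\<close> and
        the other has no constant term, which gains the missing degree.\<close>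
      have "W ^ k - Z ^ k = W * (W ^ Suc m - Z ^ Suc m) + (W - Z) * Z ^ Suc m"
        by (simp add: k algebra_simps)
      moreover have "W ^ Suc m - Z ^ Suc m \<in> ser n"
        using Kn.cong_power[of W Z "Suc m"] D by (simp add: Kn.cong_def)
      moreover have "coef (Z ^ Suc m) 0 0 = 0" using Z by (intro coef_power_eq_0) auto
      ultimately show ?thesis using D W by (simp only: KS.add_mem ser_mult_Suc)
    qed
    have split: "exp_trunc \<kappa> N P = \<kappa> (1 / fact 0) + P + (\<Sum>k\<in>{2..N}. \<kappa> (1 / fact k) * P ^ k)" for P
    proof -
      have "{..N} = {0} \<union> {1} \<union> {2..N}" using Suc.prems by auto
      then show ?thesis unfolding exp_trunc_def by (simp add: sum.union_disjoint \<kappa>)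
    qed
    have "W - Z = (exp_trunc \<kappa> N W - exp_trunc \<kappa> N Z) - (\<Sum>k\<in>{2..N}. \<kappa> (1 / fact k) * (W ^ k - Z ^ k))"
      by (simp add: split right_diff_distrib sum_subtractf)
    moreover have "exp_trunc \<kappa> N W - exp_trunc \<kappa> N Z \<in> ser (Suc n)"
      using eq ser_antimono[OF Suc.prems] by blast
    moreover have "(\<Sum>k\<in>{2..N}. \<kappa> (1 / fact k) * (W ^ k - Z ^ k)) \<in> ser (Suc n)"
      by (intro KS.sum_mem KS.mult_left_mem pow) auto
    ultimately show ?case by (simp only: KS.minus_mem)
  qed
  then show ?thesis by simp
qed

end

definition rat_series :: "rat \<Rightarrow> ('x, 'k::field_char_0) free_alg fps fps" where
  "rat_series r = fps_const (fps_const (fa_const (of_rat r)))"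

lemma rat_series_simps:
  "rat_series (r + s) = rat_series r + rat_series s" "rat_series (r * s) = rat_series r * rat_series s"
  "rat_series 1 = 1"
  by (simp_all add: rat_series_def of_rat_add of_rat_mult fa_const_simps)

lemma coef_rat_series_mult: "coef (rat_series r * P) i j = fa_const (of_rat r) * coef P i j"
  by (simp add: rat_series_def coef_mult_const)

lemma fps_fps_eqI: "(\<And>i j. coef P i j = coef Q i j) \<Longrightarrow> P = Q"
  by (intro fps_ext) (simp add: coef_def)

lemma rat_series_commute: "rat_series r * P = P * rat_series r"
proof (rule fps_fps_eqI)
  fix i j
  have "coef (P * rat_series r) i j = coef P i j * fa_const (of_rat r)"
    by (simp add: rat_series_def coef_def)
  then show "coef (rat_series r * P) i j = coef (P * rat_series r) i j"
    by (simp add: coef_rat_series_mult fa_const_commute)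
qed

lemma coef_exp_trunc:
  assumes "coef X 0 0 = 0" "i + j \<le> N"
  shows "coef (exp_trunc rat_series N X) i j = coef (exp_trunc rat_series (i + j) X) i j"
  unfolding exp_trunc_def coef_sum coef_rat_series_mult using assms
  by (intro sum.mono_neutral_right) (auto simp: coef_power_eq_0)

lemma coef_prod_list_eq_0:
  fixes X Y :: "'a::ring_1 fps fps"
  assumes "coef X 0 0 = 0" "coef Y 0 0 = 0" "i + j < length w"
  shows "coef (prod_list (map (case_letter X Y) w)) i j = 0"
  using assms(3)
proof (induction w arbitrary: i j)
  case (Cons l w)
  have "coef (case_letter X Y l) 0 0 = 0" using assms by (cases l) auto
  then have "coef (case_letter X Y l) p q * coef (prod_list (map (case_letter X Y) w)) (i - p) (j - q) = 0"
    if "p \<le> i" "q \<le> j" for p q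
    using Cons that by (cases "p = 0 \<and> q = 0") auto
  then show ?case by (simp add: coef_mult)
qed auto

lemma coef_lie_eval_00:
  fixes P Q :: "'a::ring_1 fps fps"
  assumes "coef P 0 0 = 0" "coef Q 0 0 = 0"
  shows "coef (lie_eval (\<lambda>p q. p * q - q * p) P Q w) 0 0 = 0"
  by (induction w) (simp_all add: assms coef_mult_00)

section \<open>Transfer between \<gg>[[s,t]] and U(\<gg>)[[s,t]]\<close>

locale char_0_lie_algebra = lie_algebra scale br
  for scale :: "'k::field_char_0 \<Rightarrow> 'g::ab_group_add \<Rightarrow> 'g" and br :: "'g \<Rightarrow> 'g \<Rightarrow> 'g"
begin

definition rel_ideal :: "('g, 'k) free_alg set" where
  "rel_ideal = {p. to_ncps p \<in> uea_ideal scale br}"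

lemma mem_rel_ideal: "p \<in> rel_ideal \<longleftrightarrow> to_ncps p \<in> uea_ideal scale br"
  by (simp add: rel_ideal_def)

sublocale I: ideal "uea_ideal scale br" "free_algebra :: ('g, 'k) ncps ring"
  by (rule ideal_uea_ideal)

lemma to_ncps_carrier: "to_ncps p \<in> carrier free_algebra"
  using to_ncps[of p] by (simp add: free_algebra_def)

sublocale series_ideal rel_ideal
proof
  show "(0 :: ('g, 'k) free_alg) \<in> rel_ideal"
    using additive_subgroup.zero_closed[OF I.is_additive_subgroup] by (simp add: mem_rel_ideal zero_free_alg.rep_eq free_algebra_def)
next
  fix p q :: "('g, 'k) free_alg"
  assume p: "p \<in> rel_ideal"
  show "p + q \<in> rel_ideal" if "q \<in> rel_ideal"
    using additive_subgroup.a_closed[OF I.is_additive_subgroup, of "to_ncps p" "to_ncps q"] p that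
    by (simp add: mem_rel_ideal plus_free_alg.rep_eq free_algebra_def)
  show "q * p \<in> rel_ideal"
    using I.I_l_closed[of "to_ncps p", OF _ to_ncps_carrier[of q]] p
    by (simp add: mem_rel_ideal times_free_alg.rep_eq free_algebra_def)
  show "p * q \<in> rel_ideal"
    using I.I_r_closed[of "to_ncps p", OF _ to_ncps_carrier[of q]] p
    by (simp add: mem_rel_ideal times_free_alg.rep_eq free_algebra_def)
qed

abbreviation rel_cong :: "('g, 'k) free_alg \<Rightarrow> ('g, 'k) free_alg \<Rightarrow> bool" (infix "\<approx>" 50) where
  "p \<approx> q \<equiv> cong p q"

lemma relations_mem:
  "fa_var (x + y) - fa_var x - fa_var y \<in> rel_ideal"
  "fa_var (scale c x) - fa_const c * fa_var x \<in> rel_ideal"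
  "fa_var x * fa_var y - fa_var y * fa_var x - fa_var (br x y) \<in> rel_ideal"
proof -
  have "uea_relations scale br \<subseteq> uea_ideal scale br"
    unfolding uea_ideal_def by (rule I.genideal_self[OF uea_relations_closed])
  then show "fa_var (x + y) - fa_var x - fa_var y \<in> rel_ideal"
    "fa_var (scale c x) - fa_const c * fa_var x \<in> rel_ideal"
    "fa_var x * fa_var y - fa_var y * fa_var x - fa_var (br x y) \<in> rel_ideal"
    unfolding rel_ideal_def mem_Collect_eq minus_free_alg.rep_eq times_free_alg.rep_eq fa_var.rep_eq fa_const.rep_eq uea_relations_def
    by blast+
qed

text \<open>The point where injectivity of \<gg> into U(\<gg>) enters: it turns a congruence of
  generators back into an equality in \<gg>.\<close>

lemma var_inject: "fa_var x \<approx> fa_var y \<Longrightarrow> x = y"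
  unfolding cong_def mem_rel_ideal
  by (rule uea_incl_inject) (simp add: minus_free_alg.rep_eq fa_var.rep_eq)

lemma var_add: "fa_var (x + y) \<approx> fa_var x + fa_var y"
  using relations_mem(1)[of x y] by (simp add: cong_def diff_diff_eq)

lemma var_scale: "fa_var (scale c x) \<approx> fa_const c * fa_var x"
  using relations_mem(2)[of c x] by (simp add: cong_def)

lemma var_br: "fa_var (br x y) \<approx> fa_var x * fa_var y - fa_var y * fa_var x"
  using relations_mem(3)[of x y, folded cong_def] by (rule cong_sym)

lemma var_0: "fa_var 0 \<approx> 0"
  using uminus_mem[of "- fa_var 0"] var_add[of 0 0] by (simp add: cong_def)

lemma var_sum: "fa_var (sum f A) \<approx> (\<Sum>a\<in>A. fa_var (f a))"
proof (induction A rule: infinite_finite_induct)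
  case (insert a A)
  have "fa_var (sum f (insert a A)) \<approx> fa_var (f a) + fa_var (sum f A)"
    using insert by (simp add: var_add)
  also have "\<dots> \<approx> (\<Sum>a\<in>insert a A. fa_var (f a))"
    using insert by (simp add: cong_add)
  finally show ?case .
qed (auto simp: var_0)

text \<open>
  The variable of the free algebra at \<open>0 \<in> \<gg>\<close> is only congruent to \<open>0\<close>. The case distinction makes the lift
  of a series without constant term a series without constant term.
\<close>

definition hat :: "'g series \<Rightarrow> ('g, 'k) free_alg fps fps" where
  "hat X = to_fps (\<lambda>i j. if X i j = 0 then 0 else fa_var (X i j))"

lemma coef_hat: "fa_var (X i j) \<approx> coef (hat X) i j"
  by (simp add: hat_def var_0)

text \<open>Modulo the relations, \<open>fa_var\<close> is additive and turns brackets into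
  commutators. Since s and t are central, this extends to series coefficient by coefficient.\<close>

lemma var_lie_eval:
  "fa_var (lie_eval (series_bilin br) X Y w i j) \<approx> coef (lie_eval (\<lambda>p q. p * q - q * p) (hat X) (hat Y) w) i j"
proof (induction w arbitrary: i j)
  case (LieBr u v)
  let ?f = "lie_eval (series_bilin br) X Y" and ?g = "lie_eval (\<lambda>p q. p * q - q * p) (hat X) (hat Y)"
  have "fa_var (?f (LieBr u v) i j) \<approx> (\<Sum>p\<le>i. fa_var (\<Sum>q\<le>j. br (?f u p q) (?f v (i - p) (j - q))))"
    by (simp add: series_bilin_def var_sum)
  also have "\<dots> \<approx> (\<Sum>p\<le>i. \<Sum>q\<le>j. fa_var (br (?f u p q) (?f v (i - p) (j - q))))"
    by (intro cong_sum var_sum)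
  also have "\<dots> \<approx> (\<Sum>p\<le>i. \<Sum>q\<le>j. fa_var (?f u p q) * fa_var (?f v (i - p) (j - q)) - fa_var (?f v (i - p) (j - q)) * fa_var (?f u p q))"
    by (intro cong_sum var_br)
  also have "\<dots> \<approx> (\<Sum>p\<le>i. \<Sum>q\<le>j. coef (?g u) p q * coef (?g v) (i - p) (j - q) - coef (?g v) (i - p) (j - q) * coef (?g u) p q)"
    by (intro cong_sum cong_diff cong_mult LieBr)
  also have "\<dots> = coef (?g u * ?g v) i j - (\<Sum>p\<le>i. \<Sum>q\<le>j. coef (?g v) (i - p) (j - q) * coef (?g u) p q)"
    by (simp add: coef_mult sum_subtractf)
  \<comment> \<open>The factors do not commute, so the second product of the commutator is
    recognized by reversing both summation indices.\<close>
  also have "(\<Sum>p\<le>i. \<Sum>q\<le>j. coef (?g v) (i - p) (j - q) * coef (?g u) p q) =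
      (\<Sum>p\<le>i. \<Sum>q\<le>j. coef (?g v) p q * coef (?g u) (i - p) (j - q))"
  proof -
    have *: "(\<Sum>q\<le>j. coef (?g v) (i - p) (j - q) * coef (?g u) p q) = (\<Sum>q\<le>j. coef (?g v) (i - p) q * coef (?g u) p (j - q))" for p
      by (rule sum.reindex_bij_witness[where i = "\<lambda>q. j - q" and j = "\<lambda>q. j - q"]) auto
    show ?thesis
      unfolding * by (rule sum.reindex_bij_witness[where i = "\<lambda>q. i - q" and j = "\<lambda>q. i - q"]) auto
  qed
  also have "coef (?g u * ?g v) i j - \<dots> = coef (?g (LieBr u v)) i j"
    by (simp add: coef_mult)
  finally show ?case .
qed (auto simp: coef_hat)

text \<open>The series C(X, Y) in \<gg>[[s,t]] with the cutoff of \<open>cbh_trunc\<close>. For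
  \<open>X\<close> and \<open>Y\<close> without constant term and a bihomogeneous \<open>H\<close>,
  the coefficient at \<open>(i, j)\<close> is final once \<open>i + j \<le> N\<close>.\<close>

definition lie_cbh :: "(nat \<Rightarrow> nat \<Rightarrow> lie_word \<Rightarrow>\<^sub>0 rat) \<Rightarrow> nat \<Rightarrow> 'g series \<Rightarrow> 'g series \<Rightarrow> 'g series" where
  "lie_cbh H N X Y i j = (\<Sum>m\<le>N. \<Sum>n\<le>N.
     lincomb (\<lambda>r. scale (of_rat r)) (\<lambda>w. lie_eval (series_bilin br) X Y w i j) (H m n))"

lemma var_lie_cbh: "fa_var (lie_cbh H N X Y i j) \<approx> coef (cbh_trunc H rat_series N (hat X) (hat Y)) i j"
proof -
  let ?f = "\<lambda>m n w. scale (of_rat (Poly_Mapping.lookup (H m n) w)) (lie_eval (series_bilin br) X Y w i j)"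
  have "fa_var (lie_cbh H N X Y i j) \<approx> (\<Sum>m\<le>N. fa_var (\<Sum>n\<le>N. \<Sum>w\<in>Poly_Mapping.keys (H m n). ?f m n w))"
    unfolding lie_cbh_def lincomb_def by (rule var_sum)
  also have "\<dots> \<approx> (\<Sum>m\<le>N. \<Sum>n\<le>N. fa_var (\<Sum>w\<in>Poly_Mapping.keys (H m n). ?f m n w))"
    by (intro cong_sum var_sum)
  also have "\<dots> \<approx> (\<Sum>m\<le>N. \<Sum>n\<le>N. \<Sum>w\<in>Poly_Mapping.keys (H m n). fa_var (?f m n w))"
    by (intro cong_sum var_sum)
  also have "\<dots> \<approx> (\<Sum>m\<le>N. \<Sum>n\<le>N. \<Sum>w\<in>Poly_Mapping.keys (H m n).
      fa_const (of_rat (Poly_Mapping.lookup (H m n) w)) * fa_var (lie_eval (series_bilin br) X Y w i j))"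
    by (intro cong_sum var_scale)
  also have "\<dots> \<approx> coef (cbh_trunc H rat_series N (hat X) (hat Y)) i j"
    unfolding cbh_trunc_def coef_sum lincomb_def coef_rat_series_mult
    by (intro cong_sum cong_mult cong_refl var_lie_eval)
  finally show ?thesis .
qed

definition coset :: "('g, 'k) free_alg \<Rightarrow> ('g, 'k) ncps set" where
  "coset p = uea_ideal scale br +>\<^bsub>free_algebra\<^esub> to_ncps p"

lemma coset_ring_hom:
  shows coset_carrier: "coset p \<in> carrier (uea scale br)"
    and coset_add: "coset (p + q) = coset p \<oplus>\<^bsub>uea scale br\<^esub> coset q"
    and coset_mult: "coset (p * q) = coset p \<otimes>\<^bsub>uea scale br\<^esub> coset q"
    and coset_1: "coset 1 = \<one>\<^bsub>uea scale br\<^esub>"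
proof -
  note hom = I.rcos_ring_hom
  show "coset p \<in> carrier (uea scale br)"
    unfolding coset_def uea_def by (rule ring_hom_closed[OF hom to_ncps_carrier])
  show "coset (p + q) = coset p \<oplus>\<^bsub>uea scale br\<^esub> coset q"
    using ring_hom_add[OF hom to_ncps_carrier[of p] to_ncps_carrier[of q]]
    unfolding coset_def uea_def plus_free_alg.rep_eq by (simp only: free_algebra_def ring.simps)
  show "coset (p * q) = coset p \<otimes>\<^bsub>uea scale br\<^esub> coset q"
    using ring_hom_mult[OF hom to_ncps_carrier[of p] to_ncps_carrier[of q]]
    unfolding coset_def uea_def times_free_alg.rep_eq by (simp only: free_algebra_def monoid.simps)
  show "coset 1 = \<one>\<^bsub>uea scale br\<^esub>"
    using ring_hom_one[OF hom]
    unfolding coset_def uea_def one_free_alg.rep_eq by (simp only: free_algebra_def monoid.simps)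
qed

sublocale U: ring "uea scale br"
  by (rule ring_uea)

lemma coset_0: "coset 0 = \<zero>\<^bsub>uea scale br\<^esub>"
proof -
  have "coset 0 \<oplus>\<^bsub>uea scale br\<^esub> coset 0 = \<zero>\<^bsub>uea scale br\<^esub> \<oplus>\<^bsub>uea scale br\<^esub> coset 0"
    unfolding coset_add[symmetric] U.l_zero[OF coset_carrier] by simp
  then show ?thesis
    using U.add.right_cancel[OF coset_carrier coset_carrier U.zero_closed] by blast
qed

lemma coset_eq_iff: "coset p = coset q \<longleftrightarrow> p \<approx> q"
proof -
  have "to_ncps p \<ominus>\<^bsub>free_algebra\<^esub> to_ncps q = to_ncps (p - q)"
  proof -
    have "\<ominus>\<^bsub>free_algebra\<^esub> to_ncps q = - to_ncps q"
      using to_ncps_carrier[of q] to_ncps_carrier[of "- q"]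
      by (intro I.minus_equality) (auto simp: free_algebra_def uminus_free_alg.rep_eq)
    then show ?thesis by (simp add: a_minus_def minus_free_alg.rep_eq) (simp add: free_algebra_def)
  qed
  then show ?thesis
    using I.quotient_eq_iff_same_a_r_cos[OF I.ideal_axioms to_ncps_carrier[of p] to_ncps_carrier[of q]]
    by (simp add: coset_def cong_def mem_rel_ideal)
qed

lemma coset_sum:
  assumes "finite A"
  shows "coset (sum f A) = finsum (uea scale br) (\<lambda>a. coset (f a)) A"
  using assms by (induction A rule: finite_induct) (simp_all add: coset_0 coset_add coset_carrier U.finsum_insert)

definition coset_series :: "('g, 'k) free_alg fps fps \<Rightarrow> ('g, 'k) ncps set series" where
  "coset_series P = (\<lambda>i j. coset (coef P i j))"

lemma coset_series_mult:
  "coset_series (P * Q) = coset_series P \<otimes>\<^bsub>series_ring (uea scale br)\<^esub> coset_series Q"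
  by (simp add: coset_series_def series_ring_def coef_mult coset_sum coset_mult)

lemma coset_series_power:
  "coset_series P [^]\<^bsub>series_ring (uea scale br)\<^esub> (k::nat) = coset_series (P ^ k)"
proof (induction k)
  case 0
  show ?case
    by (simp add: nat_pow_def, simp add: coset_series_def series_ring_def coef_1 fun_eq_iff coset_1 coset_0)
next
  case (Suc k)
  have "coset_series P [^]\<^bsub>series_ring (uea scale br)\<^esub> Suc k =
      (coset_series P [^]\<^bsub>series_ring (uea scale br)\<^esub> k) \<otimes>\<^bsub>series_ring (uea scale br)\<^esub> coset_series P"
    by (simp add: nat_pow_def)
  then show ?case by (simp only: Suc coset_series_mult[symmetric] power_Suc2)
qed

text \<open>The cutoff varies with the bidegree in order to match \<open>uea_exp\<close>. By
  \<open>coef_exp_trunc\<close> any larger cutoff gives the same coefficient when \<open>P\<close>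
  has no constant term.\<close>

definition exp_series :: "('g, 'k) free_alg fps fps \<Rightarrow> ('g, 'k) free_alg fps fps" where
  "exp_series P = to_fps (\<lambda>i j. coef (exp_trunc rat_series (i + j) P) i j)"

lemma uea_exp_coset: "uea_exp scale br X = coset_series (exp_series (hat X))"
proof -
  have "series_map (uea_incl scale br) X = (\<lambda>i j. coset (fa_var (X i j)))"
    by (simp add: series_map_def uea_incl_def coset_def fa_var.rep_eq)
  also have "\<dots> = coset_series (hat X)"
    by (simp add: coset_series_def fun_eq_iff coset_eq_iff coef_hat)
  finally have incl: "series_map (uea_incl scale br) X = coset_series (hat X)" .
  have sc: "uea_scale scale br (1 / fact k) (coset p) = coset (fa_const (1 / fact k) * p)" for k p
    unfolding uea_scale_def coset_mult by (simp add: coset_def fa_const.rep_eq)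
  have fact: "of_rat (1 / fact k) = (1 / fact k :: 'k)" for k
    by (metis of_nat_fact of_rat_1 of_rat_divide of_rat_of_nat_eq)
  show ?thesis
    unfolding uea_exp_def incl coset_series_power
    by (simp add: coset_series_def exp_series_def exp_trunc_def coef_sum coset_sum coef_rat_series_mult sc fact)
qed

lemma coef_exp_series_mult:
  assumes "coef P 0 0 = 0" "coef Q 0 0 = 0" "i + j \<le> N"
  shows "coef (exp_series P * exp_series Q) i j = coef (exp_trunc rat_series N P * exp_trunc rat_series N Q) i j"
  unfolding coef_mult exp_series_def coef_to_fps
  using assms by (intro sum.cong refl arg_cong2[where f = "(*)"] coef_exp_trunc[symmetric]) auto

theorem lie_cbh_eq_if_uea_exp_eq:
  assumes H: "cbh_expression H"
    and eq: "uea_exp scale br X \<otimes>\<^bsub>series_ring (uea scale br)\<^esub> uea_exp scale br Y = uea_exp scale br Z"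
    and 0: "X 0 0 = 0" "Y 0 0 = 0" "Z 0 0 = 0"
    and ij: "i + j \<le> N"
  shows "lie_cbh H N X Y i j = Z i j"
proof -
  let ?e = "exp_trunc rat_series N" and ?c = "cbh_trunc H rat_series N (hat X) (hat Y)"
  have hat_0: "coef (hat X) 0 0 = 0" "coef (hat Y) 0 0 = 0" "coef (hat Z) 0 0 = 0"
    by (simp_all add: hat_def 0)
  interpret K: two_sided_ideal "ser N" by (rule two_sided_ideal_ser)
  \<comment> \<open>Neither series has a constant term, so a monomial of length above
    \<open>N\<close> in them has no terms of total degree at most \<open>N\<close> and belongs to
    \<open>ser N\<close>.\<close>
  interpret E: nilpotent_evaluation "ser N" rat_series "hat X" "hat Y" N
    by standard (fact rat_series_simps rat_series_commute
        | use hat_0 in \<open>simp add: ser_def coef_prod_list_eq_0 zero_mem\<close>)+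
  have "?e (hat X) * ?e (hat Y) - ?e ?c \<in> ser N"
    using E.exp_trunc_mult[OF H] by (simp add: K.cong_def)
  moreover have "?e (hat X) * ?e (hat Y) - ?e (hat Z) \<in> ser N"
  proof -
    have "coset_series (exp_series (hat X) * exp_series (hat Y)) = coset_series (exp_series (hat Z))"
      using eq by (simp add: uea_exp_coset coset_series_mult)
    then have c: "coef (exp_series (hat X) * exp_series (hat Y)) p q \<approx> coef (exp_series (hat Z)) p q" for p q
      by (metis coset_series_def coset_eq_iff)
    have "coef (?e (hat X) * ?e (hat Y)) p q \<approx> coef (?e (hat Z)) p q" if "p + q \<le> N" for p q
      using c[of p q] that hat_0
      by (simp add: coef_exp_series_mult[where N = N] coef_exp_trunc[of "hat Z" p q N])
        (simp add: exp_series_def)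
    then show ?thesis by (simp add: ser_def cong_def)
  qed
  ultimately have "?e ?c - ?e (hat Z) \<in> ser N"
    using K.cong_trans[OF K.cong_sym] unfolding K.cong_def by blast
  \<comment> \<open>\<open>exp_trunc_inject\<close> is about exponents without constant
    term.\<close>
  moreover have "coef ?c 0 0 = 0"
    unfolding cbh_trunc_def coef_sum lincomb_def coef_rat_series_mult
    by (intro sum.neutral ballI) (simp add: coef_lie_eval_00 hat_0)
  ultimately have "?c - hat Z \<in> ser N"
    using exp_trunc_inject[of rat_series N ?c "hat Z"] hat_0 by (simp add: rat_series_simps)
  then have "coef ?c i j \<approx> coef (hat Z) i j"
    using ij by (simp add: ser_def cong_def)
  then show ?thesis
    by (intro var_inject cong_trans[OF var_lie_cbh] cong_trans[OF _ cong_sym[OF coef_hat]])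
qed

end

section \<open>Lie words of low degree and the first terms of the Campbell-Baker-Hausdorff
  series\<close>

lemma lie_count_pos: "lie_count_a w + lie_count_b w \<ge> 1"
  by (induction w) auto

lemma lie_word_1_0: "lie_count_a w = 1 \<Longrightarrow> lie_count_b w = 0 \<Longrightarrow> w = LieA"
  using lie_count_pos by (cases w) (auto, (metis One_nat_def add_is_0 add_is_1 not_one_le_zero)+)

lemma lie_word_0_1: "lie_count_a w = 0 \<Longrightarrow> lie_count_b w = 1 \<Longrightarrow> w = LieB"
  using lie_count_pos by (cases w) (auto, (metis One_nat_def add_is_0 add_is_1 not_one_le_zero)+)

text \<open>A bracket of words in a single letter is [x, x] or has a vanishing argument. The
  operation is left abstract because the lemma is applied to commutators of noncommutative series
  and to the bracket of \<gg>[[s,t]].\<close>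

lemma lie_eval_pure:
  fixes f :: "'l::zero \<Rightarrow> 'l \<Rightarrow> 'l"
  assumes "\<And>z. f z z = 0" "\<And>z. f 0 z = 0" "\<And>z. f z 0 = 0"
  shows "lie_count_b w = 0 \<Longrightarrow> w \<noteq> LieA \<Longrightarrow> lie_eval f x y w = 0"
    and "lie_count_a w = 0 \<Longrightarrow> w \<noteq> LieB \<Longrightarrow> lie_eval f x y w = 0"
proof -
  have "lie_eval f x y w = (if w = LieA then x else 0)" if "lie_count_b w = 0"
    using that by (induction w) (auto simp: assms)
  moreover have "lie_eval f x y w = (if w = LieB then y else 0)" if "lie_count_a w = 0"
    using that by (induction w) (auto simp: assms)
  ultimately show "lie_count_b w = 0 \<Longrightarrow> w \<noteq> LieA \<Longrightarrow> lie_eval f x y w = 0"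
    "lie_count_a w = 0 \<Longrightarrow> w \<noteq> LieB \<Longrightarrow> lie_eval f x y w = 0"
    by auto
qed

lemma lie_word_1_1:
  assumes "lie_count_a w = 1" "lie_count_b w = 1"
  shows "w = LieBr LieA LieB \<or> w = LieBr LieB LieA"
proof (cases w)
  case (LieBr u v)
  have "lie_count_a u + lie_count_b u = 1" "lie_count_a v + lie_count_b v = 1"
    using LieBr assms lie_count_pos[of u] lie_count_pos[of v] by auto
  then have "u = LieA \<or> u = LieB" "v = LieA \<or> v = LieB"
    by (metis One_nat_def add_is_1 lie_word_1_0 lie_word_0_1)+
  then show ?thesis using LieBr assms by auto
qed (use assms in auto)

lemma sum_keys_superset:
  assumes "finite S" "Poly_Mapping.keys p \<subseteq> S" "\<And>w. g 0 w = 0"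
  shows "(\<Sum>w\<in>Poly_Mapping.keys p. g (Poly_Mapping.lookup p w) w) = (\<Sum>w\<in>S. g (Poly_Mapping.lookup p w) w)"
  using assms by (intro sum.mono_neutral_left) (auto simp: in_keys_iff)

lemma nc_coeff_nc_lie_poly:
  assumes "finite S" "Poly_Mapping.keys h \<subseteq> S"
  shows "nc_coeff (nc_lie_poly h) w = (\<Sum>u\<in>S. Poly_Mapping.lookup h u *
    nc_coeff (lie_eval (\<lambda>p q. p * q - q * p) (nc_var Letter_a) (nc_var Letter_b) u) w)"
  unfolding nc_lie_poly_def lincomb_def nc_coeff_sum nc_coeff_const_times
  using assms by (intro sum_keys_superset) auto

text \<open>Comparison of the coefficients of a, b and ab in \<open>e^a e^b = e^C\<close>. An
  expression for the component of bidegree (1, 1) may mix [a, b] and [b, a], so only the difference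
  of their coefficients is determined.\<close>

lemma cbh_expression_low_degree:
  assumes "cbh_expression H"
  shows "Poly_Mapping.lookup (H 1 0) LieA = 1" "Poly_Mapping.lookup (H 0 1) LieB = 1"
    and "Poly_Mapping.lookup (H 1 1) (LieBr LieA LieB) - Poly_Mapping.lookup (H 1 1) (LieBr LieB LieA) = 1 / 2"
proof -
  define C :: "(letter, rat) ncps" where
    "C = Abs_ncps (\<lambda>w. \<Sum>j\<le>length w. \<Sum>k\<le>length w. nc_coeff (nc_lie_poly (H j k)) w)"
  have cnt: "\<And>j k w. w\<in>Poly_Mapping.keys (H j k) \<Longrightarrow> lie_count_a w = j \<and> lie_count_b w = k"
    and eq: "nc_exp (nc_var Letter_a) * nc_exp (nc_var Letter_b) = nc_exp C"
    using assms unfolding cbh_expression_def C_def by blast+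
  have C: "nc_coeff C w = (\<Sum>j\<le>length w. \<Sum>k\<le>length w. nc_coeff (nc_lie_poly (H j k)) w)" for w
    by (simp add: C_def Abs_ncps_inverse)
  have exp: "nc_coeff (nc_exp P) w = (\<Sum>k\<le>length w. nc_coeff (P ^ k) w / fact k)" for P :: "(letter, rat) ncps" and w
    by (simp add: nc_exp_def Abs_ncps_inverse)
  have hom: "nc_coeff (nc_lie_poly (H j k)) w = 0" if "length w \<noteq> j + k" for j k w
    unfolding nc_lie_poly_def lincomb_def nc_coeff_sum
    using that cnt by (intro sum.neutral) (auto simp: nc_coeff_const_times nc_coeff_lie_eval_eq_0)
  have k10: "Poly_Mapping.keys (H (Suc 0) 0) \<subseteq> {LieA}"
    using cnt lie_word_1_0 by (metis One_nat_def singletonI subsetI)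
  have k01: "Poly_Mapping.keys (H 0 (Suc 0)) \<subseteq> {LieB}"
    using cnt lie_word_0_1 by (metis One_nat_def singletonI subsetI)
  have k11: "Poly_Mapping.keys (H (Suc 0) (Suc 0)) \<subseteq> {LieBr LieA LieB, LieBr LieB LieA}"
    using cnt lie_word_1_1 by (metis One_nat_def insertCI subsetI)
  have k20: "nc_lie_poly (H 2 0) = 0"
    unfolding nc_lie_poly_def lincomb_def
  proof (intro sum.neutral ballI)
    fix u assume "u \<in> Poly_Mapping.keys (H 2 0)"
    then show "nc_const (Poly_Mapping.lookup (H 2 0) u) *
        lie_eval (\<lambda>p q. p * q - q * p) (nc_var Letter_a) (nc_var Letter_b) u = 0"
      using cnt[of u 2 0] by (subst lie_eval_pure(1)) auto
  qed
  have k02: "nc_lie_poly (H 0 2) = 0"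
    unfolding nc_lie_poly_def lincomb_def
  proof (intro sum.neutral ballI)
    fix u assume "u \<in> Poly_Mapping.keys (H 0 2)"
    then show "nc_const (Poly_Mapping.lookup (H 0 2) u) *
        lie_eval (\<lambda>p q. p * q - q * p) (nc_var Letter_a) (nc_var Letter_b) u = 0"
      using cnt[of u 0 2] by (subst lie_eval_pure(2)) auto
  qed
  have "Poly_Mapping.keys (H 0 0) = {}"
    using cnt[of _ 0 0] lie_count_pos by (metis add_0 equals0I not_one_le_zero)
  then have k00: "nc_lie_poly (H 0 0) = 0"
    by (simp add: nc_lie_poly_def lincomb_def)
  note simps = times_ncps.rep_eq nc_var.rep_eq one_ncps.rep_eq exp numeral_2_eq_2
  have C0: "nc_coeff C [] = 0" by (simp add: C k00)
  have "nc_coeff (nc_exp (nc_var Letter_a) * nc_exp (nc_var Letter_b)) [Letter_a] = nc_coeff (nc_exp C) [Letter_a]"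
    by (simp only: eq)
  then have a: "nc_coeff C [Letter_a] = 1" by (simp add: simps)
  have "nc_coeff (nc_exp (nc_var Letter_a) * nc_exp (nc_var Letter_b)) [Letter_b] = nc_coeff (nc_exp C) [Letter_b]"
    by (simp only: eq)
  then have b: "nc_coeff C [Letter_b] = 1" by (simp add: simps)
  \<comment> \<open>On the left the coefficient of ab is 1. On the right, C^2 / 2 contributes half
    the product of the coefficients of a and b, that is 1/2, which leaves 1/2 for
    \<open>C\<close>.\<close>
  have "nc_coeff (nc_exp (nc_var Letter_a) * nc_exp (nc_var Letter_b)) [Letter_a, Letter_b] = nc_coeff (nc_exp C) [Letter_a, Letter_b]"
    by (simp only: eq)
  then have ab: "nc_coeff C [Letter_a, Letter_b] = 1 / 2"
    by (simp add: simps a b C0)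
  show "Poly_Mapping.lookup (H 1 0) LieA = 1"
    using a by (simp add: C nc_coeff_nc_lie_poly[OF _ k10] nc_coeff_nc_lie_poly[OF _ k01] hom simps)
  show "Poly_Mapping.lookup (H 0 1) LieB = 1"
    using b by (simp add: C nc_coeff_nc_lie_poly[OF _ k10] nc_coeff_nc_lie_poly[OF _ k01] hom simps)
  show "Poly_Mapping.lookup (H 1 1) (LieBr LieA LieB) - Poly_Mapping.lookup (H 1 1) (LieBr LieB LieA) = 1 / 2"
    using ab by (simp add: C nc_coeff_nc_lie_poly[OF _ k11] hom k20[unfolded numeral_2_eq_2] k02[unfolded numeral_2_eq_2] simps)
qed

section \<open>Evaluation of the canonical factorization series\<close>

lemma proj_along_eqI:
  fixes x y :: "'g::ab_group_add"
  assumes "A \<inter> B = {0}" "\<And>u v. u \<in> A \<Longrightarrow> v \<in> A \<Longrightarrow> u - v \<in> A" "\<And>u v. u \<in> B \<Longrightarrow> v \<in> B \<Longrightarrow> u - v \<in> B"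
    and y: "y \<in> A" "x - y \<in> B"
  shows "proj_along A B x = y"
  unfolding proj_along_def
proof (rule the_equality)
  fix z assume z: "z \<in> A \<and> x - z \<in> B"
  have "z - y \<in> A" "(x - y) - (x - z) \<in> B"
    using assms(2)[of z y] assms(3)[OF y(2), of "x - z"] y z by auto
  then have "z - y \<in> A \<inter> B" by simp
  then show "z = y" using assms(1) by simp
qed (use y in simp)

lemma graded_sum_superset:
  assumes "i \<le> N" "j \<le> N" "\<And>m n. m > i \<or> n > j \<Longrightarrow> w m n i j = 0"
  shows "graded_sum w i j = (\<Sum>m\<le>N. \<Sum>n\<le>N. w m n i j)"
proof -
  have "graded_sum w i j = (\<Sum>m\<le>i. \<Sum>n\<le>N. w m n i j)"
    unfolding graded_sum_def using assms by (intro sum.cong refl sum.mono_neutral_left) auto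
  also have "\<dots> = (\<Sum>m\<le>N. \<Sum>n\<le>N. w m n i j)"
    using assms by (intro sum.mono_neutral_left) (auto intro!: sum.neutral)
  finally show ?thesis .
qed

text \<open>The reindexing of a Cauchy product: as pairs beyond the diagonal contribute nothing, the
  triangle can be completed to a square, where the two indices are independent.\<close>

lemma sum_atMost_split_pairs:
  fixes F :: "nat \<Rightarrow> nat \<Rightarrow> 'a::comm_monoid_add"
  assumes "\<And>p q. p + q > N \<Longrightarrow> F p q = 0"
  shows "(\<Sum>m\<le>N. \<Sum>p\<le>m. F p (m - p)) = (\<Sum>p\<le>N. \<Sum>q\<le>N. F p q)"
proof -
  have "(\<Sum>m\<le>N. \<Sum>p\<le>m. F p (m - p)) = (\<Sum>(m, p)\<in>(SIGMA m:{..N}. {..m}). F p (m - p))"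
    by (subst sum.Sigma) auto
  also have "\<dots> = (\<Sum>(p, q)\<in>{(p, q). p + q \<le> N}. F p q)"
    by (rule sum.reindex_bij_witness[where i = "\<lambda>(p, q). (p + q, p)" and j = "\<lambda>(m, p). (p, m - p)"]) auto
  also have "\<dots> = (\<Sum>(p, q)\<in>{..N} \<times> {..N}. F p q)"
    by (intro sum.mono_neutral_left) (auto intro: assms simp: not_le)
  finally show ?thesis by (simp add: sum.cartesian_product)
qed

text \<open>The property that makes the component at \<open>(m, n)\<close> evaluate to a multiple of
  s^m t^n, so that the finite cutoff in \<open>graded_sum\<close> loses no terms.\<close>

definition bihomogeneous :: "(word \<Rightarrow>\<^sub>0 rat) series \<Rightarrow> bool" where
  "bihomogeneous P \<longleftrightarrow> (\<forall>m n. \<forall>w\<in>Poly_Mapping.keys (P m n). count_a w = m \<and> count_b w = n)"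

lemma keys_sum_subset: "Poly_Mapping.keys (sum f A) \<subseteq> (\<Union>x\<in>A. Poly_Mapping.keys (f x))"
proof (induction A rule: infinite_finite_induct)
  case (insert x A)
  have "Poly_Mapping.keys (f x + sum f A) \<subseteq> Poly_Mapping.keys (f x) \<union> (\<Union>x\<in>A. Poly_Mapping.keys (f x))"
    using keys_add[of "f x" "sum f A"] insert.IH by (rule order_trans[OF _ Un_mono[OF order_refl]])
  then show ?case by (simp only: sum.insert[OF insert.hyps] UN_insert)
qed auto

lemma in_keys_sumE:
  assumes "w \<in> Poly_Mapping.keys (sum f A)"
  obtains x where "x \<in> A" "w \<in> Poly_Mapping.keys (f x)"
  using subsetD[OF keys_sum_subset assms] by blast

lemma in_keys_word_brE:
  assumes "w \<in> Poly_Mapping.keys (word_br p q)"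
  obtains u v where "u \<in> Poly_Mapping.keys p" "v \<in> Poly_Mapping.keys q" "w = WordBr u v"
proof -
  obtain u where u: "u \<in> Poly_Mapping.keys p" "w \<in> Poly_Mapping.keys (\<Sum>v\<in>Poly_Mapping.keys q.
      Poly_Mapping.single (WordBr u v) (Poly_Mapping.lookup p u * Poly_Mapping.lookup q v))"
    using assms unfolding word_br_def by (rule in_keys_sumE)
  from u(2) obtain v where "v \<in> Poly_Mapping.keys q"
    "w \<in> Poly_Mapping.keys (Poly_Mapping.single (WordBr u v) (Poly_Mapping.lookup p u * Poly_Mapping.lookup q v))"
    by (rule in_keys_sumE)
  then show ?thesis using that u(1) by (auto split: if_splits)
qed

lemma in_keys_word_mapE:
  assumes "w \<in> Poly_Mapping.keys (word_map f p)"
  obtains u where "u \<in> Poly_Mapping.keys p" "w = f u"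
proof -
  obtain u where "u \<in> Poly_Mapping.keys p" "w \<in> Poly_Mapping.keys (Poly_Mapping.single (f u) (Poly_Mapping.lookup p u))"
    using assms unfolding word_map_def by (rule in_keys_sumE)
  then show ?thesis using that by (auto split: if_splits)
qed

lemma keys_map_times: "Poly_Mapping.keys (Poly_Mapping.map ((*) r) p) \<subseteq> Poly_Mapping.keys p" for r :: rat
  by (simp add: subset_iff in_keys_iff Poly_Mapping.map.rep_eq when_def)

lemma bihomogeneous_series_bilin:
  assumes "bihomogeneous P" "bihomogeneous Q"
  shows "bihomogeneous (series_bilin word_br P Q)"
  unfolding bihomogeneous_def
proof (intro allI ballI)
  fix m n w assume "w \<in> Poly_Mapping.keys (series_bilin word_br P Q m n)"
  then obtain p where p: "p \<in> {..m}" "w \<in> Poly_Mapping.keys (\<Sum>q\<le>n. word_br (P p q) (Q (m - p) (n - q)))"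
    unfolding series_bilin_def by (rule in_keys_sumE)
  from p(2) obtain q where q: "q \<in> {..n}" "w \<in> Poly_Mapping.keys (word_br (P p q) (Q (m - p) (n - q)))"
    by (rule in_keys_sumE)
  from q(2) obtain u v where "u \<in> Poly_Mapping.keys (P p q)" "v \<in> Poly_Mapping.keys (Q (m - p) (n - q))" "w = WordBr u v"
    by (rule in_keys_word_brE)
  then show "count_a w = m \<and> count_b w = n"
    using assms p(1) q(1) by (auto simp: bihomogeneous_def)
qed

lemma bihomogeneous_lie_eval:
  "bihomogeneous P \<Longrightarrow> bihomogeneous Q \<Longrightarrow> bihomogeneous (lie_eval (series_bilin word_br) P Q w)"
  by (induction w) (auto intro: bihomogeneous_series_bilin)

lemma bihomogeneous_word_lie_poly:
  assumes "bihomogeneous P" "bihomogeneous Q"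
  shows "bihomogeneous (word_lie_poly P Q h)"
  unfolding bihomogeneous_def
proof (intro allI ballI)
  fix m n w assume "w \<in> Poly_Mapping.keys (word_lie_poly P Q h m n)"
  then obtain u where "w \<in> Poly_Mapping.keys (Poly_Mapping.map ((*) (Poly_Mapping.lookup h u))
      (lie_eval (series_bilin word_br) P Q u m n))"
    unfolding word_lie_poly_def lincomb_series_apply by (rule in_keys_sumE)
  then have "w \<in> Poly_Mapping.keys (lie_eval (series_bilin word_br) P Q u m n)"
    by (rule subsetD[OF keys_map_times])
  then show "count_a w = m \<and> count_b w = n"
    using bihomogeneous_lie_eval[OF assms, of u] by (simp add: bihomogeneous_def)
qed

lemma keys_bracket_part:
  assumes "bihomogeneous P" "bihomogeneous Q" "w \<in> Poly_Mapping.keys (bracket_part H P Q m n)"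
  shows "count_a w = m \<and> count_b w = n"
proof -
  obtain j where "w \<in> Poly_Mapping.keys (\<Sum>k = 1..n. word_lie_poly P Q (H j k) m n)"
    using assms(3) unfolding bracket_part_def by (rule in_keys_sumE)
  then obtain k where "w \<in> Poly_Mapping.keys (word_lie_poly P Q (H j k) m n)"
    by (rule in_keys_sumE)
  then show ?thesis
    using bihomogeneous_word_lie_poly[OF assms(1,2), of "H j k"] by (simp add: bihomogeneous_def)
qed

lemma bihomogeneous_F: "bihomogeneous (F_minus H)" "bihomogeneous (F_plus H)"
proof -
  have "(\<forall>w\<in>Poly_Mapping.keys (F_minus H m n). count_a w = m \<and> count_b w = n) \<and>
      (\<forall>w\<in>Poly_Mapping.keys (F_plus H m n). count_a w = m \<and> count_b w = n)" for m n
  proof (induction "m + n" arbitrary: m n rule: less_induct)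
    case less
    \<comment> \<open>The truncated series from the recursion; the induction hypothesis covers all
      their nonzero components.\<close>
    let ?P = "\<lambda>p q. if p + q < m + n then F_minus H p q else 0"
    let ?Q = "\<lambda>p q. if p + q < m + n then F_plus H p q else 0"
    have "bihomogeneous ?P" "bihomogeneous ?Q"
      unfolding bihomogeneous_def using less.hyps by auto
    note br = keys_bracket_part[OF this]
    show ?case
    proof (cases "m = 0 \<or> n = 0")
      case True
      show ?thesis unfolding F_minus_boundary[OF True] F_plus_boundary[OF True] by auto
    next
      case False
      then show ?thesis
        by (subst F_minus.simps, subst F_plus.simps)
          (auto simp: False elim!: in_keys_word_mapE dest: br)
    qed
  qed
  then show "bihomogeneous (F_minus H)" "bihomogeneous (F_plus H)"
    unfolding bihomogeneous_def by blast+
qed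

locale split_char_0_lie_algebra = split_lie_algebra scale br g_minus g_plus
  for scale :: "'k::field_char_0 \<Rightarrow> 'g::ab_group_add \<Rightarrow> 'g" and br :: "'g \<Rightarrow> 'g \<Rightarrow> 'g"
    and g_minus g_plus :: "'g set"
begin

sublocale char_0_lie_algebra scale br ..

abbreviation proj_minus :: "'g \<Rightarrow> 'g" where "proj_minus \<equiv> proj_along g_minus g_plus"
abbreviation proj_plus :: "'g \<Rightarrow> 'g" where "proj_plus \<equiv> proj_along g_plus g_minus"

lemma proj_eqI:
  assumes "y \<in> g_minus" "z \<in> g_plus" "x = y + z"
  shows "proj_minus x = y" "proj_plus x = z"
proof -
  note diff = subspace_diff[OF subspace_g_minus] subspace_diff[OF subspace_g_plus]
  show "proj_minus x = y"
    by (rule proj_along_eqI[OF g_minus_Int_g_plus diff assms(1)]) (use assms in simp_all)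
  show "proj_plus x = z"
    by (rule proj_along_eqI[OF g_minus_Int_g_plus[unfolded Int_commute[of g_minus]] diff(2,1) assms(2)])
      (use assms in simp_all)
qed

lemma proj_decomp: "proj_minus x \<in> g_minus" "proj_plus x \<in> g_plus" "proj_minus x + proj_plus x = x"
proof -
  obtain y z where "y \<in> g_minus" "z \<in> g_plus" "x = y + z" using g_minus_plus_g_plus by blast
  with proj_eqI[OF this] show "proj_minus x \<in> g_minus" "proj_plus x \<in> g_plus" "proj_minus x + proj_plus x = x"
    by auto
qed

lemma proj_add: "proj_minus (x + y) = proj_minus x + proj_minus y" "proj_plus (x + y) = proj_plus x + proj_plus y"
proof -
  have "x + y = (proj_minus x + proj_plus x) + (proj_minus y + proj_plus y)"
    by (simp only: proj_decomp(3))
  also have "\<dots> = (proj_minus x + proj_minus y) + (proj_plus x + proj_plus y)"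
    by (simp only: add_ac)
  finally have *: "x + y = (proj_minus x + proj_minus y) + (proj_plus x + proj_plus y)" .
  show "proj_minus (x + y) = proj_minus x + proj_minus y" "proj_plus (x + y) = proj_plus x + proj_plus y"
    by (rule proj_eqI[OF subspace_add[OF subspace_g_minus proj_decomp(1) proj_decomp(1)]
          subspace_add[OF subspace_g_plus proj_decomp(2) proj_decomp(2)] *])+
qed

lemma proj_scale: "proj_minus (scale c x) = scale c (proj_minus x)" "proj_plus (scale c x) = scale c (proj_plus x)"
proof -
  have *: "scale c x = scale c (proj_minus x) + scale c (proj_plus x)"
    by (simp only: scale_right_distrib[symmetric] proj_decomp(3))
  show "proj_minus (scale c x) = scale c (proj_minus x)" "proj_plus (scale c x) = scale c (proj_plus x)"
    by (rule proj_eqI[OF subspace_scale[OF subspace_g_minus proj_decomp(1)]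
          subspace_scale[OF subspace_g_plus proj_decomp(2)] *])+
qed

lemma proj_0: "proj_minus 0 = 0" "proj_plus 0 = 0"
  using proj_scale[of 0 0] by simp_all

lemma proj_sum: "proj_minus (sum f A) = (\<Sum>x\<in>A. proj_minus (f x))" "proj_plus (sum f A) = (\<Sum>x\<in>A. proj_plus (f x))"
  by (induction A rule: infinite_finite_induct) (simp_all add: proj_0 proj_add)

lemma br_zero: "br 0 x = 0" "br x 0 = 0"
  using br_scale_left[of 0 0 x] br_scale_right[of x 0 0] by simp_all

lemma br_sum: "br (sum f A) y = (\<Sum>x\<in>A. br (f x) y)" "br y (sum f A) = (\<Sum>x\<in>A. br y (f x))"
  by (induction A rule: infinite_finite_induct) (simp_all add: br_zero br_add_left br_add_right)

lemma series_bilin_antisym: "series_bilin br X Y i j = - series_bilin br Y X i j"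
proof -
  have *: "(\<Sum>q\<le>j. br (Y p q) (X (i - p) (j - q))) = (\<Sum>q\<le>j. br (Y p (j - q)) (X (i - p) q))" for p
    by (rule sum.reindex_bij_witness[where i = "\<lambda>q. j - q" and j = "\<lambda>q. j - q"]) auto
  have "series_bilin br Y X i j = (\<Sum>p\<le>i. \<Sum>q\<le>j. br (Y (i - p) (j - q)) (X p q))"
    unfolding series_bilin_def *
    by (rule sum.reindex_bij_witness[where i = "\<lambda>q. i - q" and j = "\<lambda>q. i - q"]) auto
  also have "\<dots> = - series_bilin br X Y i j"
    unfolding series_bilin_def sum_negf[symmetric] by (intro sum.cong refl br_antisym)
  finally show ?thesis by simp
qed

end

section \<open>Evaluation of formal series of words as a homomorphism\<close>

locale factorization_words = split_char_0_lie_algebra scale br g_minus g_plus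
  for scale :: "'k::field_char_0 \<Rightarrow> 'g::ab_group_add \<Rightarrow> 'g" and br :: "'g \<Rightarrow> 'g \<Rightarrow> 'g"
    and g_minus g_plus :: "'g set" +
  fixes a b :: "'g series"
  assumes a_0: "a 0 j = 0" and b_0: "b i 0 = 0" and a_minus: "a i j \<in> g_minus" and b_plus: "b i j \<in> g_plus"
begin

abbreviation val :: "word \<Rightarrow> 'g series" where
  "val \<equiv> word_eval br g_minus g_plus a b"

definition lin :: "(word \<Rightarrow>\<^sub>0 rat) \<Rightarrow> 'g series" where
  "lin = lincomb (\<lambda>r. series_scale scale (of_rat r)) val"

lemma lin_apply: "lin p i j = (\<Sum>w\<in>Poly_Mapping.keys p. scale (of_rat (Poly_Mapping.lookup p w)) (val w i j))"
  unfolding lin_def series_scale_def lincomb_series_apply by (rule refl)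

lemma lin_superset:
  assumes "finite S" "Poly_Mapping.keys p \<subseteq> S"
  shows "lin p i j = (\<Sum>w\<in>S. scale (of_rat (Poly_Mapping.lookup p w)) (val w i j))"
  unfolding lin_apply using assms by (intro sum_keys_superset) auto

lemma lin_0: "lin 0 i j = 0"
  by (simp add: lin_apply)

lemma lin_add: "lin (p + q) i j = lin p i j + lin q i j"
proof -
  let ?S = "Poly_Mapping.keys p \<union> Poly_Mapping.keys q"
  have "finite ?S" "Poly_Mapping.keys (p + q) \<subseteq> ?S" by (auto simp: keys_add)
  then show ?thesis
    by (simp add: lin_superset[of ?S] lookup_add of_rat_add scale_left_distrib sum.distrib)
qed

lemma lin_uminus: "lin (- p) i j = - lin p i j"
  using lin_add[of p "- p" i j] by (simp add: lin_0 eq_neg_iff_add_eq_0 add.commute)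

lemma lin_sum: "lin (sum f A) i j = (\<Sum>x\<in>A. lin (f x) i j)"
  by (induction A rule: infinite_finite_induct) (simp_all add: lin_0 lin_add)

lemma lin_single: "lin (Poly_Mapping.single w c) i j = scale (of_rat c) (val w i j)"
  by (subst lin_superset[of "{w}"]) auto

lemma lin_map_times: "lin (Poly_Mapping.map ((*) r) p) i j = scale (of_rat r) (lin p i j)"
proof -
  have "lin (Poly_Mapping.map ((*) r) p) i j =
      (\<Sum>w\<in>Poly_Mapping.keys p. scale (of_rat (r * Poly_Mapping.lookup p w)) (val w i j))"
    by (subst lin_superset[OF finite_keys keys_map_times]) (simp add: Poly_Mapping.map.rep_eq when_def in_keys_iff)
  then show ?thesis by (simp add: lin_apply scale_sum_right of_rat_mult)
qed

lemma lin_word_map: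
  "lin (word_map WordPm p) i j = proj_minus (lin p i j)"
  "lin (word_map WordPp p) i j = proj_plus (lin p i j)"
  by (simp_all add: word_map_def lin_sum lin_single lin_apply[of p] proj_sum proj_scale series_map_def)

lemma lin_word_br: "lin (word_br p q) i j = series_bilin br (lin p) (lin q) i j"
proof -
  let ?P = "Poly_Mapping.keys p" and ?Q = "Poly_Mapping.keys q"
  let ?c = "\<lambda>u v. of_rat (Poly_Mapping.lookup p u * Poly_Mapping.lookup q v) :: 'k"
  have "series_bilin br (lin p) (lin q) i j =
      (\<Sum>m\<le>i. \<Sum>n\<le>j. \<Sum>u\<in>?P. \<Sum>v\<in>?Q. scale (?c u v) (br (val u m n) (val v (i - m) (j - n))))"
    unfolding series_bilin_def lin_apply br_sum
    by (simp add: br_scale_left br_scale_right of_rat_mult sum.swap[of _ ?Q ?P] mult.commute)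
  also have "\<dots> = (\<Sum>u\<in>?P. \<Sum>v\<in>?Q. \<Sum>m\<le>i. \<Sum>n\<le>j. scale (?c u v) (br (val u m n) (val v (i - m) (j - n))))"
    by (simp only: sum.swap[of _ ?P "{..j}"] sum.swap[of _ ?P "{..i}"] sum.swap[of _ ?Q "{..j}"] sum.swap[of _ ?Q "{..i}"])
  also have "\<dots> = lin (word_br p q) i j"
    by (simp add: word_br_def lin_sum lin_single series_bilin_def scale_sum_right)
  finally show ?thesis by simp
qed

lemma val_eq_0: "i < count_a w \<or> j < count_b w \<Longrightarrow> val w i j = 0"
proof (induction w arbitrary: i j)
  case (WordBr u v)
  have "br (val u p q) (val v (i - p) (j - q)) = 0" if "p \<le> i" "q \<le> j" for p q
  proof (cases "p < count_a u \<or> q < count_b u")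
    case True
    then show ?thesis using WordBr.IH(1) by (simp add: br_zero)
  next
    case False
    then have "i - p < count_a v \<or> j - q < count_b v" using WordBr.prems that by auto
    then show ?thesis using WordBr.IH(2) by (simp add: br_zero)
  qed
  then show ?case by (simp add: series_bilin_def)
qed (auto simp: a_0 b_0 series_map_def proj_0)

lemma lin_eq_0: "bihomogeneous P \<Longrightarrow> m > i \<or> n > j \<Longrightarrow> lin (P m n) i j = 0"
  unfolding lin_apply bihomogeneous_def by (intro sum.neutral ballI) (auto simp: val_eq_0)

definition ev_series :: "(word \<Rightarrow>\<^sub>0 rat) series \<Rightarrow> 'g series" where
  "ev_series P = graded_sum (\<lambda>m n. lin (P m n))"

lemma ev_series_eq: "ev_series P = word_series_eval scale br g_minus g_plus a b P"
  by (simp add: ev_series_def word_series_eval_def lin_def)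

lemma ev_series_superset:
  "bihomogeneous P \<Longrightarrow> i \<le> N \<Longrightarrow> j \<le> N \<Longrightarrow> ev_series P i j = (\<Sum>m\<le>N. \<Sum>n\<le>N. lin (P m n) i j)"
  unfolding ev_series_def by (intro graded_sum_superset lin_eq_0)

text \<open>Evaluation respects brackets. The grading of words and the grading by powers of s and t
  are summed independently; bihomogeneity bounds the former by the latter, so all sums are finite
  and may be interchanged.\<close>

lemma ev_series_bilin:
  assumes P: "bihomogeneous P" and Q: "bihomogeneous Q"
  shows "ev_series (series_bilin word_br P Q) = series_bilin br (ev_series P) (ev_series Q)"
proof (intro ext)
  fix i j :: nat
  define N where "N = i + j"
  let ?B = "\<lambda>p q p' q'. series_bilin br (lin (P p q)) (lin (Q p' q')) i j"
  \<comment> \<open>This vanishing allows every range to be enlarged to the common bound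
    \<open>N\<close>, which decouples the bidegrees of the two factors.\<close>
  have B0: "?B p q p' q' = 0" if "p + p' > i \<or> q + q' > j" for p q p' q'
  proof -
    have "br (lin (P p q) k l) (lin (Q p' q') (i - k) (j - l)) = 0" if "k \<le> i" "l \<le> j" for k l
    proof (cases "p > k \<or> q > l")
      case True
      then show ?thesis using lin_eq_0[OF P] by (simp add: br_zero)
    next
      case False
      then have "p' > i - k \<or> q' > j - l" using that \<open>p + p' > i \<or> q + q' > j\<close> by auto
      then show ?thesis using lin_eq_0[OF Q] by (simp add: br_zero)
    qed
    then show ?thesis by (simp add: series_bilin_def)
  qed
  have "ev_series (series_bilin word_br P Q) i j =
      (\<Sum>m\<le>N. \<Sum>n\<le>N. \<Sum>p\<le>m. \<Sum>q\<le>n. ?B p q (m - p) (n - q))"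
    unfolding ev_series_superset[OF bihomogeneous_series_bilin[OF P Q], of i N j, unfolded N_def, simplified] N_def
    by (simp add: series_bilin_def[of word_br] lin_sum lin_word_br)
  also have "\<dots> = (\<Sum>m\<le>N. \<Sum>p\<le>m. \<Sum>n\<le>N. \<Sum>q\<le>n. ?B p q (m - p) (n - q))"
    by (intro sum.cong refl sum.swap)
  also have "\<dots> = (\<Sum>m\<le>N. \<Sum>p\<le>m. \<Sum>q\<le>N. \<Sum>q'\<le>N. ?B p q (m - p) q')"
    by (intro sum.cong refl sum_atMost_split_pairs B0) (simp add: N_def)
  also have "\<dots> = (\<Sum>p\<le>N. \<Sum>p'\<le>N. \<Sum>q\<le>N. \<Sum>q'\<le>N. ?B p q p' q')"
    by (intro sum_atMost_split_pairs sum.neutral ballI B0) (simp add: N_def)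
  also have "\<dots> = (\<Sum>k\<le>i. \<Sum>l\<le>j. \<Sum>p\<le>N. \<Sum>p'\<le>N. \<Sum>q\<le>N. \<Sum>q'\<le>N.
      br (lin (P p q) k l) (lin (Q p' q') (i - k) (j - l)))"
    unfolding series_bilin_def by (simp only: sum.swap[of _ "{..i}" "{..N}"] sum.swap[of _ "{..j}" "{..N}"])
  also have "\<dots> = (\<Sum>k\<le>i. \<Sum>l\<le>j. br (\<Sum>p\<le>N. \<Sum>q\<le>N. lin (P p q) k l) (\<Sum>p'\<le>N. \<Sum>q'\<le>N. lin (Q p' q') (i - k) (j - l)))"
  proof (intro sum.cong refl)
    fix k l
    show "(\<Sum>p\<le>N. \<Sum>p'\<le>N. \<Sum>q\<le>N. \<Sum>q'\<le>N. br (lin (P p q) k l) (lin (Q p' q') (i - k) (j - l))) =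
      br (\<Sum>p\<le>N. \<Sum>q\<le>N. lin (P p q) k l) (\<Sum>p'\<le>N. \<Sum>q'\<le>N. lin (Q p' q') (i - k) (j - l))"
      unfolding br_sum(1) unfolding br_sum(2) by (rule sum.cong[OF refl], rule sum.swap)
  qed
  also have "\<dots> = series_bilin br (ev_series P) (ev_series Q) i j"
    unfolding series_bilin_def
    by (intro sum.cong refl arg_cong2[where f = br] ev_series_superset[OF P, symmetric] ev_series_superset[OF Q, symmetric])
      (auto simp: N_def)
  finally show "ev_series (series_bilin word_br P Q) i j = series_bilin br (ev_series P) (ev_series Q) i j" .
qed

end

section \<open>Uniqueness of the factorization\<close>

lemma sum_square_split:
  fixes f :: "nat \<Rightarrow> nat \<Rightarrow> 'a::comm_monoid_add"
  assumes "f 0 0 = 0" "\<And>m. m \<ge> 2 \<Longrightarrow> f m 0 = 0" "\<And>n. n \<ge> 2 \<Longrightarrow> f 0 n = 0" "N \<ge> 1"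
  shows "(\<Sum>m\<le>N. \<Sum>n\<le>N. f m n) = f 1 0 + f 0 1 + (\<Sum>m = 1..N. \<Sum>n = 1..N. f m n)"
proof -
  have N: "{..N} = insert 0 {1..N}" by auto
  have one: "(\<Sum>m = 1..N. g m) = g 1" if "\<And>m. m \<ge> 2 \<Longrightarrow> g m = 0" for g :: "nat \<Rightarrow> 'a"
    using assms(4) that by (subst sum.mono_neutral_right[of _ "{1}"]) auto
  show ?thesis
    unfolding N using assms(1) one[of "f 0"] one[of "\<lambda>m. f m 0"] assms(2,3)
    by (simp add: sum.distrib add_ac)
qed

lemma sum_point:
  fixes x :: "'a::comm_monoid_add" and p q N :: nat
  assumes "p \<le> N" "q \<le> N"
  shows "(\<Sum>m\<le>N. \<Sum>n\<le>N. if m = p then if n = q then x else 0 else 0) = x"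
proof -
  have "(\<Sum>n\<le>N. if m = p then if n = q then x else 0 else 0) = (if m = p then x else 0)" for m
    using assms by simp
  then show ?thesis using assms by simp
qed

context split_char_0_lie_algebra
begin

lemma double_eq_0:
  assumes "x = - (x :: 'g)"
  shows "x = 0"
proof -
  have "scale 2 x = x + x" using scale_left_distrib[of 1 1 x] by simp
  also have "\<dots> = 0" using assms by (metis add.right_inverse)
  finally show ?thesis by simp
qed

lemma series_bilin_zero: "series_bilin br 0 X = 0" "series_bilin br X 0 = 0"
  by (simp_all add: series_bilin_def br_zero fun_eq_iff)

text \<open>Antisymmetry makes the value equal to its negative, and 2 is invertible in
  characteristic zero.\<close>

lemma series_bilin_self: "series_bilin br X X = 0"
  using double_eq_0[OF series_bilin_antisym[of X X]] by (simp add: fun_eq_iff)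

definition cbh_part :: "(nat \<Rightarrow> nat \<Rightarrow> lie_word \<Rightarrow>\<^sub>0 rat) \<Rightarrow> 'g series \<Rightarrow> 'g series \<Rightarrow> nat \<Rightarrow> nat \<Rightarrow> 'g series" where
  "cbh_part H X Y m n i j = lincomb (\<lambda>r. scale (of_rat r)) (\<lambda>w. lie_eval (series_bilin br) X Y w i j) (H m n)"

lemma cbh_part_superset:
  assumes "finite S" "Poly_Mapping.keys (H m n) \<subseteq> S"
  shows "cbh_part H X Y m n i j = (\<Sum>w\<in>S. scale (of_rat (Poly_Mapping.lookup (H m n) w)) (lie_eval (series_bilin br) X Y w i j))"
  unfolding cbh_part_def lincomb_def using assms by (intro sum_keys_superset) auto

text \<open>Pure words other than a single letter vanish by \<open>lie_eval_pure\<close>, and the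
  two single letters have coefficient 1, so the border of the square of indices reduces to
  \<open>X\<close> and \<open>Y\<close>.\<close>

lemma lie_cbh_split:
  assumes H: "cbh_expression H" and N: "N \<ge> 1"
  shows "lie_cbh H N X Y i j = X i j + Y i j + (\<Sum>m = 1..N. \<Sum>n = 1..N. cbh_part H X Y m n i j)"
proof -
  have cnt: "lie_count_a w = m \<and> lie_count_b w = n" if "w \<in> Poly_Mapping.keys (H m n)" for m n w
    using H that unfolding cbh_expression_def by blast
  have "w = LieA" if "w \<in> Poly_Mapping.keys (H 1 0)" for w
    using cnt[OF that] lie_word_1_0 by simp
  then have c10: "cbh_part H X Y 1 0 i j = X i j"
    using cbh_expression_low_degree(1)[OF H] by (subst cbh_part_superset[of "{LieA}"]) auto
  have "w = LieB" if "w \<in> Poly_Mapping.keys (H 0 1)" for w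
    using cnt[OF that] lie_word_0_1 by simp
  then have c01: "cbh_part H X Y 0 1 i j = Y i j"
    using cbh_expression_low_degree(2)[OF H] by (subst cbh_part_superset[of "{LieB}"]) auto
  have m0: "cbh_part H X Y m 0 i j = 0" if "m \<noteq> 1" for m
    unfolding cbh_part_def lincomb_def
  proof (intro sum.neutral ballI)
    fix w assume w: "w \<in> Poly_Mapping.keys (H m 0)"
    have "w \<noteq> LieA" using cnt[OF w] that by auto
    then have "lie_eval (series_bilin br) X Y w = 0"
      using cnt[OF w] by (intro lie_eval_pure(1) series_bilin_zero series_bilin_self) auto
    then show "scale (of_rat (Poly_Mapping.lookup (H m 0) w)) (lie_eval (series_bilin br) X Y w i j) = 0"
      by simp
  qed
  have n0: "cbh_part H X Y 0 n i j = 0" if "n \<noteq> 1" for n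
    unfolding cbh_part_def lincomb_def
  proof (intro sum.neutral ballI)
    fix w assume w: "w \<in> Poly_Mapping.keys (H 0 n)"
    have "w \<noteq> LieB" using cnt[OF w] that by auto
    then have "lie_eval (series_bilin br) X Y w = 0"
      using cnt[OF w] by (intro lie_eval_pure(2) series_bilin_zero series_bilin_self) auto
    then show "scale (of_rat (Poly_Mapping.lookup (H 0 n) w)) (lie_eval (series_bilin br) X Y w i j) = 0"
      by simp
  qed
  have "lie_cbh H N X Y i j = (\<Sum>m\<le>N. \<Sum>n\<le>N. cbh_part H X Y m n i j)"
    by (simp add: lie_cbh_def cbh_part_def)
  also have "\<dots> = cbh_part H X Y 1 0 i j + cbh_part H X Y 0 1 i j + (\<Sum>m = 1..N. \<Sum>n = 1..N. cbh_part H X Y m n i j)"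
    using N by (intro sum_square_split m0 n0) auto
  finally show ?thesis unfolding c10 c01 .
qed

lemma lie_eval_series_00:
  assumes "X 0 0 = 0" "Y 0 0 = 0"
  shows "lie_eval (series_bilin br) X Y w 0 0 = 0"
  by (induction w) (auto simp: assms series_bilin_def br_zero)

text \<open>The second alternative for \<open>w\<close> is the point: a bracket in total degree
  exactly \<open>d\<close> is determined by its arguments below \<open>d\<close>, because neither
  factor has a constant term.\<close>

lemma lie_eval_series_agree:
  assumes "X 0 0 = 0" "Y 0 0 = 0" "X' 0 0 = 0" "Y' 0 0 = 0"
    and "\<And>p q. p + q < d \<Longrightarrow> X p q = X' p q" "\<And>p q. p + q < d \<Longrightarrow> Y p q = Y' p q"
    and "m + n < d \<or> m + n \<le> d \<and> (\<exists>u v. w = LieBr u v)"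
  shows "lie_eval (series_bilin br) X Y w m n = lie_eval (series_bilin br) X' Y' w m n"
  using assms(7)
proof (induction w arbitrary: m n)
  case (LieBr u v)
  let ?e = "lie_eval (series_bilin br) X Y" and ?e' = "lie_eval (series_bilin br) X' Y'"
  have le: "m + n \<le> d"
    using LieBr.prems by auto
  have "br (?e u p q) (?e v (m - p) (n - q)) = br (?e' u p q) (?e' v (m - p) (n - q))"
    if pq: "p \<le> m" "q \<le> n" for p q
  proof -
    \<comment> \<open>If one factor takes the whole degree, the other is a constant term and
      vanishes; otherwise both factors have degree below \<open>d\<close>.\<close>
    consider "p = 0" "q = 0" | "m - p = 0" "n - q = 0" | "p + q < d" "(m - p) + (n - q) < d"
      using le pq by atomize_elim presburger
    then show ?thesis
      by cases (use LieBr.IH lie_eval_series_00 assms(1-4) in \<open>auto simp: br_zero\<close>)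
  qed
  then show ?case by (simp add: series_bilin_apply[of _ "lie_eval _ _ _ _"])
qed (use assms in auto)

text \<open>In a bidegree \<open>(i, j)\<close>, the brackets only involve the factors in lower degrees, so that the equation
  determines the sum \<open>X i j + Y i j\<close>, and hence its components in \<open>\<gg>\<^sup>-\<close> and \<open>\<gg>\<^sup>+\<close>.\<close>

lemma factorization_unique:
  assumes H: "cbh_expression H"
    and "X \<in> series_in g_minus" "X' \<in> series_in g_minus" "Y \<in> series_in g_plus" "Y' \<in> series_in g_plus"
    and 0: "X 0 0 = 0" "Y 0 0 = 0" "X' 0 0 = 0" "Y' 0 0 = 0"
    and eq: "\<And>i j. lie_cbh H (Suc (i + j)) X Y i j = lie_cbh H (Suc (i + j)) X' Y' i j"
  shows "X = X' \<and> Y = Y'"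
proof -
  have "X i j = X' i j \<and> Y i j = Y' i j" for i j
  proof (induction "i + j" arbitrary: i j rule: less_induct)
    case less
    \<comment> \<open>The successor keeps the cutoff at least 1 also for \<open>i = j = 0\<close>,
      as \<open>lie_cbh_split\<close> demands.\<close>
    let ?N = "Suc (i + j)"
    have "cbh_part H X Y m n i j = cbh_part H X' Y' m n i j" if "m \<ge> 1" "n \<ge> 1" for m n
      unfolding cbh_part_def lincomb_def
    proof (intro sum.cong refl arg_cong[where f = "scale _"] lie_eval_series_agree[of X Y X' Y' "i + j", OF 0])
      fix w assume "w \<in> Poly_Mapping.keys (H m n)"
      then have "lie_count_a w = m \<and> lie_count_b w = n" using H unfolding cbh_expression_def by blast
      then show "i + j < i + j \<or> i + j \<le> i + j \<and> (\<exists>u v. w = LieBr u v)"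
        using that by (cases w) auto
    qed (use less in auto)
    then have "(\<Sum>m = 1..?N. \<Sum>n = 1..?N. cbh_part H X Y m n i j) = (\<Sum>m = 1..?N. \<Sum>n = 1..?N. cbh_part H X' Y' m n i j)"
      by (intro sum.cong refl) auto
    then have sum_eq: "X i j + Y i j = X' i j + Y' i j"
      using eq[of i j] by (simp only: lie_cbh_split[OF H, of ?N] One_nat_def le_add1 plus_1_eq_Suc Suc_le_mono le0 add_right_cancel)
    have mem: "X i j \<in> g_minus" "X' i j \<in> g_minus" "Y i j \<in> g_plus" "Y' i j \<in> g_plus"
      using assms(2-5) by (auto simp: series_in_def)
    show ?case
      using proj_eqI[OF mem(1,3) refl] proj_eqI[OF mem(2,4) sum_eq] by simp
  qed
  then show ?thesis by (auto simp: fun_eq_iff)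
qed

end

section \<open>The equation solved by the canonical series, and its lowest-order terms\<close>

context factorization_words
begin

lemma ev_lie_eval_word:
  assumes "bihomogeneous P" "bihomogeneous Q"
  shows "ev_series (lie_eval (series_bilin word_br) P Q w) = lie_eval (series_bilin br) (ev_series P) (ev_series Q) w"
  by (induction w) (simp_all add: ev_series_bilin bihomogeneous_lie_eval assms)

lemma lin_word_lie_poly:
  "lin (word_lie_poly P Q h m n) i j = (\<Sum>w\<in>Poly_Mapping.keys h.
     scale (of_rat (Poly_Mapping.lookup h w)) (lin (lie_eval (series_bilin word_br) P Q w m n) i j))"
  unfolding word_lie_poly_def lincomb_series_apply lin_sum lin_map_times by (rule refl)

lemma ev_word_lie_poly:
  assumes "bihomogeneous P" "bihomogeneous Q"
  shows "ev_series (word_lie_poly P Q (H m n)) i j = cbh_part H (ev_series P) (ev_series Q) m n i j"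
proof -
  have "ev_series (word_lie_poly P Q (H m n)) i j = (\<Sum>w\<in>Poly_Mapping.keys (H m n).
     scale (of_rat (Poly_Mapping.lookup (H m n) w)) (ev_series (lie_eval (series_bilin word_br) P Q w) i j))"
    unfolding ev_series_def graded_sum_def lin_word_lie_poly scale_sum_right
    by (simp only: sum.swap[of _ "Poly_Mapping.keys (H m n)" "{..i}"] sum.swap[of _ "Poly_Mapping.keys (H m n)" "{..j}"])
  then show ?thesis
    by (simp add: cbh_part_def lincomb_def ev_lie_eval_word assms)
qed

text \<open>The projections add up to the identity, so in bidegrees with \<open>m, n \<ge> 1\<close>
  the sum of the two recursions cancels the bracket part. On the border the bracket part is an empty
  sum, and only the initial values are left.\<close>

lemma lin_F:
  assumes "\<forall>j k. \<forall>w\<in>Poly_Mapping.keys (H j k). lie_count_a w = j \<and> lie_count_b w = k"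
  shows "lin (F_minus H m n) i j + lin (F_plus H m n) i j + lin (bracket_part H (F_minus H) (F_plus H) m n) i j =
    (if m = 1 then if n = 0 then a i j else 0 else 0) + (if m = 0 then if n = 1 then b i j else 0 else 0)"
proof (cases "m = 0 \<or> n = 0")
  case True
  then have "bracket_part H (F_minus H) (F_plus H) m n = 0" by (auto simp: bracket_part_def)
  then show ?thesis
    unfolding F_minus_boundary[OF True] F_plus_boundary[OF True] using True
    by (auto simp: lin_0 lin_single)
next
  case False
  then have "m \<ge> 1" "n \<ge> 1" by auto
  note rec = F_recursion[OF assms this]
  let ?l = "lin (bracket_part H (F_minus H) (F_plus H) m n) i j"
  have "lin (F_minus H m n) i j + lin (F_plus H m n) i j + ?l = - proj_minus ?l - proj_plus ?l + (proj_minus ?l + proj_plus ?l)"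
    unfolding rec lin_uminus lin_word_map proj_decomp(3) by simp
  then show ?thesis using False by simp
qed

lemma lin_bracket_part:
  assumes "\<forall>j k. \<forall>w\<in>Poly_Mapping.keys (H j k). lie_count_a w = j \<and> lie_count_b w = k" "m \<le> N" "n \<le> N"
  shows "(\<Sum>p = 1..N. \<Sum>q = 1..N. lin (word_lie_poly (F_minus H) (F_plus H) (H p q) m n) i j) =
    lin (bracket_part H (F_minus H) (F_plus H) m n) i j"
proof -
  let ?f = "\<lambda>p q. lin (word_lie_poly (F_minus H) (F_plus H) (H p q) m n) i j"
  have 0: "?f p q = 0" if "p > m \<or> q > n" for p q
    using bracket_part_omitted_terms[OF assms(1) that] by (simp add: lin_0)
  have "(\<Sum>p = 1..N. \<Sum>q = 1..N. ?f p q) = (\<Sum>p = 1..N. \<Sum>q = 1..n. ?f p q)"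
    using assms(3) by (intro sum.cong refl sum.mono_neutral_right) (auto simp: 0)
  also have "\<dots> = (\<Sum>p = 1..m. \<Sum>q = 1..n. ?f p q)"
    using assms(2) by (intro sum.mono_neutral_right) (auto simp: 0)
  finally show ?thesis by (simp add: bracket_part_def lin_sum)
qed

text \<open>Pulling evaluation through the brackets produces the left side of \<open>lin_F\<close>
  in each bidegree; summing over all bidegrees picks out the two initial values.\<close>

lemma lie_cbh_F:
  assumes H: "cbh_expression H" and N: "N \<ge> 1" "i \<le> N" "j \<le> N"
  shows "lie_cbh H N (ev_series (F_minus H)) (ev_series (F_plus H)) i j = a i j + b i j"
proof -
  let ?P = "F_minus H" and ?Q = "F_plus H"
  have cnt: "\<forall>j k. \<forall>w\<in>Poly_Mapping.keys (H j k). lie_count_a w = j \<and> lie_count_b w = k"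
    using H unfolding cbh_expression_def by blast
  note hom = bihomogeneous_F[of H]
  have "(\<Sum>p = 1..N. \<Sum>q = 1..N. cbh_part H (ev_series ?P) (ev_series ?Q) p q i j) =
      (\<Sum>p = 1..N. \<Sum>q = 1..N. \<Sum>m\<le>N. \<Sum>n\<le>N. lin (word_lie_poly ?P ?Q (H p q) m n) i j)"
    unfolding ev_word_lie_poly[OF hom, symmetric]
    by (intro sum.cong refl ev_series_superset bihomogeneous_word_lie_poly hom N)
  also have "\<dots> = (\<Sum>m\<le>N. \<Sum>n\<le>N. \<Sum>p = 1..N. \<Sum>q = 1..N. lin (word_lie_poly ?P ?Q (H p q) m n) i j)"
    by (simp only: sum.swap[of _ "{..N}" "{1..N}"])
  also have "\<dots> = (\<Sum>m\<le>N. \<Sum>n\<le>N. lin (bracket_part H ?P ?Q m n) i j)"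
    by (intro sum.cong refl lin_bracket_part cnt) auto
  finally have "lie_cbh H N (ev_series ?P) (ev_series ?Q) i j =
      (\<Sum>m\<le>N. \<Sum>n\<le>N. lin (?P m n) i j + lin (?Q m n) i j + lin (bracket_part H ?P ?Q m n) i j)"
    unfolding lie_cbh_split[OF H N(1)] ev_series_superset[OF hom(1) N(2,3)] ev_series_superset[OF hom(2) N(2,3)]
    by (simp add: sum.distrib)
  also have "\<dots> = a i j + b i j"
    unfolding lin_F[OF cnt] sum.distrib using N(1) by (simp only: sum_point le0)
  finally show ?thesis .
qed

lemma series_module: "module (series_scale scale)"
proof (rule module.intro)
  show "series_scale scale x (X + Y) = series_scale scale x X + series_scale scale x Y" for x X Y
    unfolding series_scale_def series_map_def plus_fun_def scale_right_distrib by (rule refl)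
  show "series_scale scale (x + y) X = series_scale scale x X + series_scale scale y X" for x y X
    unfolding series_scale_def series_map_def plus_fun_def scale_left_distrib by (rule refl)
  show "series_scale scale x (series_scale scale y X) = series_scale scale (x * y) X" for x y X
    unfolding series_scale_def series_map_def scale_scale by (rule refl)
  show "series_scale scale 1 X = X" for X
    unfolding series_scale_def series_map_def scale_one by (rule refl)
qed

lemma lin_F_mem: "lin (F_minus H m n) i j \<in> g_minus" "lin (F_plus H m n) i j \<in> g_plus"
  if "\<forall>j k. \<forall>w\<in>Poly_Mapping.keys (H j k). lie_count_a w = j \<and> lie_count_b w = k"
proof -
  have "lin (F_minus H m n) i j \<in> g_minus \<and> lin (F_plus H m n) i j \<in> g_plus"
  proof (cases "m = 0 \<or> n = 0")
    case True
    have "lin (if c then Poly_Mapping.single WordA 1 else 0) i j \<in> g_minus"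
      "lin (if c then Poly_Mapping.single WordB 1 else 0) i j \<in> g_plus" for c
      using subspace_0[OF subspace_g_minus] subspace_0[OF subspace_g_plus]
      by (cases c; simp add: lin_single lin_0 a_minus b_plus)+
    then show ?thesis
      unfolding F_minus_boundary[OF True] F_plus_boundary[OF True] by (rule conjI)
  next
    case False
    then have "m \<ge> 1" "n \<ge> 1" by auto
    from F_recursion[OF that this] show ?thesis
      by (simp add: lin_uminus lin_word_map proj_decomp subspace_neg subspace_g_minus subspace_g_plus)
  qed
  then show "lin (F_minus H m n) i j \<in> g_minus" "lin (F_plus H m n) i j \<in> g_plus" by auto
qed

text \<open>For the canonical series, the bidegrees left out are those of the initial value and of
  the 1/2 term, together with border components that are zero.\<close>

definition higher_part :: "(word \<Rightarrow>\<^sub>0 rat) series \<Rightarrow> 'g series" where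
  "higher_part P = graded_sum (\<lambda>m n. if m \<ge> 1 \<and> n \<ge> 1 \<and> m + n \<ge> 3 then lin (P m n) else 0)"

lemma lin_span:
  assumes "bihomogeneous P" "(m, n) \<in> D"
  shows "lin (P m n) \<in> module.span (series_scale scale) {val u | u. count_a u = m \<and> count_b u = n \<and> (m, n) \<in> D}"
  unfolding lin_def lincomb_def
  by (intro module.span_sum[OF series_module] module.span_scale[OF series_module] module.span_base[OF series_module])
    (use assms in \<open>auto simp: bihomogeneous_def\<close>)

lemma ev_series_word_space:
  "bihomogeneous P \<Longrightarrow> ev_series P \<in> word_space scale br g_minus g_plus a b"
  unfolding word_space_on_def ev_series_def
  by (intro CollectI exI[of _ "\<lambda>m n. lin (P m n)"] conjI refl allI lin_span) auto

text \<open>The set \<open>D\<close> stays variable because the remainder is needed both in the full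
  word space and in the one restricted to words with at least three letters.\<close>

lemma higher_part_word_space:
  assumes "bihomogeneous P" "{(m, n). m \<ge> 1 \<and> n \<ge> 1 \<and> m + n \<ge> 3} \<subseteq> D"
  shows "higher_part P \<in> word_space_on D scale br g_minus g_plus a b"
  unfolding word_space_on_def higher_part_def
proof (intro CollectI exI[of _ "\<lambda>m n. if m \<ge> 1 \<and> n \<ge> 1 \<and> m + n \<ge> 3 then lin (P m n) else 0"] conjI refl allI)
  fix m n
  show "(if m \<ge> 1 \<and> n \<ge> 1 \<and> m + n \<ge> 3 then lin (P m n) else 0) \<in>
      module.span (series_scale scale) {val u | u. count_a u = m \<and> count_b u = n \<and> (m, n) \<in> D}"
  proof (cases "m \<ge> 1 \<and> n \<ge> 1 \<and> m + n \<ge> 3")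
    case True
    then have "(m, n) \<in> D" using assms(2) by auto
    from lin_span[OF assms(1) this] True show ?thesis by simp
  next
    case False
    then show ?thesis by (simp only: if_False module.span_zero[OF series_module])
  qed
qed

text \<open>Stated with a letter \<open>l\<close> in bidegree \<open>(m0, n0)\<close> in order to
  serve both signs: \<open>WordA\<close> at (1, 0) and \<open>WordB\<close> at (0, 1).\<close>

lemma ev_series_split:
  assumes "bihomogeneous P" "\<And>m n. m = 0 \<or> n = 0 \<Longrightarrow> P m n = (if m = m0 \<and> n = n0 then Poly_Mapping.single l 1 else 0)"
    and "m0 + n0 = 1"
  shows "ev_series P = val l + lin (P 1 1) + higher_part P"
proof (intro ext)
  fix i j :: nat
  define N where "N = Suc (i + j)"
  have N: "i \<le> N" "j \<le> N" "1 \<le> N" "m0 \<le> N" "n0 \<le> N" using assms(3) by (auto simp: N_def)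
  let ?h = "\<lambda>m n. if m \<ge> 1 \<and> n \<ge> 1 \<and> m + n \<ge> 3 then lin (P m n) else 0"
  have split: "lin (P m n) i j = (if m = m0 then if n = n0 then val l i j else 0 else 0) +
      (if m = 1 then if n = 1 then lin (P 1 1) i j else 0 else 0) + ?h m n i j" for m n
  proof (cases "m = 0 \<or> n = 0")
    case True
    then show ?thesis unfolding assms(2)[OF True] by (auto simp: lin_0 lin_single)
  next
    case False
    then show ?thesis using assms(3) by (cases "m = 1 \<and> n = 1") auto
  qed
  have "ev_series P i j = (\<Sum>m\<le>N. \<Sum>n\<le>N. lin (P m n) i j)"
    by (rule ev_series_superset[OF assms(1) N(1,2)])
  also have "\<dots> = (\<Sum>m\<le>N. \<Sum>n\<le>N. (if m = m0 then if n = n0 then val l i j else 0 else 0) +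
      (if m = 1 then if n = 1 then lin (P 1 1) i j else 0 else 0) + ?h m n i j)"
    by (intro sum.cong refl split)
  also have "\<dots> = val l i j + lin (P 1 1) i j + (\<Sum>m\<le>N. \<Sum>n\<le>N. ?h m n i j)"
    unfolding sum.distrib by (simp only: sum_point N)
  also have "(\<Sum>m\<le>N. \<Sum>n\<le>N. ?h m n i j) = higher_part P i j"
    unfolding higher_part_def
    by (rule graded_sum_superset[symmetric]) (use N in \<open>auto simp: lin_eq_0[OF assms(1)]\<close>)
  finally show "ev_series P i j = (val l + lin (P 1 1) + higher_part P) i j" by simp
qed

text \<open>In bidegree (1, 1) the factors can only be the initial values \<open>a\<close> and
  \<open>b\<close>. Both [a, b] and [b, a] may occur in \<open>H 1 1\<close>, and antisymmetry
  combines them into the difference of coefficients that is known to be 1/2.\<close>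

lemma lin_bracket_part_1_1:
  assumes H: "cbh_expression H"
  shows "lin (bracket_part H (F_minus H) (F_plus H) 1 1) i j = scale (1 / 2) (series_bilin br a b i j)"
proof -
  have cnt: "lie_count_a w = m \<and> lie_count_b w = n" if "w \<in> Poly_Mapping.keys (H m n)" for m n w
    using H that unfolding cbh_expression_def by blast
  let ?AB = "LieBr LieA LieB" and ?BA = "LieBr LieB LieA"
  have keys: "Poly_Mapping.keys (H 1 1) \<subseteq> {?AB, ?BA}"
    using cnt lie_word_1_1 by (metis insertCI subsetI)
  have A: "lin (Poly_Mapping.single WordA 1) = a" and B: "lin (Poly_Mapping.single WordB 1) = b"
    by (auto simp: fun_eq_iff lin_single)
  have "series_bilin word_br (F_minus H) (F_plus H) 1 1 = word_br (Poly_Mapping.single WordA 1) (Poly_Mapping.single WordB 1)"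
    "series_bilin word_br (F_plus H) (F_minus H) 1 1 = word_br (Poly_Mapping.single WordB 1) (Poly_Mapping.single WordA 1)"
    by (simp_all add: series_bilin_def F_minus_boundary F_plus_boundary)
  then have ev: "lin (series_bilin word_br (F_minus H) (F_plus H) 1 1) i j = series_bilin br a b i j"
    "lin (series_bilin word_br (F_plus H) (F_minus H) 1 1) i j = - series_bilin br a b i j"
    by (simp_all add: lin_word_br A B series_bilin_antisym[of b a])
  have "lin (bracket_part H (F_minus H) (F_plus H) 1 1) i j = lin (word_lie_poly (F_minus H) (F_plus H) (H 1 1) 1 1) i j"
    by (simp add: bracket_part_def)
  also have "\<dots> = (\<Sum>w\<in>{?AB, ?BA}. scale (of_rat (Poly_Mapping.lookup (H 1 1) w))
      (lin (lie_eval (series_bilin word_br) (F_minus H) (F_plus H) w 1 1) i j))"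
    unfolding lin_word_lie_poly using keys by (intro sum_keys_superset) auto
  also have "\<dots> = scale (of_rat (Poly_Mapping.lookup (H 1 1) ?AB - Poly_Mapping.lookup (H 1 1) ?BA)) (series_bilin br a b i j)"
    using ev by (simp add: of_rat_diff scale_left_diff_distrib)
  finally show ?thesis
    unfolding cbh_expression_low_degree(3)[OF H] by (simp add: of_rat_divide)
qed

text \<open>The minus sign of the recursion is absorbed by exchanging the arguments of the bracket;
  hence \<open>br b a\<close> instead of \<open>br a b\<close>.\<close>

lemma lin_F_1_1:
  assumes H: "cbh_expression H"
  shows "lin (F_minus H 1 1) = series_scale scale (1 / 2) (series_map proj_minus (series_bilin br b a))"
    and "lin (F_plus H 1 1) = series_scale scale (1 / 2) (series_map proj_plus (series_bilin br b a))"
proof -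
  have cnt: "\<forall>j k. \<forall>w\<in>Poly_Mapping.keys (H j k). lie_count_a w = j \<and> lie_count_b w = k"
    using H unfolding cbh_expression_def by blast
  have minus: "proj_minus (- x) = - proj_minus x" "proj_plus (- x) = - proj_plus x" for x
    using proj_scale[of "-1" x] by simp_all
  show "lin (F_minus H 1 1) = series_scale scale (1 / 2) (series_map proj_minus (series_bilin br b a))"
    "lin (F_plus H 1 1) = series_scale scale (1 / 2) (series_map proj_plus (series_bilin br b a))"
    unfolding F_recursion[OF cnt order_refl order_refl] fun_eq_iff lin_uminus lin_word_map lin_bracket_part_1_1[OF H]
      series_bilin_antisym[of b a] series_scale_def series_map_def
    by (simp_all add: minus proj_scale)
qed

end

theorem theorem3p6:
  fixes scale :: "'k::field_char_0 \<Rightarrow> 'g::ab_group_add \<Rightarrow> 'g"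
    and br :: "'g \<Rightarrow> 'g \<Rightarrow> 'g"
    and g_minus g_plus :: "'g set"
    and hm hp gm gp a b :: "'g series"
    and H :: "nat \<Rightarrow> nat \<Rightarrow> lie_word \<Rightarrow>\<^sub>0 rat"
  assumes "split_lie_algebra scale br g_minus g_plus"
    and "cbh_expression H"
    and "hm \<in> series_in g_minus" and "hp \<in> series_in g_plus"
    and "gm \<in> series_in g_minus" and "gp \<in> series_in g_plus"
    and "a = s_times hm" and "b = t_times hp"
    and "uea_exp scale br (s_times gm) \<otimes>\<^bsub>series_ring (uea scale br)\<^esub> uea_exp scale br (t_times gp)
           = uea_exp scale br (a + b)"
  shows "s_times gm \<in> word_space scale br g_minus g_plus a b \<and>
    t_times gp \<in> word_space scale br g_minus g_plus a b \<and>
    s_times gm = word_series_eval scale br g_minus g_plus a b (F_minus H) \<and>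
    t_times gp = word_series_eval scale br g_minus g_plus a b (F_plus H) \<and>
    (\<exists>um up.
       s_times gm = a + series_scale scale (1 / 2)
         (series_map (proj_along g_minus g_plus) (series_bilin br b a)) + um \<and>
       t_times gp = b + series_scale scale (1 / 2)
         (series_map (proj_along g_plus g_minus) (series_bilin br b a)) + up \<and>
       um \<in> word_space scale br g_minus g_plus a b \<inter> series_in g_minus \<and>
       up \<in> word_space scale br g_minus g_plus a b \<inter> series_in g_plus \<and>
       um \<in> word_space_on {(m, n). m \<ge> 1 \<and> n \<ge> 1 \<and> m + n \<ge> 3} scale br g_minus g_plus a b \<and>
       up \<in> word_space_on {(m, n). m \<ge> 1 \<and> n \<ge> 1 \<and> m + n \<ge> 3} scale br g_minus g_plus a b)"
proof -
  interpret split_lie_algebra scale br g_minus g_plus by (fact assms(1))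
  have zero: "0 \<in> g_minus" "0 \<in> g_plus"
    using subspace_0[OF subspace_g_minus] subspace_0[OF subspace_g_plus] by auto
  have times_in: "s_times X \<in> series_in g_minus" if "X \<in> series_in g_minus" for X
    using that zero by (simp add: series_in_def s_times_def)
  have times_in': "t_times X \<in> series_in g_plus" if "X \<in> series_in g_plus" for X
    using that zero by (simp add: series_in_def t_times_def)
  interpret factorization_words scale br g_minus g_plus a b
    using times_in[OF assms(3)] times_in'[OF assms(4)]
    by unfold_locales (simp_all add: assms(7,8) series_in_def s_times_def t_times_def)
  note H = assms(2)
  have cnt: "\<forall>j k. \<forall>w\<in>Poly_Mapping.keys (H j k). lie_count_a w = j \<and> lie_count_b w = k"
    using H unfolding cbh_expression_def by blast
  note hom = bihomogeneous_F[of H] and mem = lin_F_mem[OF cnt]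
  have in_minus: "ev_series (F_minus H) \<in> series_in g_minus" "higher_part (F_minus H) \<in> series_in g_minus"
    unfolding series_in_def ev_series_def higher_part_def graded_sum_def
    by (auto intro!: subspace_sum[OF subspace_g_minus] simp: mem zero)
  have in_plus: "ev_series (F_plus H) \<in> series_in g_plus" "higher_part (F_plus H) \<in> series_in g_plus"
    unfolding series_in_def ev_series_def higher_part_def graded_sum_def
    by (auto intro!: subspace_sum[OF subspace_g_plus] simp: mem zero)
  have F_00: "ev_series (F_minus H) 0 0 = 0" "ev_series (F_plus H) 0 0 = 0"
    by (simp_all add: ev_series_def graded_sum_def F_minus_boundary F_plus_boundary lin_0)
  have X_00: "s_times gm 0 0 = 0" "t_times gp 0 0 = 0" "(a + b) 0 0 = 0"
    by (simp_all add: s_times_def t_times_def a_0 b_0)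
  have "s_times gm = ev_series (F_minus H) \<and> t_times gp = ev_series (F_plus H)"
  proof (rule factorization_unique[OF H])
    fix i j
    have "lie_cbh H (Suc (i + j)) (s_times gm) (t_times gp) i j = (a + b) i j"
      by (rule lie_cbh_eq_if_uea_exp_eq[OF H assms(9) X_00]) simp
    then show "lie_cbh H (Suc (i + j)) (s_times gm) (t_times gp) i j =
        lie_cbh H (Suc (i + j)) (ev_series (F_minus H)) (ev_series (F_plus H)) i j"
      using lie_cbh_F[OF H, of "Suc (i + j)" i j] by simp
  qed (use X_00 F_00 in_minus in_plus times_in[OF assms(5)] times_in'[OF assms(6)] in auto)
  then have eq: "s_times gm = ev_series (F_minus H)" "t_times gp = ev_series (F_plus H)" by auto
  have "ev_series (F_minus H) = val WordA + lin (F_minus H 1 1) + higher_part (F_minus H)"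
    by (rule ev_series_split[OF hom(1) F_minus_boundary]) auto
  moreover have "ev_series (F_plus H) = val WordB + lin (F_plus H 1 1) + higher_part (F_plus H)"
    by (rule ev_series_split[OF hom(2) F_plus_boundary]) auto
  ultimately have split:
    "s_times gm = a + series_scale scale (1 / 2) (series_map proj_minus (series_bilin br b a)) + higher_part (F_minus H)"
    "t_times gp = b + series_scale scale (1 / 2) (series_map proj_plus (series_bilin br b a)) + higher_part (F_plus H)"
    by (simp_all add: eq lin_F_1_1[OF H, unfolded One_nat_def])
  have "s_times gm \<in> word_space scale br g_minus g_plus a b" "t_times gp \<in> word_space scale br g_minus g_plus a b"
    unfolding eq by (intro ev_series_word_space hom)+
  moreover have "s_times gm = word_series_eval scale br g_minus g_plus a b (F_minus H)"
    "t_times gp = word_series_eval scale br g_minus g_plus a b (F_plus H)"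
    unfolding eq ev_series_eq by (rule refl)+
  \<comment> \<open>The same series is the witness for both memberships: \<open>D = UNIV\<close> for
    the word space, the smaller set for the number of occurrences.\<close>
  moreover have "higher_part P \<in> word_space scale br g_minus g_plus a b"
    "higher_part P \<in> word_space_on {(m, n). m \<ge> 1 \<and> n \<ge> 1 \<and> m + n \<ge> 3} scale br g_minus g_plus a b"
    if "bihomogeneous P" for P
    by (rule higher_part_word_space[OF that], simp)+
  ultimately show ?thesis
    using split in_minus(2) in_plus(2) hom by blast
qed

end
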